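(* For $n\ge 5$, let $\mathcal C(\Sigma_n)$ be the curve graph of the $n$-holed sphere $\Sigma_n$. The fractional chromatic number $\chi_f(\mathcal C(\Sigma_n))$ and the chromatic number $\chi(\mathcal C(\Sigma_n))$ are both $\Theta(n\log n)$.
   Context: $\Sigma_n$ is the compact sphere with $n$ boundary components (holes). A simple closed curve on a compact surface $S$ is peripheral if it is isotopic to a boundary component, and essential if it neither is peripheral nor bounds a disk. The curve graph $\mathcal C(S)$ has as vertices the isotopy classes of essential simple closed curves on $S$; two classes are adjacent if they have disjoint representatives. $\chi$ and $\chi_f$ denote the chromatic and fractional chromatic numbers. $f=O(g)$ means there is an absolute constant $C>0$ with $f\le C g$; $f=\Omega(g)$ means $g=O(f)$; $f=\Theta(g)$ means both. *)

theory Defs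
  imports "HOL-Analysis.Analysis"
begin

text \<open>A simple graph is a pair of a vertex set and a set of two-element edges.\<close>

type_synonym 'v sgraph = "'v set \<times> 'v set set"

definition proper_coloring :: "'v sgraph \<Rightarrow> nat \<Rightarrow> ('v \<Rightarrow> nat) \<Rightarrow> bool" where
  "proper_coloring G k f \<longleftrightarrow>
     f ` fst G \<subseteq> {..<k} \<and> (\<forall>u v. {u, v} \<in> snd G \<longrightarrow> f u \<noteq> f v)"

text \<open>The infimum of the empty set is \<open>\<infinity>\<close>: the value for graphs without a finite coloring.\<close>

definition chromatic_number :: "'v sgraph \<Rightarrow> enat" where
  "chromatic_number G = (INF k \<in> {k. \<exists>f. proper_coloring G k f}. enat k)"

text \<open>A \<open>b\<close>-fold coloring with \<open>a\<close> colors gives every vertex a \<open>b\<close>-element set of colors,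
  adjacent vertices receiving disjoint sets (a homomorphism into the Kneser graph
  \<open>KG(a, b)\<close>). This form of the fractional chromatic number is meaningful for
  infinite graphs as well.\<close>

definition fold_coloring :: "'v sgraph \<Rightarrow> nat \<Rightarrow> nat \<Rightarrow> ('v \<Rightarrow> nat set) \<Rightarrow> bool" where
  "fold_coloring G a b f \<longleftrightarrow>
     (\<forall>v \<in> fst G. f v \<subseteq> {..<a} \<and> card (f v) = b) \<and>
     (\<forall>u v. {u, v} \<in> snd G \<longrightarrow> f u \<inter> f v = {})"

definition fractional_chromatic_number :: "'v sgraph \<Rightarrow> ereal" where
  "fractional_chromatic_number G =
     (INF (a, b) \<in> {(a, b). 0 < b \<and> (\<exists>f. fold_coloring G a b f)}. ereal (real a / real b))"

abbreviation unit_circle :: "complex set" where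
  "unit_circle \<equiv> sphere 0 1"

text \<open>The manifold boundary of a surface: the points without an open disk neighborhood.\<close>

definition surface_boundary :: "'a::topological_space set \<Rightarrow> 'a set" where
  "surface_boundary S =
     {x \<in> S. \<nexists>U. openin (top_of_set S) U \<and> x \<in> U \<and> U homeomorphic ball (0::complex) 1}"

definition simple_closed_curve :: "'a::topological_space set \<Rightarrow> 'a set \<Rightarrow> bool" where
  "simple_closed_curve S \<gamma> \<longleftrightarrow> \<gamma> \<subseteq> S \<and> \<gamma> homeomorphic unit_circle"

text \<open>Curves are unparametrized, and an isotopy is a homotopy through embeddings of the
  circle; continuous injections of the circle into a Hausdorff space are embeddings.
  An ambient isotopy would not do, since it could never move a curve in the interior
  onto a boundary component.\<close>

definition isotopic :: "'a::topological_space set \<Rightarrow> 'a set \<Rightarrow> 'a set \<Rightarrow> bool" where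
  "isotopic S \<gamma> \<delta> \<longleftrightarrow>
     (\<exists>f g. homotopic_with_canon (\<lambda>h. inj_on h unit_circle) unit_circle S f g \<and>
            f ` unit_circle = \<gamma> \<and> g ` unit_circle = \<delta>)"

definition peripheral :: "'a::topological_space set \<Rightarrow> 'a set \<Rightarrow> bool" where
  "peripheral S \<gamma> \<longleftrightarrow> (\<exists>\<beta> \<in> components (surface_boundary S). isotopic S \<gamma> \<beta>)"

definition bounds_disk :: "'a::topological_space set \<Rightarrow> 'a set \<Rightarrow> bool" where
  "bounds_disk S \<gamma> \<longleftrightarrow>
     (\<exists>D h k. D \<subseteq> S \<and> homeomorphism (cball (0::complex) 1) D h k \<and> h ` unit_circle = \<gamma>)"

definition essential :: "'a::topological_space set \<Rightarrow> 'a set \<Rightarrow> bool" where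
  "essential S \<gamma> \<longleftrightarrow> simple_closed_curve S \<gamma> \<and> \<not> peripheral S \<gamma> \<and> \<not> bounds_disk S \<gamma>"

definition isotopy_rel :: "'a::topological_space set \<Rightarrow> ('a set \<times> 'a set) set" where
  "isotopy_rel S = {(\<gamma>, \<delta>). essential S \<gamma> \<and> essential S \<delta> \<and> isotopic S \<gamma> \<delta>}"

definition curve_classes :: "'a::topological_space set \<Rightarrow> 'a set set set" where
  "curve_classes S = {\<gamma>. essential S \<gamma>} // isotopy_rel S"

definition curve_graph :: "'a::topological_space set \<Rightarrow> 'a set set sgraph" where
  "curve_graph S =
     (curve_classes S,
      {{u, v} | u v. u \<in> curve_classes S \<and> v \<in> curve_classes S \<and> u \<noteq> v \<and>
                     (\<exists>\<gamma> \<in> u. \<exists>\<delta> \<in> v. \<gamma> \<inter> \<delta> = {})})"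

text \<open>The unit sphere of \<open>\<complex> \<times> \<real>\<close> (Euclidean 3-space) with \<open>n\<close> round open disks removed,
  centered at the \<open>n\<close>-th roots of unity on the equator. For \<open>n > 2\<close> neighboring centers have
  distance \<open>2 sin (\<pi> / n) > 2 / n\<close>, so the closed disks are disjoint.\<close>

definition std_holed_sphere :: "nat \<Rightarrow> (complex \<times> real) set" where
  "std_holed_sphere n =
     sphere 0 1 - (\<Union>k<n. ball (cis (2 * pi * real k / real n), 0) (1 / real n))"

definition holed_sphere :: "nat \<Rightarrow> (complex \<times> real) set \<Rightarrow> bool" where
  "holed_sphere n S \<longleftrightarrow> S homeomorphic std_holed_sphere n"

text \<open>Uniform (not merely asymptotic) estimates on \<open>A\<close>. The values are extended reals, so an
  upper bound by a finite function includes finiteness.\<close>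

definition bigO_on :: "'a set \<Rightarrow> ('a \<Rightarrow> ereal) \<Rightarrow> ('a \<Rightarrow> ereal) \<Rightarrow> bool" where
  "bigO_on A f g \<longleftrightarrow> (\<exists>C::real. 0 < C \<and> (\<forall>x \<in> A. f x \<le> ereal C * g x))"

definition bigTheta_on :: "'a set \<Rightarrow> ('a \<Rightarrow> ereal) \<Rightarrow> ('a \<Rightarrow> ereal) \<Rightarrow> bool" where
  "bigTheta_on A f g \<longleftrightarrow> bigO_on A f g \<and> bigO_on A g f"

end

theory Submission
  imports Defs "HOL-Complex_Analysis.Complex_Analysis"
begin

text \<open>
  Project the sphere from the centre of one hole to the plane. The surface becomes a closed disc with
  \<open>n - 1\<close> open discs removed, all centred on the real axis, and a curve in it encloses a set of holes.
  This set is an isotopy invariant, because it is read off from winding numbers about points that do not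
  belong to the surface. Both bounds are statements about these sets.

  Upper bound. An essential curve encloses at least one hole, since otherwise its inside would be a disc in
  the surface. Two disjoint curves have nested or disjoint insides, so they enclose nested or disjoint
  sets of holes, and if they are not isotopic then these sets are different. Hence it is enough to colour
  the nonempty subsets of an \<open>n\<close>-element set so that distinct sets of the same colour are
  neither nested nor disjoint. With \<open>n\<close> colours for each dyadic range of sizes this is possible
  (\<open>colouring_of_nested_or_disjoint_sets\<close>), and there are about \<open>log n\<close> ranges.

  Lower bound. A circle symmetric about the real axis encloses an interval of consecutive holes. The
  circles can be placed so that two of them meet only if their intervals cross, that is, overlap without
  being nested. A family of pairwise crossing intervals has at most as many members as the
  size of its smallest member, so if an interval of \<open>s\<close> holes has weight \<open>1 / s\<close>, then every colour
  class has weight at most \<open>1\<close>. The total weight is of the order of \<open>n\<close> times a harmonic sum, and this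
  bounds the fractional chromatic number from below.

  The analytic part of the proof is the claim that disjoint curves with the same nonempty set of enclosed holes
  are isotopic (\<open>isotopic_nested_Jordan_curves\<close>): the closed region between them contains no hole, and
  it must be swept out by embedded circles although the curves are merely continuous. A Riemann map onto
  the inside of a Jordan curve extends to a homeomorphism of the closed discs
  (\<open>Caratheodory_extension\<close>). Applied to the outer curve, this makes the outer curve the unit circle.
  Applied to the inner curve after an inversion that turns its outside into an inside, it
  gives a family of nested curves that starts at the inner curve and tends to infinity. Far out these curves
  are nearly round, and a radial map that compresses the plane into the disc turns the family into
  an isotopy to the unit circle.

  The extension theorem is proved by the length-area method: near every boundary point there is a circular
  arc with a short image. Janiszewski's theorem converts this, and later the injectivity on
  the boundary, into statements about which arcs separate the disc.
\<close>

section \<open>Colourings and weights of set systems\<close>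

lemma exists_element_of_rank:
  fixes A :: "'a::linorder set"
  assumes "finite A" "1 \<le> p" "p \<le> card A"
  shows "\<exists>x\<in>A. card {a\<in>A. a \<le> x} = p"
  using assms
proof (induction A arbitrary: p rule: finite_linorder_max_induct)
  case empty then show ?case by simp
next
  case (insert b A)
  show ?case
  proof (cases "p = card (insert b A)")
    case True
    have "{a \<in> insert b A. a \<le> b} = insert b A" using insert.hyps by force
    then show ?thesis using True by (metis insertI1)
  next
    case False
    moreover have "b \<notin> A" using insert.hyps by blast
    ultimately have "p \<le> card A" using insert.prems insert.hyps(1) by simp
    then obtain x where x: "x \<in> A" "card {a\<in>A. a \<le> x} = p" using insert.IH insert.prems by blast
    have "{a \<in> insert b A. a \<le> x} = {a \<in> A. a \<le> x}" using insert.hyps(2) x(1) by force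
    then show ?thesis using x by (intro bexI[of _ x]) auto
  qed
qed

text \<open>
  If \<open>2 ^ i \<le> card A < 2 ^ (i + 1)\<close>, the colour of \<open>A\<close> is \<open>i\<close> together with the element of \<open>A\<close> that
  has rank \<open>2 ^ (i + 1) - card A\<close>. Sets of equal colour share this element, so they are not disjoint. If
  \<open>A\<close> is a proper subset of \<open>B\<close>, the rank of a common element does not decrease from \<open>A\<close> to \<open>B\<close>, whereas
  the prescribed rank does; so nested sets cannot have equal colours either.
\<close>

lemma colouring_of_nested_or_disjoint_sets:
  assumes "n \<ge> 1"
  obtains c :: "nat set \<Rightarrow> nat" where
    "\<And>A. A \<subseteq> {..<n} \<Longrightarrow> A \<noteq> {} \<Longrightarrow> c A < n * (nat \<lfloor>log 2 (real n)\<rfloor> + 1)"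
    "\<And>A B. A \<subseteq> {..<n} \<Longrightarrow> B \<subseteq> {..<n} \<Longrightarrow> A \<noteq> {} \<Longrightarrow> B \<noteq> {} \<Longrightarrow> A \<noteq> B \<Longrightarrow>
       A \<subseteq> B \<or> B \<subseteq> A \<or> A \<inter> B = {} \<Longrightarrow> c A \<noteq> c B"
proof -
  define g where "g = (\<lambda>A::nat set. SOME i. 2^i \<le> card A \<and> card A < 2^(i+1))"
  have g: "2 ^ g A \<le> card A \<and> card A < 2 ^ (g A + 1)" if "A \<subseteq> {..<n}" "A \<noteq> {}" for A
  proof -
    have "card A \<ge> 1" using that finite_subset[of A] by (simp add: Suc_le_eq card_gt_0_iff)
    then have "\<exists>i. 2^i \<le> card A \<and> card A < 2^(i+1)" by (intro ex_power_ivl1) auto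
    then show ?thesis unfolding g_def by (rule someI_ex)
  qed
  define p where "p = (\<lambda>A. 2 ^ (g A + 1) - card A)"
  define x where "x = (\<lambda>A::nat set. SOME x. x \<in> A \<and> card {a\<in>A. a \<le> x} = p A)"
  have x: "x A \<in> A \<and> card {a\<in>A. a \<le> x A} = p A" if "A \<subseteq> {..<n}" "A \<noteq> {}" for A
  proof -
    have "1 \<le> p A" "p A \<le> card A" using g[OF that] by (auto simp: p_def)
    then have "\<exists>x. x \<in> A \<and> card {a\<in>A. a \<le> x} = p A"
      using exists_element_of_rank[of A "p A"] that finite_subset[of A "{..<n}"] by auto
    then show ?thesis unfolding x_def by (rule someI_ex)
  qed
  define c where "c = (\<lambda>A. g A * n + x A)"
  have xn: "x A < n" if "A \<subseteq> {..<n}" "A \<noteq> {}" for A using x[OF that] that by auto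
  have ne: "\<not> (g A = g B \<and> x A = x B)"
    if "A \<subseteq> {..<n}" "B \<subseteq> {..<n}" "A \<noteq> {}" "B \<noteq> {}" "A \<subset> B" for A B
  proof
    assume eq: "g A = g B \<and> x A = x B"
    have fin: "finite B" using that finite_subset by blast
    have "card A < card B" using psubset_card_mono[OF fin that(5)] .
    moreover have "p A \<le> p B"
    proof -
      have "{a\<in>A. a \<le> x A} \<subseteq> {a\<in>B. a \<le> x B}" using eq that(5) by auto
      then have "card {a\<in>A. a \<le> x A} \<le> card {a\<in>B. a \<le> x B}" using fin by (intro card_mono) auto
      then show ?thesis using x that by metis
    qed
    moreover have "card A < 2 ^ (g A + 1)" "card B < 2 ^ (g A + 1)" using g that eq by metis+
    ultimately show False using eq by (auto simp: p_def)
  qed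
  show thesis
  proof (rule that[of c])
    fix A assume A: "A \<subseteq> {..<n}" "A \<noteq> {}"
    have "card A \<le> n" using A(1) card_mono[of "{..<n}" A] by simp
    then have "2 ^ g A \<le> n" using g[OF A] by linarith
    then have "(2::real) ^ g A \<le> real n" by (metis of_nat_le_iff of_nat_numeral of_nat_power)
    then have "real (g A) \<le> log 2 (real n)"
      using assms by (simp add: le_log_iff powr_realpow)
    then have "g A \<le> nat \<lfloor>log 2 (real n)\<rfloor>" by (simp add: le_nat_floor)
    then have "g A * n + x A < nat \<lfloor>log 2 (real n)\<rfloor> * n + n"
      using xn[OF A] by (intro add_le_less_mono mult_right_mono) auto
    then show "c A < n * (nat \<lfloor>log 2 (real n)\<rfloor> + 1)" by (simp add: c_def algebra_simps)
  next
    fix A B assume AB: "A \<subseteq> {..<n}" "B \<subseteq> {..<n}" "A \<noteq> {}" "B \<noteq> {}" "A \<noteq> B"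
      "A \<subseteq> B \<or> B \<subseteq> A \<or> A \<inter> B = {}"
    show "c A \<noteq> c B"
    proof
      assume "c A = c B"
      then have "(g A * n + x A) div n = (g B * n + x B) div n" "(g A * n + x A) mod n = (g B * n + x B) mod n"
        by (simp_all add: c_def)
      then have eq: "g A = g B" "x A = x B" using xn[OF AB(1,3)] xn[OF AB(2,4)] by simp_all
      then have "A \<inter> B \<noteq> {}" using x[OF AB(1,3)] x[OF AB(2,4)] by (metis IntI empty_iff)
      then have "A \<subset> B \<or> B \<subset> A" using AB by blast
      then show False using ne eq AB by metis
    qed
  qed
qed

text \<open>
  A pair \<open>(s, i)\<close> stands for the interval \<open>{i..<i + s}\<close>. Each of the other members has exactly one end
  strictly between \<open>i\<close> and \<open>i + s\<close>. Crossing intervals have no end in common, so these ends are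
  distinct and there are at most \<open>s - 1\<close> of them.
\<close>

lemma card_le_size_of_crossing_intervals:
  fixes F :: "(nat \<times> nat) set"
  assumes fin: "finite F" and cross: "\<And>s i s' i'. (s, i) \<in> F \<Longrightarrow> (s', i') \<in> F \<Longrightarrow> (s, i) \<noteq> (s', i') \<Longrightarrow>
      i < i' \<and> i' < i + s \<and> i + s < i' + s' \<or> i' < i \<and> i < i' + s' \<and> i' + s' < i + s"
    and "(s, i) \<in> F" "0 < s"
  shows "card F \<le> s"
proof -
  define h where "h = (\<lambda>(s', i'). if i' > i then i' else i' + s')"
  have rng: "h (s', i') \<in> {i<..<i + s}" if "(s', i') \<in> F - {(s, i)}" for s' i'
    using cross[OF \<open>(s, i) \<in> F\<close>, of s' i'] that by (auto simp: h_def)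
  have "inj_on h (F - {(s, i)})"
  proof (rule inj_onI)
    fix u v assume uv: "u \<in> F - {(s, i)}" "v \<in> F - {(s, i)}" "h u = h v"
    obtain s1 i1 s2 i2 where u: "u = (s1, i1)" and v: "v = (s2, i2)" by (cases u, cases v)
    have F: "(s1, i1) \<in> F" "(s2, i2) \<in> F" and eq: "h (s1, i1) = h (s2, i2)" using uv u v by auto
    show "u = v"
    proof (rule ccontr)
      assume "u \<noteq> v"
      then have "(s1, i1) \<noteq> (s2, i2)" using u v by auto
      from cross[OF F(1,2) this] eq show False by (auto simp: h_def split: if_splits)
    qed
  qed
  then have "card (F - {(s, i)}) \<le> card {i<..<i + s}"
  proof (rule card_inj_on_le)
    show "h ` (F - {(s, i)}) \<subseteq> {i<..<i + s}"
    proof (rule image_subsetI)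
      fix u assume "u \<in> F - {(s, i)}"
      then show "h u \<in> {i<..<i + s}" using rng by (cases u) blast
    qed
  qed simp
  then show ?thesis using fin \<open>(s, i) \<in> F\<close> \<open>0 < s\<close> by (simp add: card_Diff_singleton)
qed

lemma sum_inverse_size_crossing_intervals:
  fixes F :: "(nat \<times> nat) set"
  assumes fin: "finite F" and cross: "\<And>s i s' i'. (s, i) \<in> F \<Longrightarrow> (s', i') \<in> F \<Longrightarrow> (s, i) \<noteq> (s', i') \<Longrightarrow>
      i < i' \<and> i' < i + s \<and> i + s < i' + s' \<or> i' < i \<and> i < i' + s' \<and> i' + s' < i + s"
    and pos: "\<And>s i. (s, i) \<in> F \<Longrightarrow> 0 < s"
  shows "(\<Sum>(s, i)\<in>F. 1 / real s) \<le> 1"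
proof (cases "F = {}")
  case False
  then have "card F > 0" using fin by (simp add: card_gt_0_iff)
  have "(\<Sum>(s, i)\<in>F. 1 / real s) \<le> (\<Sum>_\<in>F. 1 / real (card F))"
  proof (rule sum_mono, clarify)
    fix s i assume "(s, i) \<in> F"
    then have "card F \<le> s" using card_le_size_of_crossing_intervals[OF fin cross _ pos] by blast
    then show "1 / real s \<le> 1 / real (card F)" using \<open>card F > 0\<close> by (simp add: frac_le)
  qed
  also have "\<dots> = 1" using \<open>card F > 0\<close> by simp
  finally show ?thesis .
qed simp

text \<open>
  There are at least \<open>n / 2\<close> intervals of each size \<open>s \<le> n / 2\<close>, and the sum of their
  reciprocals \<open>1 / s\<close> is at least the logarithm of \<open>(n + 1) / 4\<close>. Bernoulli's inequality gives \<open>n \<le> ((n + 1) / 4) ^ 8\<close> for \<open>n \<ge> 5\<close>, which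
  replaces this logarithm by \<open>ln n / 8\<close>.
\<close>

lemma total_interval_weight:
  assumes "n \<ge> 5"
  shows "real n * ln (real n) / 16 \<le> (\<Sum>(s, i)\<in>(SIGMA s:{2..n div 2}. {1..n - s}). 1 / real s)"
proof -
  define m where "m = n div 2"
  have H: "ln (real (k + 1) / 2) \<le> (\<Sum>s=2..k. 1 / real s)" if "k \<ge> 1" for k
    using that
  proof (induction k rule: dec_induct)
    case base then show ?case by simp
  next
    case (step k)
    have "ln (real (Suc k + 1) / 2) = ln (real (k + 1) / 2) + ln (1 + 1 / real (Suc k))"
    proof -
      have "real (k + 1) * (1 + 1 / real (Suc k)) = real (Suc k + 1)" by (simp add: distrib_left)
      then have "real (Suc k + 1) / 2 = real (k + 1) / 2 * (1 + 1 / real (Suc k))" by simp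
      then show ?thesis by (simp only: ln_mult_pos add_pos_nonneg zero_less_one) (subst ln_mult_pos; simp add: add_pos_nonneg)
    qed
    also have "ln (1 + 1 / real (Suc k)) \<le> 1 / real (Suc k)" by (rule ln_add_one_self_le_self) simp
    finally show ?case using step by simp
  qed
  have "real n \<le> ((real n + 1) / 4) ^ 8"
  proof -
    have "1 + real 8 * ((real n - 3) / 4) \<le> (1 + (real n - 3) / 4) ^ 8"
      using assms by (intro Bernoulli_inequality) simp
    also have "1 + (real n - 3) / 4 = (real n + 1) / 4" by (simp add: field_simps)
    finally have "1 + real 8 * ((real n - 3) / 4) \<le> ((real n + 1) / 4) ^ 8" .
    moreover have "real n \<le> 1 + real 8 * ((real n - 3) / 4)"
    proof -
      have "real n \<ge> 5" using assms by simp
      then show ?thesis by (simp add: field_simps)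
    qed
    ultimately show ?thesis by linarith
  qed
  then have "ln (real n) \<le> ln (((real n + 1) / 4) ^ 8)" using assms by simp
  also have "\<dots> = 8 * ln ((real n + 1) / 4)" using assms by (simp add: ln_realpow)
  also have "ln ((real n + 1) / 4) \<le> ln (real (m + 1) / 2)"
  proof -
    have "real n \<le> 2 * real m + 1" unfolding m_def by linarith
    then have "(real n + 1) / 4 \<le> real (m + 1) / 2" by simp
    then show ?thesis by simp
  qed
  also have "\<dots> \<le> (\<Sum>s=2..m. 1 / real s)" using assms by (intro H) (simp add: m_def)
  finally have "ln (real n) / 8 \<le> (\<Sum>s=2..m. 1 / real s)" by simp
  then have "real n / 2 * (ln (real n) / 8) \<le> real n / 2 * (\<Sum>s=2..m. 1 / real s)"
    by (intro mult_left_mono) auto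
  also have "\<dots> = (\<Sum>s=2..m. real n / 2 * (1 / real s))" by (rule sum_distrib_left)
  also have "\<dots> \<le> (\<Sum>s=2..m. real (n - s) * (1 / real s))"
  proof (rule sum_mono, rule mult_right_mono)
    fix s assume "s \<in> {2..m}"
    then have "2 * s \<le> n" by (auto simp: m_def)
    then show "real n / 2 \<le> real (n - s)" by linarith
  qed simp
  also have "\<dots> = (\<Sum>s=2..m. \<Sum>i=1..n - s. 1 / real s)" by simp
  also have "\<dots> = (\<Sum>(s, i)\<in>(SIGMA s:{2..m}. {1..n - s}). 1 / real s)" by (rule sum.Sigma) auto
  finally show ?thesis by (simp add: m_def)
qed

section \<open>The area of a conformal image\<close>

text \<open>
  The change of variables formula concerns \<open>real ^ 2\<close>, while iterated integrals belong to the product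
  \<open>real \<times> real\<close>. Both carry the same measure.
\<close>

lemma lborel_real2_eq_distr_prod:
  "distr (lborel :: (real \<times> real) measure) borel (\<lambda>p. \<chi> i. if i = 1 then fst p else snd p)
     = (lborel :: (real^2) measure)"
proof (rule lborel_eqI[symmetric])
  let ?v = "\<lambda>p::real\<times>real. (\<chi> i. if i = 1 then fst p else snd p) :: real^2"
  have cont: "continuous_on UNIV ?v"
    by (intro continuous_on_vec_lambda) (case_tac "i = 1"; simp add: continuous_intros)
  have meas: "?v \<in> borel_measurable lborel"
    using borel_measurable_continuous_onI[OF cont] by simp
  fix l u :: "real^2"
  assume le: "\<And>b. b \<in> Basis \<Longrightarrow> l \<bullet> b \<le> u \<bullet> b"
  have le1: "l$1 \<le> u$1" and le2: "l$2 \<le> u$2"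
    using le[of "axis 1 1"] le[of "axis 2 1"] by (auto simp: inner_axis Basis_vec_def)
  have pre: "?v -` box l u \<inter> space lborel = box (l$1, l$2) (u$1, u$2)"
    by (auto simp: mem_box_cart forall_2 mem_box Basis_prod_def)
  have "emeasure (distr lborel borel ?v) (box l u) = emeasure lborel (box (l$1, l$2) (u$1, u$2))"
    using pre meas by (subst emeasure_distr) auto
  also have "\<dots> = (\<Prod>b\<in>Basis. ((u$1, u$2) - (l$1, l$2)) \<bullet> b)"
    using le1 le2 by (subst emeasure_lborel_box) (auto simp: Basis_prod_def)
  also have "(\<Prod>b\<in>Basis. ((u$1, u$2) - (l$1, l$2)) \<bullet> b) = (u$1 - l$1) * (u$2 - l$2)"
    by (simp add: Basis_prod_def prod.union_disjoint )
  also have "(u$1 - l$1) * (u$2 - l$2) = (\<Prod>b\<in>Basis. (u - l) \<bullet> b)"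
  proof -
    have B: "(Basis :: (real^2) set) = {axis 1 1, axis 2 1}"
      by (auto simp: Basis_vec_def UNIV_2)
    show ?thesis unfolding B by (simp add: axis_eq_axis inner_axis)
  qed
  finally show "emeasure (distr lborel borel ?v) (box l u) = (\<Prod>b\<in>Basis. (u - l) \<bullet> b)" .
qed simp

text \<open>
  The Jacobian determinant of a holomorphic map is the squared modulus of its derivative, so for an
  injective map the integral is the area of the image, which is contained in a disc of radius \<open>M\<close>.
\<close>

lemma nn_integral_deriv_squared_le_area:
  fixes f :: "complex \<Rightarrow> complex"
  assumes U: "open U" and hol: "f holomorphic_on U" and inj: "inj_on f U"
    and bd: "f ` U \<subseteq> cball 0 M"
  shows "(\<integral>\<^sup>+ s. \<integral>\<^sup>+ t. ennreal (indicator U (Complex s t) * (cmod (deriv f (Complex s t)))\<^sup>2) \<partial>lborel \<partial>lborel)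
           \<le> ennreal (measure lebesgue (cball (0::real^2) M))"
proof -
  define v where "v = (\<lambda>x::real^2. Complex (x$1) (x$2))"
  define vi where "vi = (\<lambda>z. (\<chi> i. if i = 1 then Re z else Im z) :: real^2)"
  have vvi [simp]: "v (vi z) = z" for z by (simp add: v_def vi_def)
  have viv [simp]: "vi (v x) = x" for x by (simp add: v_def vi_def vec_eq_iff forall_2)
  have linv: "bounded_linear v"
    unfolding v_def by (intro linear_linear[THEN iffD2] linearI) (auto simp: complex_eq_iff)
  have linvi: "bounded_linear vi"
    unfolding vi_def by (intro linear_linear[THEN iffD2] linearI) (auto simp: vec_eq_iff)
  define S where "S = v -` U"
  have contv: "continuous_on UNIV v" by (simp add: linv linear_continuous_on)
  have openS: "open S" unfolding S_def using U contv by (simp add: open_vimage)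
  define G where "G = (\<lambda>x. vi (f (v x)))"
  define G' where "G' = (\<lambda>x h. vi (deriv f (v x) * v h))"
  have der: "(G has_derivative G' x) (at x within S)" if "x \<in> S" for x
  proof -
    have fd: "(f has_field_derivative deriv f (v x)) (at (v x))"
      using that hol U by (auto simp: S_def holomorphic_derivI)
    have "(f has_derivative (*) (deriv f (v x))) (at (v x))"
      using fd by (simp add: has_field_derivative_def)
    from has_derivative_compose[OF bounded_linear_imp_has_derivative[OF linv] this]
    have "((\<lambda>x. f (v x)) has_derivative (\<lambda>h. deriv f (v x) * v h)) (at x)" .
    from bounded_linear.has_derivative[OF linvi this]
    have "(G has_derivative G' x) (at x)" by (simp add: G_def G'_def)
    then show ?thesis
      by (rule has_derivative_at_withinI)
  qed
  have detG: "\<bar>det (matrix (G' x))\<bar> = (cmod (deriv f (v x)))\<^sup>2" for x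
    by (simp add: det_2 matrix_def G'_def vi_def v_def axis_def cmod_power2) (simp add: power2_eq_square)
  have injG: "inj_on G S"
    using inj by (auto simp: G_def inj_on_def S_def) (metis viv vvi)
  have "open (f ` U)" using open_mapping_thm3 hol U inj by blast
  have GS: "G ` S = v -` (f ` U)"
  proof (intro equalityI subsetI)
    fix x assume "x \<in> v -` (f ` U)"
    then obtain u where u: "u \<in> U" "v x = f u" by auto
    then have "x = G (vi u)" unfolding G_def by (metis viv vvi)
    then show "x \<in> G ` S" using u by (auto simp: S_def)
  qed (auto simp: G_def S_def)
  then have "open (G ` S)" using \<open>open (f ` U)\<close> contv by (simp add: open_vimage)
  have normv: "cmod (v x) = norm x" for x
    by (simp add: v_def cmod_def norm_vec_def L2_set_def sum_2)
  have sub: "G ` S \<subseteq> cball 0 M"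
  proof
    fix y assume "y \<in> G ` S"
    then have "v y \<in> cball 0 M" using bd by (auto simp: GS)
    then show "y \<in> cball 0 M" using normv by simp
  qed
  have lmeas: "G ` S \<in> lmeasurable"
    using \<open>open (G ` S)\<close> sub by (meson bounded_cball bounded_subset lmeasurable_open)
  have Sl: "S \<in> sets lebesgue" using openS by (simp add: borel_open)
  have hi: "((\<lambda>x. \<bar>det (matrix (G' x))\<bar>) has_integral measure lebesgue (G ` S)) S"
    using has_measure_differentiable_image[OF Sl der injG] lmeas
    by blast
  define g where "g = (\<lambda>x. indicator S x * (cmod (deriv f (v x)))\<^sup>2)"
  have derc: "continuous_on U (deriv f)"
    by (simp add: U hol holomorphic_deriv holomorphic_on_imp_continuous_on)
  have gm: "g \<in> borel_measurable borel"
  proof -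
    have "continuous_on S (\<lambda>x. (cmod (deriv f (v x)))\<^sup>2)"
      by (intro continuous_intros continuous_on_compose2[OF derc] continuous_on_subset[OF contv]) (auto simp: S_def)
    then show ?thesis unfolding g_def
      using openS borel_measurable_continuous_on_indicator[of S "\<lambda>x. (cmod (deriv f (v x)))\<^sup>2"]
      by (simp add: borel_open)
  qed
  have vm: "(\<lambda>p::real\<times>real. (\<chi> i. if i = 1 then fst p else snd p) :: real^2) \<in> borel_measurable borel"
    by (intro borel_measurable_continuous_onI continuous_on_vec_lambda) (case_tac "i = 1"; simp add: continuous_intros)
  have "integral\<^sup>N lborel (\<lambda>x. ennreal (indicator S x * \<bar>det (matrix (G' x))\<bar>)) = ennreal (measure lebesgue (G ` S))"
    by (rule nn_integral_has_integral_lebesgue[OF _ hi]) auto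
  then have "integral\<^sup>N lborel (\<lambda>x. ennreal (g x)) = ennreal (measure lebesgue (G ` S))"
    using gm by (simp add: detG g_def)
  moreover have "integral\<^sup>N lborel (\<lambda>x. ennreal (g x))
     = integral\<^sup>N (lborel \<Otimes>\<^sub>M lborel) (\<lambda>p. ennreal (g (\<chi> i. if i = 1 then fst p else snd p)))"
    unfolding lborel_real2_eq_distr_prod[symmetric] lborel_prod
  proof (rule nn_integral_distr)
    show "(\<lambda>p. \<chi> i. if i = 1 then fst p else snd p) \<in> lborel \<rightarrow>\<^sub>M (borel :: (real^2) measure)"
      using vm by simp
  qed (use gm in simp)
  moreover have "\<dots> = (\<integral>\<^sup>+ s. \<integral>\<^sup>+ t. ennreal (g (\<chi> i. if i = 1 then s else t)) \<partial>lborel \<partial>lborel)"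
  proof -
    have "(\<lambda>p. g (\<chi> i. if i = 1 then fst p else snd p)) \<in> borel_measurable (lborel \<Otimes>\<^sub>M lborel)"
      using gm vm by (simp add: lborel_prod measurable_compose)
    then show ?thesis
      by (subst lborel.nn_integral_fst[symmetric]) (auto cong: if_cong)
  qed
  moreover have "g (\<chi> i. if i = 1 then s else t) = indicator U (Complex s t) * (cmod (deriv f (Complex s t)))\<^sup>2" for s t
    by (simp add: g_def S_def v_def indicator_def)
  ultimately have eq: "(\<integral>\<^sup>+ s. \<integral>\<^sup>+ t. ennreal (indicator U (Complex s t) * (cmod (deriv f (Complex s t)))\<^sup>2) \<partial>lborel \<partial>lborel)
      = ennreal (measure lebesgue (G ` S))"
    by simp
  show ?thesis
    unfolding eq using sub lmeas
    by (intro ennreal_leI measure_mono_fmeasurable) (auto simp: fmeasurableD)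
qed

text \<open>
  The Cauchy-Schwarz inequality on a segment of length at most \<open>2 * pi\<close>: the length of the image is at
  least \<open>\<eta>\<close>.
\<close>

lemma energy_of_variation_on_vertical_segment:
  fixes F :: "complex \<Rightarrow> complex"
  assumes "open U" and holF: "F holomorphic_on U" and "0 < \<eta>"
    and seg: "\<And>t. t \<in> {t1..t2} \<Longrightarrow> Complex s t \<in> U" and "t1 \<le> t2" and "t2 - t1 \<le> 2 * pi"
    and var: "\<eta> < dist (F (Complex s t1)) (F (Complex s t2))"
  shows "ennreal (\<eta>\<^sup>2 / (2 * pi)) \<le>
    (\<integral>\<^sup>+ t. ennreal (indicator U (Complex s t) * (cmod (deriv F (Complex s t)))\<^sup>2) \<partial>lborel)"
proof -
  define e where "e = \<eta>\<^sup>2 / (2 * pi)"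
  have contd: "continuous_on U (deriv F)"
    by (simp add: \<open>open U\<close> holF holomorphic_deriv holomorphic_on_imp_continuous_on)
  have Cst: "Complex s t = of_real s + \<i> * of_real t" for t by (simp add: complex_eq_iff)
  define h where "h = (\<lambda>t. cmod (deriv F (Complex s t)))"
  have conth: "continuous_on {t1..t2} (\<lambda>t. deriv F (Complex s t))"
    by (rule continuous_on_compose2[OF contd]) (auto simp: Cst seg[unfolded Cst] intro!: continuous_intros)
  have ftc: "((\<lambda>t. deriv F (Complex s t) * \<i>) has_integral (F (Complex s t2) - F (Complex s t1))) {t1..t2}"
  proof (rule fundamental_theorem_of_calculus[OF \<open>t1 \<le> t2\<close>])
    fix t assume "t \<in> {t1..t2}"
    then have "(F has_field_derivative deriv F (Complex s t)) (at (Complex s t))"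
      using holF \<open>open U\<close> seg by (auto intro: holomorphic_derivI)
    moreover have "((\<lambda>t. Complex s t) has_vector_derivative \<i>) (at t within {t1..t2})"
      unfolding Cst by (auto intro!: derivative_eq_intros)
    ultimately show "((\<lambda>t. F (Complex s t)) has_vector_derivative deriv F (Complex s t) * \<i>) (at t within {t1..t2})"
      using field_vector_diff_chain_within[of "\<lambda>t. Complex s t" \<i> t "{t1..t2}" F "deriv F (Complex s t)"]
      by (simp add: o_def has_field_derivative_at_within mult.commute)
  qed
  have hsq: "(\<lambda>t. (h t)\<^sup>2) integrable_on {t1..t2}"
    unfolding h_def by (intro integrable_continuous_interval continuous_intros conth)
  define I where "I = integral {t1..t2} (\<lambda>t. (h t)\<^sup>2)"
  \<comment> \<open>The weight \<open>\<kappa>\<close> balances the two terms of \<open>h \<le> h\<^sup>2 / (2 * \<kappa>) + \<kappa> / 2\<close>, which takes the place of Cauchy-Schwarz.\<close>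
  define \<kappa> where "\<kappa> = \<eta> / (2*pi)"
  have "\<kappa> > 0" using \<open>0 < \<eta>\<close> by (simp add: \<kappa>_def)
  have hi: "((\<lambda>t. (h t)\<^sup>2 / (2*\<kappa>) + \<kappa>/2) has_integral (I / (2*\<kappa>) + (t2-t1) * (\<kappa>/2))) {t1..t2}"
    using has_integral_add[OF has_integral_divide[OF integrable_integral[OF hsq], of "2*\<kappa>"] has_integral_const_real[of "\<kappa>/2" t1 t2]] \<open>t1 \<le> t2\<close>
    by (simp add: I_def)
  have "\<eta> < norm (F (Complex s t2) - F (Complex s t1))" using var by (simp add: dist_norm norm_minus_commute)
  also have "\<dots> \<le> I / (2*\<kappa>) + (t2-t1) * (\<kappa>/2)"
    unfolding integral_unique[OF ftc, symmetric] integral_unique[OF hi, symmetric]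
  proof (rule integral_norm_bound_integral)
    show "(\<lambda>t. deriv F (Complex s t) * \<i>) integrable_on {t1..t2}"
      "(\<lambda>t. (h t)\<^sup>2 / (2*\<kappa>) + \<kappa>/2) integrable_on {t1..t2}"
      using ftc hi by (blast intro: has_integral_integrable)+
    fix t assume "t \<in> {t1..t2}"
    have "0 \<le> (h t - \<kappa>)\<^sup>2" by simp
    then have "2 * \<kappa> * h t \<le> (h t)\<^sup>2 + \<kappa>\<^sup>2" by (simp add: power2_eq_square algebra_simps)
    then show "norm (deriv F (Complex s t) * \<i>) \<le> (h t)\<^sup>2 / (2*\<kappa>) + \<kappa>/2"
      using \<open>\<kappa> > 0\<close> by (simp add: h_def norm_mult field_simps power2_eq_square)
  qed
  also have "(t2-t1) * (\<kappa>/2) \<le> (2*pi) * (\<kappa>/2)"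
    using \<open>t2 - t1 \<le> 2 * pi\<close> \<open>\<kappa> > 0\<close> by (intro mult_right_mono) auto
  also have "\<dots> = \<eta>/2" by (simp add: \<kappa>_def)
  finally have "I / (2*\<kappa>) \<ge> \<eta>/2" by simp
  then have "I \<ge> e" using \<open>\<kappa> > 0\<close> \<open>0<\<eta>\<close> by (simp add: e_def \<kappa>_def field_simps power2_eq_square)
  have "ennreal e \<le> ennreal I" using \<open>I \<ge> e\<close> by (rule ennreal_leI)
  also have "ennreal I = (\<integral>\<^sup>+ t. ennreal (indicator {t1..t2} t * (h t)\<^sup>2) \<partial>lborel)"
    using nn_integral_has_integral_lebesgue[OF _ integrable_integral[OF hsq]] by (simp add: I_def)
  also have "\<dots> \<le> (\<integral>\<^sup>+ t. ennreal (indicator U (Complex s t) * (cmod (deriv F (Complex s t)))\<^sup>2) \<partial>lborel)"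
    by (intro nn_integral_mono ennreal_leI) (auto simp: h_def indicator_def seg)
  finally show ?thesis by (simp only: e_def)
qed

text \<open>
  In the coordinate \<open>w = ln (1 - z / \<zeta>)\<close> the circular arcs about \<open>\<zeta>\<close> are vertical segments. If
  the image of each arc of radius between \<open>\<delta>\<close> and \<open>1 / 2\<close> had diameter above \<open>\<eta>\<close>, each of these
  segments would contribute at least \<open>\<eta>\<^sup>2 / (2 * pi)\<close> to the area of the image, and together they would exceed
  it as soon as \<open>ln (1 / \<delta>)\<close> is large. The choice of \<open>\<delta>\<close> depends on \<open>M\<close> and \<open>\<eta>\<close> only, hence it serves all
  points \<open>\<zeta>\<close> at once.
\<close>

lemma small_circular_crosscut:
  fixes \<phi> :: "complex \<Rightarrow> complex"
  assumes hol: "\<phi> holomorphic_on ball 0 1" and inj: "inj_on \<phi> (ball 0 1)"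
    and bd: "\<phi> ` ball 0 1 \<subseteq> cball 0 M" and "0 < \<eta>"
  obtains \<delta> where "0 < \<delta>"
    "\<And>\<zeta>. cmod \<zeta> = 1 \<Longrightarrow> \<exists>\<rho>. \<delta> \<le> \<rho> \<and> \<rho> \<le> 1/2 \<and>
        (\<forall>z \<in> ball 0 1 \<inter> sphere \<zeta> \<rho>. \<forall>w \<in> ball 0 1 \<inter> sphere \<zeta> \<rho>. dist (\<phi> z) (\<phi> w) \<le> \<eta>)"
proof -
  define K where "K = measure lebesgue (cball (0::real^2) M)"
  define e where "e = \<eta>\<^sup>2 / (2 * pi)"
  have "0 < e" using \<open>0 < \<eta>\<close> by (simp add: e_def)
  \<comment> \<open>\<open>L\<close> is the length of the range of \<open>s = ln \<rho>\<close>; the resulting area bound \<open>e * L\<close> exceeds \<open>K\<close>.\<close>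
  define L where "L = (K + 1) / e"
  have "K \<ge> 0" by (simp add: K_def)
  then have "L > 0" using \<open>0 < e\<close> by (simp add: L_def)
  define s0 where "s0 = ln (1/2) - L"
  show thesis
  proof
    show "0 < exp s0" by simp
    fix \<zeta> :: complex assume \<zeta>: "cmod \<zeta> = 1"
    then have "\<zeta> \<noteq> 0" by auto
    show "\<exists>\<rho>. exp s0 \<le> \<rho> \<and> \<rho> \<le> 1/2 \<and>
        (\<forall>z \<in> ball 0 1 \<inter> sphere \<zeta> \<rho>. \<forall>w \<in> ball 0 1 \<inter> sphere \<zeta> \<rho>. dist (\<phi> z) (\<phi> w) \<le> \<eta>)"
    proof (rule ccontr)
      assume neg: "\<not> ?thesis"
      define U where "U = {w. \<bar>Im w\<bar> < pi \<and> cmod (1 - exp w) < 1}"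
      define F where "F = (\<lambda>w. \<phi> (\<zeta> * (1 - exp w)))"
      have "open U" unfolding U_def
        by (intro open_Collect_conj open_Collect_less continuous_intros)
      have mem: "\<zeta> * (1 - exp w) \<in> ball 0 1" if "w \<in> U" for w
        using that \<zeta> by (simp add: U_def norm_mult)
      have holF: "F holomorphic_on U"
        unfolding F_def using mem
        by (intro holomorphic_on_compose_gen[OF _ hol, unfolded o_def] holomorphic_intros) auto
      have injF: "inj_on F U"
      proof (rule inj_onI)
        fix w w' assume w: "w \<in> U" "w' \<in> U" "F w = F w'"
        then have "\<zeta> * (1 - exp w) = \<zeta> * (1 - exp w')"
          using inj_onD[OF inj] mem unfolding F_def by blast
        then have "exp w = exp w'" using \<open>\<zeta> \<noteq> 0\<close> by simp
        moreover have "Ln (exp w) = w" "Ln (exp w') = w'"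
          using w by (auto intro!: Ln_exp simp: U_def)
        ultimately show "w = w'" by metis
      qed
      have bdF: "F ` U \<subseteq> cball 0 M" using bd mem unfolding F_def by blast
      have inner: "(\<integral>\<^sup>+ t. ennreal (indicator U (Complex s t) * (cmod (deriv F (Complex s t)))\<^sup>2) \<partial>lborel) \<ge> ennreal e"
        if s: "s \<in> {s0..ln (1/2)}" for s
      proof -
        have "exp s0 \<le> exp s" "exp s \<le> 1/2"
          using s by (auto simp: ln_ge_iff)
        with neg obtain z w where zw: "z \<in> ball 0 1 \<inter> sphere \<zeta> (exp s)" "w \<in> ball 0 1 \<inter> sphere \<zeta> (exp s)"
          and d: "dist (\<phi> z) (\<phi> w) > \<eta>" by (meson not_le)
        have *: "\<exists>t. Complex s t \<in> U \<and> F (Complex s t) = \<phi> z" if z: "z \<in> ball 0 1 \<inter> sphere \<zeta> (exp s)" for z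
        proof -
          define p where "p = Ln (1 - z / \<zeta>)"
          have n: "cmod (1 - z/\<zeta>) = exp s"
          proof -
            have "1 - z/\<zeta> = (\<zeta> - z) / \<zeta>" using \<open>\<zeta> \<noteq> 0\<close> by (simp add: field_simps)
            then show ?thesis using z \<zeta> by (simp add: norm_divide dist_norm)
          qed
          then have nz: "1 - z/\<zeta> \<noteq> 0" by auto
          then have ep: "exp p = 1 - z/\<zeta>" by (simp add: p_def)
          have "cmod (z/\<zeta>) < 1" using z \<zeta> by (simp add: norm_divide)
          then have "Re (1 - z/\<zeta>) > 0" using abs_Re_le_cmod[of "z/\<zeta>"] by simp
          then have "\<bar>Im p\<bar> < pi/2" unfolding p_def using Re_Ln_pos_lt nz by blast
          moreover have "Re p = s" using n nz by (simp add: p_def)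
          moreover have "cmod (1 - exp p) < 1" using \<open>cmod (z/\<zeta>) < 1\<close> by (simp add: ep)
          moreover have "F p = \<phi> z" using \<open>\<zeta> \<noteq> 0\<close> by (simp add: F_def ep)
          ultimately show ?thesis
            by (intro exI[of _ "Im p"]) (auto simp: U_def)
        qed
        obtain t1 t2 where t: "Complex s t1 \<in> U" "Complex s t2 \<in> U" "t1 \<le> t2"
           "dist (F (Complex s t1)) (F (Complex s t2)) > \<eta>"
          using *[OF zw(1)] *[OF zw(2)] d by (metis dist_commute linear)
        have seg: "Complex s t \<in> U" if "t \<in> {t1..t2}" for t
        proof -
          have iff: "Complex s t \<in> U \<longleftrightarrow> \<bar>t\<bar> < pi \<and> exp s < 2 * cos t" for t
          proof -
            have "(cmod (1 - exp (Complex s t)))\<^sup>2 = (1 - exp s * cos t)\<^sup>2 + (exp s * sin t)\<^sup>2"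
              by (simp add: cmod_power2 Re_exp Im_exp)
            also have "\<dots> = 1 - 2 * exp s * cos t + (exp s)\<^sup>2 * ((cos t)\<^sup>2 + (sin t)\<^sup>2)"
              by algebra
            also have "(cos t)\<^sup>2 + (sin t)\<^sup>2 = 1" by simp
            finally have "(cmod (1 - exp (Complex s t)))\<^sup>2 = 1 + exp s * (exp s - 2 * cos t)"
              by (simp add: power2_eq_square algebra_simps)
            moreover have "cmod (1 - exp (Complex s t)) < 1 \<longleftrightarrow> (cmod (1 - exp (Complex s t)))\<^sup>2 < 1"
              by (simp add: power_less_one_iff)
            ultimately have "cmod (1 - exp (Complex s t)) < 1 \<longleftrightarrow> exp s * (exp s - 2 * cos t) < 0"
              by simp
            then show ?thesis by (simp add: U_def mult_less_0_iff)
          qed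
          have "\<bar>t\<bar> \<le> \<bar>t1\<bar> \<or> \<bar>t\<bar> \<le> \<bar>t2\<bar>" using that by auto
          then obtain t' where t': "t' \<in> {t1,t2}" "\<bar>t\<bar> \<le> \<bar>t'\<bar>" by blast
          then have "\<bar>t'\<bar> < pi" "exp s < 2 * cos t'" using t iff by blast+
          moreover have "cos \<bar>t'\<bar> \<le> cos \<bar>t\<bar>"
            using t' \<open>\<bar>t'\<bar> < pi\<close> by (intro cos_monotone_0_pi_le) auto
          ultimately show ?thesis using t' iff by (auto simp: cos_abs_real)
        qed
        show ?thesis
          unfolding e_def
        proof (rule energy_of_variation_on_vertical_segment[OF \<open>open U\<close> holF \<open>0 < \<eta>\<close> seg t(3) _ t(4)])
          show "t2 - t1 \<le> 2 * pi" using t(1,2) by (auto simp: U_def)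
        qed
      qed
      have "ennreal (K + 1) = ennreal e * emeasure lborel {s0..ln (1/2)}"
        using \<open>0 < e\<close> \<open>L > 0\<close> \<open>K \<ge> 0\<close> by (simp add: s0_def L_def flip: ennreal_mult)
      also have "\<dots> = (\<integral>\<^sup>+ s. ennreal e * indicator {s0..ln (1/2)} s \<partial>lborel)"
        by (subst nn_integral_cmult_indicator) auto
      also have "\<dots> \<le> (\<integral>\<^sup>+ s. \<integral>\<^sup>+ t. ennreal (indicator U (Complex s t) * (cmod (deriv F (Complex s t)))\<^sup>2) \<partial>lborel \<partial>lborel)"
        using inner by (intro nn_integral_mono) (auto simp: indicator_def)
      also have "\<dots> \<le> ennreal K"
        unfolding K_def by (rule nn_integral_deriv_squared_le_area[OF \<open>open U\<close> holF injF bdF])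
      finally show False using \<open>K \<ge> 0\<close> by simp
    qed
  qed
qed

section \<open>Jordan curves and the Caratheodory extension\<close>

definition circle_embedding :: "(complex \<Rightarrow> 'a::topological_space) \<Rightarrow> bool" where
  "circle_embedding f \<longleftrightarrow> continuous_on (sphere 0 1) f \<and> inj_on f (sphere 0 1)"

lemma circle_embedding_simple_path:
  assumes "circle_embedding f"
  shows "simple_path (f \<circ> circlepath 0 1)"
    "pathfinish (f \<circ> circlepath 0 1) = pathstart (f \<circ> circlepath 0 1)"
    "path_image (f \<circ> circlepath 0 1) = f ` sphere 0 1"
  using assms simple_path_continuous_image[of "circlepath 0 1" f]
  by (auto simp: circle_embedding_def simple_path_circlepath path_image_compose pathfinish_compose pathstart_compose)

lemma compact_circle_embedding: "circle_embedding f \<Longrightarrow> compact (f ` sphere 0 1)"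
  by (auto simp: circle_embedding_def intro: compact_continuous_image)

lemma Jordan_circle_embedding:
  fixes f :: "complex \<Rightarrow> complex"
  assumes "circle_embedding f" and "\<gamma> = f ` sphere 0 1"
  shows "inside \<gamma> \<noteq> {}" "open (inside \<gamma>)" "connected (inside \<gamma>)" "bounded (inside \<gamma>)"
    "outside \<gamma> \<noteq> {}" "open (outside \<gamma>)" "connected (outside \<gamma>)" "\<not> bounded (outside \<gamma>)"
    "frontier (inside \<gamma>) = \<gamma>" "frontier (outside \<gamma>) = \<gamma>"
    "compact \<gamma>" "connected \<gamma>" "\<gamma> \<noteq> {}"
proof -
  note sp = circle_embedding_simple_path[OF assms(1)]
  show "inside \<gamma> \<noteq> {}" "open (inside \<gamma>)" "connected (inside \<gamma>)" "bounded (inside \<gamma>)"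
    "outside \<gamma> \<noteq> {}" "open (outside \<gamma>)" "connected (outside \<gamma>)" "\<not> bounded (outside \<gamma>)"
    "frontier (inside \<gamma>) = \<gamma>" "frontier (outside \<gamma>) = \<gamma>"
    using Jordan_inside_outside[OF sp(1,2)] by (simp_all add: sp(3) assms(2))
  show "compact \<gamma>" "connected \<gamma>"
    using compact_simple_path_image[OF sp(1)] connected_simple_path_image[OF sp(1)]
    by (simp_all add: sp(3) assms(2))
  show "\<gamma> \<noteq> {}" by (auto simp: assms(2) intro: exI[of _ 1])
qed

lemma connected_subset_inside:
  assumes "connected W" "W \<inter> S = {}" "x \<in> W" "x \<in> inside S"
  shows "W \<subseteq> inside S"
proof
  fix y assume "y \<in> W"
  then have "connected_component (- S) x y"
    using assms by (auto simp: connected_component_def)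
  then show "y \<in> inside S" using assms inside_same_component by blast
qed

lemma connected_subset_outside:
  assumes "connected W" "W \<inter> S = {}" "x \<in> W" "x \<in> outside S"
  shows "W \<subseteq> outside S"
proof
  fix y assume "y \<in> W"
  then have "connected_component (- S) x y"
    using assms by (auto simp: connected_component_def)
  then show "y \<in> outside S" using assms outside_same_component by blast
qed

text \<open>
  The embedding and its inverse are uniformly continuous, so a set of small diameter comes from a
  short piece of the circle, and a short arc around that piece has a small image.
\<close>

lemma small_subset_in_small_arc:
  fixes f :: "complex \<Rightarrow> 'a::metric_space"
  assumes f: "circle_embedding f" and "0 < e"
  obtains d where "0 < d"
    "\<forall>T \<subseteq> f ` sphere 0 1. (\<forall>x\<in>T. \<forall>y\<in>T. dist x y < d) \<longrightarrow>
       (\<exists>\<sigma>. T \<subseteq> \<sigma> \<and> \<sigma> \<subseteq> f ` sphere 0 1 \<and> compact \<sigma> \<and> connected \<sigma> \<and> (\<forall>x\<in>T. \<forall>y\<in>\<sigma>. dist x y \<le> e))"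
proof -
  let ?C = "sphere (0::complex) 1"
  have cf: "continuous_on ?C f" and inj: "inj_on f ?C" using f by (auto simp: circle_embedding_def)
  have ucf: "uniformly_continuous_on ?C f"
    by (intro compact_uniformly_continuous cf) auto
  obtain d1 where "d1 > 0" and d1: "\<And>x y. x \<in> ?C \<Longrightarrow> y \<in> ?C \<Longrightarrow> dist x y < d1 \<Longrightarrow> dist (f x) (f y) < e/2"
    using ucf \<open>0 < e\<close> unfolding uniformly_continuous_on_def by (meson half_gt_zero)
  have "isCont (\<lambda>t::real. exp (\<i> * of_real t)) 0" by (intro continuous_intros)
  then obtain \<alpha>' where "\<alpha>' > 0" and \<alpha>': "\<And>t::real. \<bar>t\<bar> < \<alpha>' \<Longrightarrow> cmod (exp (\<i> * of_real t) - 1) < d1"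
    using \<open>d1 > 0\<close> unfolding continuous_at_eps_delta by (fastforce simp: dist_norm)
  define \<alpha> where "\<alpha> = \<alpha>'/2"
  have "\<alpha> > 0" and \<alpha>: "\<And>t::real. \<bar>t\<bar> \<le> \<alpha> \<Longrightarrow> cmod (exp (\<i> * of_real t) - 1) < d1"
    using \<open>\<alpha>' > 0\<close> \<alpha>' by (auto simp: \<alpha>_def)
  have "isCont Ln 1" by (intro continuous_intros) auto
  then obtain \<beta> where "\<beta> > 0" and \<beta>: "\<And>w. cmod (w - 1) < \<beta> \<Longrightarrow> cmod (Ln w) < \<alpha>"
    using \<open>\<alpha> > 0\<close> unfolding continuous_at_eps_delta by (fastforce simp: dist_norm)
  obtain g where hom: "homeomorphism ?C (f ` ?C) f g"
    using homeomorphism_compact[OF _ cf _ inj] by auto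
  then have "uniformly_continuous_on (f ` ?C) g"
    by (intro compact_uniformly_continuous compact_circle_embedding f) (auto simp: homeomorphism_def)
  then obtain d where "d > 0" and d: "\<And>x y. x \<in> f ` ?C \<Longrightarrow> y \<in> f ` ?C \<Longrightarrow> dist x y < d \<Longrightarrow> dist (g x) (g y) < \<beta>"
    unfolding uniformly_continuous_on_def using \<open>\<beta> > 0\<close> by metis
  show thesis
  proof (rule that[OF \<open>d > 0\<close>], intro allI impI)
    fix T assume T: "T \<subseteq> f ` ?C" and dT: "\<forall>x\<in>T. \<forall>y\<in>T. dist x y < d"
    show "\<exists>\<sigma>. T \<subseteq> \<sigma> \<and> \<sigma> \<subseteq> f ` ?C \<and> compact \<sigma> \<and> connected \<sigma> \<and> (\<forall>x\<in>T. \<forall>y\<in>\<sigma>. dist x y \<le> e)"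
    proof (cases "T = {}")
      case True then show ?thesis by (intro exI[of _ "{}"]) auto
    next
      case False
      then obtain a where "a \<in> T" by auto
      define x0 where "x0 = g a"
      have x0: "x0 \<in> ?C" "f x0 = a" using hom T \<open>a \<in> T\<close> by (auto simp: x0_def homeomorphism_def)
      then have "x0 \<noteq> 0" by auto
      define c where "c = (\<lambda>t::real. x0 * exp (\<i> * of_real t))"
      have cC: "c t \<in> ?C" for t using x0 by (simp add: c_def norm_mult)
      have cd: "dist x0 (c t) < d1" if "\<bar>t\<bar> \<le> \<alpha>" for t
      proof -
        have "dist x0 (c t) = cmod (x0 * (exp (\<i> * of_real t) - 1))"
          by (simp add: c_def dist_norm norm_minus_commute algebra_simps)
        then show ?thesis using \<alpha>[OF that] x0 by (simp add: norm_mult)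
      qed
      define \<sigma> where "\<sigma> = (f \<circ> c) ` {-\<alpha>..\<alpha>}"
      have cont: "continuous_on {-\<alpha>..\<alpha>} (f \<circ> c)"
        unfolding c_def using cC[unfolded c_def]
        by (intro continuous_on_compose continuous_on_subset[OF cf] continuous_intros) auto
      have near: "dist a y < e/2" if y: "y \<in> \<sigma>" for y
        using y d1[OF x0(1) cC cd] x0(2) by (auto simp: \<sigma>_def)
      have "T \<subseteq> \<sigma>"
      proof
        fix y assume "y \<in> T"
        define x where "x = g y"
        have x: "x \<in> ?C" "f x = y" using hom T \<open>y \<in> T\<close> by (auto simp: x_def homeomorphism_def)
        have "dist x x0 < \<beta>" unfolding x_def x0_def by (rule d) (use dT T \<open>a \<in> T\<close> \<open>y \<in> T\<close> in auto)
        moreover have "cmod (x / x0 - 1) = dist x x0"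
        proof -
          have "x / x0 - 1 = (x - x0) / x0" using \<open>x0 \<noteq> 0\<close> by (simp add: field_simps)
          then show ?thesis using x0 by (simp add: norm_divide dist_norm)
        qed
        ultimately have "cmod (Ln (x/x0)) < \<alpha>" using \<beta> by metis
        then have "\<bar>Im (Ln (x/x0))\<bar> \<le> \<alpha>" using abs_Im_le_cmod[of "Ln (x/x0)"] by linarith
        moreover have "c (Im (Ln (x/x0))) = x"
        proof -
          have "x / x0 \<noteq> 0" "cmod (x/x0) = 1" using x x0 by (auto simp: norm_divide)
          then have "Re (Ln (x/x0)) = 0" by (simp add: Re_Ln)
          then have "\<i> * of_real (Im (Ln (x/x0))) = Ln (x/x0)" by (simp add: complex_eq_iff)
          then have "exp (\<i> * of_real (Im (Ln (x/x0)))) = x / x0" by (simp only: exp_Ln[OF \<open>x/x0 \<noteq> 0\<close>])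
          then show ?thesis using \<open>x0 \<noteq> 0\<close> by (simp add: c_def)
        qed
        ultimately show "y \<in> \<sigma>" unfolding \<sigma>_def using x by (intro image_eqI[of _ _ "Im (Ln (x/x0))"]) auto
      qed
      moreover have "\<sigma> \<subseteq> f ` ?C" using cC by (auto simp: \<sigma>_def)
      moreover have "compact \<sigma>" "connected \<sigma>" unfolding \<sigma>_def
        by (intro compact_continuous_image connected_continuous_image cont; simp)+
      moreover have "dist x y \<le> e" if "x \<in> T" "y \<in> \<sigma>" for x y
        using near[of x] near[of y] that \<open>T \<subseteq> \<sigma>\<close> dist_triangle3[of x y a] by (force simp: dist_commute)
      ultimately show ?thesis by blast
    qed
  qed
qed

lemma Riemann_map_inverse:
  assumes hol: "\<phi> holomorphic_on ball 0 1" and inj: "inj_on \<phi> (ball 0 1)" and im: "\<phi> ` ball 0 1 = \<Omega>"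
  obtains \<psi> where "continuous_on \<Omega> \<psi>" "\<psi> ` \<Omega> = ball (0::complex) 1"
    "\<And>z. z \<in> ball 0 1 \<Longrightarrow> \<psi> (\<phi> z) = z" "\<And>w. w \<in> \<Omega> \<Longrightarrow> \<phi> (\<psi> w) = w"
proof -
  obtain \<psi> where \<psi>: "\<psi> holomorphic_on (\<phi> ` ball 0 1)" "\<And>z. z \<in> ball 0 1 \<Longrightarrow> \<psi> (\<phi> z) = z"
    using holomorphic_has_inverse[OF hol open_ball inj] by metis
  show thesis
  proof (rule that[of \<psi>])
    show "continuous_on \<Omega> \<psi>" using \<psi> im holomorphic_on_imp_continuous_on by blast
    show "\<psi> ` \<Omega> = ball 0 1" using \<psi>(2) im by (auto simp: image_iff)
    show "\<phi> (\<psi> w) = w" if "w \<in> \<Omega>" for w using that im \<psi>(2) by auto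
  qed (use \<psi> in auto)
qed

text \<open>
  Choose a circular arc \<open>C\<close> about \<open>\<zeta>\<close> with a small image, and let \<open>T\<close> be the closure of
  this image together with a small arc of \<open>\<gamma>\<close> that contains the points of \<open>\<gamma>\<close> in the closure. Then \<open>T\<close>
  lies in a small disc. A value \<open>\<phi> z\<close> outside that disc is not separated from \<open>\<phi> 0\<close> by \<open>T\<close>, nor
  by \<open>\<gamma>\<close>, and \<open>\<gamma> \<inter> T\<close> is connected; by Janiszewski's theorem \<open>\<gamma> \<union> T\<close> does not separate them.
  But \<open>C\<close> separates \<open>0\<close> from the points \<open>z\<close> near \<open>\<zeta>\<close>.
\<close>

lemma Riemann_map_small_image_near_boundary:
  fixes f \<phi> :: "complex \<Rightarrow> complex"
  assumes f: "circle_embedding f" and \<gamma>: "\<gamma> = f ` sphere 0 1"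
    and hol: "\<phi> holomorphic_on ball 0 1" and inj: "inj_on \<phi> (ball 0 1)"
    and im: "\<phi> ` ball 0 1 = inside \<gamma>"
    and "0 < \<epsilon>"
  shows "\<exists>\<delta>>0. \<forall>\<zeta>. cmod \<zeta> = 1 \<longrightarrow> (\<exists>a. \<forall>z \<in> ball 0 1 \<inter> ball \<zeta> \<delta>. dist a (\<phi> z) \<le> \<epsilon>)"
proof -
  note J = Jordan_circle_embedding[OF f \<gamma>]
  have in_compl: "inside \<gamma> \<subseteq> - \<gamma>" using inside_Un_outside[of \<gamma>] by blast
  obtain \<psi> where \<psi>: "continuous_on (inside \<gamma>) \<psi>" "\<psi> ` inside \<gamma> = ball 0 1"
    "\<And>z. z \<in> ball 0 1 \<Longrightarrow> \<psi> (\<phi> z) = z" "\<And>w. w \<in> inside \<gamma> \<Longrightarrow> \<phi> (\<psi> w) = w"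
    using Riemann_map_inverse[OF hol inj im] by metis
  obtain M where M: "\<phi> ` ball 0 1 \<subseteq> cball 0 M"
    using J(4) im bounded_iff[of "inside \<gamma>"] by (auto simp: subset_iff)
  have cont: "continuous_on (ball 0 1) \<phi>" using hol by (rule holomorphic_on_imp_continuous_on)
  have "open (\<phi> ` ball 0 (1/2))"
    by (rule open_mapping_thm3[OF holomorphic_on_subset[OF hol]]) (auto intro: inj_on_subset[OF inj])
  then obtain d0 where "d0 > 0" and d0: "ball (\<phi> 0) d0 \<subseteq> \<phi> ` ball 0 (1/2)"
    by (metis centre_in_ball half_gt_zero imageI open_contains_ball zero_less_one)
  define e where "e = min \<epsilon> (d0 / 2)"
  have "0 < e" "e < d0" "e \<le> \<epsilon>" using \<open>0 < \<epsilon>\<close> \<open>0 < d0\<close> by (auto simp: e_def)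
  obtain d where "0 < d" and d: "\<forall>T \<subseteq> \<gamma>. (\<forall>x\<in>T. \<forall>y\<in>T. dist x y < d) \<longrightarrow>
     (\<exists>\<sigma>. T \<subseteq> \<sigma> \<and> \<sigma> \<subseteq> \<gamma> \<and> compact \<sigma> \<and> connected \<sigma> \<and> (\<forall>x\<in>T. \<forall>y\<in>\<sigma>. dist x y \<le> e/2))"
    by (rule small_subset_in_small_arc[OF f half_gt_zero[OF \<open>0 < e\<close>], folded \<gamma>])
  define \<eta> where "\<eta> = min (d/2) (e/2)"
  have \<eta>: "0 < \<eta>" "\<eta> < d" "\<eta> \<le> e/2" using \<open>0 < d\<close> \<open>0 < e\<close> by (auto simp: \<eta>_def)
  obtain \<delta> where "0 < \<delta>" and \<delta>: "\<And>\<zeta>. cmod \<zeta> = 1 \<Longrightarrow> \<exists>\<rho>. \<delta> \<le> \<rho> \<and> \<rho> \<le> 1/2 \<and>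
      (\<forall>z \<in> ball 0 1 \<inter> sphere \<zeta> \<rho>. \<forall>w \<in> ball 0 1 \<inter> sphere \<zeta> \<rho>. dist (\<phi> z) (\<phi> w) \<le> \<eta>)"
    using small_circular_crosscut[OF hol inj M \<eta>(1)] by metis
  show ?thesis
  proof (intro exI[of _ \<delta>] conjI allI impI \<open>0 < \<delta>\<close>)
    fix \<zeta> :: complex assume \<zeta>: "cmod \<zeta> = 1"
    then have "\<zeta> \<noteq> 0" by auto
    obtain \<rho> where \<rho>: "\<delta> \<le> \<rho>" "\<rho> \<le> 1/2"
      "\<And>z w. z \<in> ball 0 1 \<inter> sphere \<zeta> \<rho> \<Longrightarrow> w \<in> ball 0 1 \<inter> sphere \<zeta> \<rho> \<Longrightarrow> dist (\<phi> z) (\<phi> w) \<le> \<eta>"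
      using \<delta>[OF \<zeta>] by blast
    have "\<rho> > 0" using \<rho> \<open>0 < \<delta>\<close> by linarith
    define C where "C = ball 0 1 \<inter> sphere \<zeta> \<rho>"
    define K where "K = closure (\<phi> ` C)"
    have Kd: "dist x y \<le> \<eta>" if "x \<in> K" "y \<in> K" for x y
    proof -
      have "K \<subseteq> cball x' \<eta>" if "x' \<in> \<phi> ` C" for x'
        unfolding K_def using that \<rho>(3) by (intro closure_minimal) (auto simp: C_def)
      then have "\<phi> ` C \<subseteq> cball y \<eta>" using \<open>y \<in> K\<close> by (fastforce simp: dist_commute)
      then have "K \<subseteq> cball y \<eta>" unfolding K_def by (intro closure_minimal) auto
      then show ?thesis using \<open>x \<in> K\<close> by (auto simp: dist_commute)
    qed
    have "\<zeta> * (1 - of_real \<rho>) \<in> C"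
    proof -
      have "1 - of_real \<rho> = (of_real (1 - \<rho>) :: complex)" by simp
      then have "cmod (1 - of_real \<rho>) = 1 - \<rho>" using \<rho> by (simp only: norm_of_real)
      moreover have "dist \<zeta> (\<zeta> * (1 - of_real \<rho>)) = \<rho>"
        using \<zeta> \<open>\<rho> > 0\<close> by (simp add: dist_norm algebra_simps norm_mult)
      ultimately show ?thesis using \<zeta> \<open>\<rho> > 0\<close> by (simp add: C_def norm_mult)
    qed
    then obtain c where "c \<in> C" by blast
    define a where "a = \<phi> c"
    have "a \<in> K" unfolding a_def K_def by (rule subsetD[OF closure_subset]) (use \<open>c \<in> C\<close> in auto)
    have "cmod c \<ge> 1/2"
    proof -
      have "cmod \<zeta> \<le> dist \<zeta> c + cmod c" using norm_triangle_ineq[of "\<zeta> - c" c] by (simp add: dist_norm)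
      then show ?thesis using \<open>c \<in> C\<close> \<zeta> \<rho> by (simp add: C_def)
    qed
    \<comment> \<open>The arc stays at distance at least \<open>1 / 2\<close> from \<open>0\<close>, so \<open>\<phi> 0\<close> is not in the small disc around \<open>a\<close>.\<close>
    have "a \<notin> \<phi> ` ball 0 (1/2)"
    proof
      assume "a \<in> \<phi> ` ball 0 (1/2)"
      then obtain c' where c': "c' \<in> ball 0 (1/2)" "\<phi> c = \<phi> c'" by (auto simp: a_def)
      moreover have "c' \<in> ball 0 1" "c \<in> ball 0 1" using c' \<open>c \<in> C\<close> by (auto simp: C_def)
      ultimately have "c = c'" using inj by (auto dest: inj_onD)
      then show False using c' \<open>cmod c \<ge> 1/2\<close> by simp
    qed
    then have p0: "dist a (\<phi> 0) \<ge> d0" using d0 by (force simp: dist_commute)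
    have "\<exists>\<sigma>. K \<inter> \<gamma> \<subseteq> \<sigma> \<and> \<sigma> \<subseteq> \<gamma> \<and> compact \<sigma> \<and> connected \<sigma> \<and> (\<forall>x\<in>K \<inter> \<gamma>. \<forall>y\<in>\<sigma>. dist x y \<le> e/2) \<and> (K \<inter> \<gamma> = {} \<longrightarrow> \<sigma> = {})"
    proof (cases "K \<inter> \<gamma> = {}")
      case False
      have "\<forall>x\<in>K \<inter> \<gamma>. \<forall>y\<in>K \<inter> \<gamma>. dist x y < d" using Kd \<eta>(2) by force
      then show ?thesis using d[rule_format, of "K \<inter> \<gamma>"] False by blast
    qed auto
    then obtain \<sigma> where \<sigma>: "K \<inter> \<gamma> \<subseteq> \<sigma>" "\<sigma> \<subseteq> \<gamma>" "compact \<sigma>" "connected \<sigma>"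
      "\<And>x y. x\<in>K \<inter> \<gamma> \<Longrightarrow> y\<in>\<sigma> \<Longrightarrow> dist x y \<le> e/2" "K \<inter> \<gamma> = {} \<Longrightarrow> \<sigma> = {}" by metis
    define T where "T = K \<union> \<sigma>"
    have TB: "T \<subseteq> cball a e"
    proof
      fix y assume "y \<in> T"
      then consider "y \<in> K" | "y \<in> \<sigma>" by (auto simp: T_def)
      then show "y \<in> cball a e"
      proof cases
        case 1 then show ?thesis using Kd[OF \<open>a \<in> K\<close> 1] \<eta> \<open>0 < e\<close> by simp
      next
        case 2
        then obtain x where x: "x \<in> K \<inter> \<gamma>" using \<sigma>(6) by blast
        have "dist a y \<le> dist a x + dist x y" by (rule dist_triangle)
        also have "\<dots> \<le> \<eta> + e/2" using Kd \<open>a \<in> K\<close> x \<sigma>(5)[OF x 2] by (intro add_mono) auto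
        finally show ?thesis using \<eta> by simp
      qed
    qed
    show "\<exists>a. \<forall>z \<in> ball 0 1 \<inter> ball \<zeta> \<delta>. dist a (\<phi> z) \<le> \<epsilon>"
    proof (intro exI[of _ a] ballI, rule ccontr)
      fix z assume z: "z \<in> ball 0 1 \<inter> ball \<zeta> \<delta>" and "\<not> dist a (\<phi> z) \<le> \<epsilon>"
      then have far: "\<not> dist a (\<phi> z) \<le> e" using \<open>e \<le> \<epsilon>\<close> by linarith
      have in1: "\<phi> 0 \<in> inside \<gamma>" "\<phi> z \<in> inside \<gamma>" using im z by (auto simp flip: im)
      have "connected_component (- (\<gamma> \<union> T)) (\<phi> 0) (\<phi> z)"
      proof (rule Janiszewski)
        show "compact \<gamma>" by fact
        show "closed T" unfolding T_def K_def using \<sigma>(3) by (simp add: closed_Un compact_imp_closed)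
        have "\<gamma> \<inter> T = \<sigma>" using \<sigma> by (auto simp: T_def)
        then show "connected (\<gamma> \<inter> T)" using \<sigma> by simp
        show "connected_component (- \<gamma>) (\<phi> 0) (\<phi> z)"
          unfolding connected_component_def
          by (rule exI[of _ "inside \<gamma>"]) (use J(3) in1 in_compl in simp)
        have "connected (- cball a e)" by (rule connected_complement_bounded_convex) auto
        then show "connected_component (- T) (\<phi> 0) (\<phi> z)"
          unfolding connected_component_def using TB p0 \<open>e < d0\<close> far
          by (intro exI[of _ "- cball a e"]) auto
      qed
      then obtain W where W: "connected W" "W \<inter> (\<gamma> \<union> T) = {}" "\<phi> 0 \<in> W" "\<phi> z \<in> W"
        unfolding connected_component_def by auto
      have Win: "W \<subseteq> inside \<gamma>"
        by (rule connected_subset_inside[OF W(1) _ W(3) in1(1)]) (use W in auto)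
      have con: "connected ((\<lambda>w. dist \<zeta> (\<psi> w)) ` W)"
        by (intro connected_continuous_image W continuous_intros continuous_on_subset[OF \<psi>(1) Win])
      have one: "1 \<in> (\<lambda>w. dist \<zeta> (\<psi> w)) ` W"
        using W(3) \<psi>(3)[of 0] \<zeta> by (force simp: image_iff)
      have "dist \<zeta> z \<in> (\<lambda>w. dist \<zeta> (\<psi> w)) ` W"
        using W(4) \<psi>(3)[of z] z by (force simp: image_iff)
      then have "\<rho> \<in> (\<lambda>w. dist \<zeta> (\<psi> w)) ` W"
        by (rule connectedD_interval[OF con _ one]) (use z \<rho> in auto)
      then obtain w where w: "w \<in> W" "\<rho> = dist \<zeta> (\<psi> w)" by auto
      have "\<psi> w \<in> ball 0 1" using w Win \<psi>(2) by blast
      then have "\<psi> w \<in> C" using w by (auto simp: C_def)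
      then have "w \<in> \<phi> ` C" using \<psi>(4)[of w] w Win by (metis imageI subsetD)
      then have "w \<in> K" unfolding K_def by (rule subsetD[OF closure_subset])
      then have "w \<in> T" by (simp add: T_def)
      then show False using W w by auto
    qed
  qed
qed

text \<open>
  Near the circle this is the preceding estimate, which is uniform in the boundary point; away
  from the circle it is compactness.
\<close>

lemma Riemann_map_uniformly_continuous:
  fixes f \<phi> :: "complex \<Rightarrow> complex"
  assumes f: "circle_embedding f" and \<gamma>: "\<gamma> = f ` sphere 0 1"
    and hol: "\<phi> holomorphic_on ball 0 1" and inj: "inj_on \<phi> (ball 0 1)"
    and im: "\<phi> ` ball 0 1 = inside \<gamma>"
  shows "uniformly_continuous_on (ball 0 1) \<phi>"
proof -
  have cont: "continuous_on (ball 0 1) \<phi>" using hol by (rule holomorphic_on_imp_continuous_on)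
  show ?thesis
    unfolding uniformly_continuous_on_def
  proof (intro allI impI)
    fix e :: real assume "e > 0"
    define e' where "e' = e/3"
    have e': "0 < e'" "2 * e' < e" using \<open>e > 0\<close> by (auto simp: e'_def)
    obtain \<delta>0 where "\<delta>0 > 0" and \<delta>0: "\<And>\<zeta>. cmod \<zeta> = 1 \<Longrightarrow> \<exists>a. \<forall>z \<in> ball 0 1 \<inter> ball \<zeta> \<delta>0. dist a (\<phi> z) \<le> e'"
      using Riemann_map_small_image_near_boundary[OF f \<gamma> hol inj im e'(1)] by blast
    define \<delta> where "\<delta> = min \<delta>0 1"
    have "\<delta> > 0" "\<delta> \<le> 1" using \<open>\<delta>0 > 0\<close> by (auto simp: \<delta>_def)
    have \<delta>: "\<exists>a. \<forall>z \<in> ball 0 1 \<inter> ball \<zeta> \<delta>. dist a (\<phi> z) \<le> e'" if \<zeta>: "cmod \<zeta> = 1" for \<zeta>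
    proof -
      obtain a where "\<forall>z \<in> ball 0 1 \<inter> ball \<zeta> \<delta>0. dist a (\<phi> z) \<le> e'" using \<delta>0[OF \<zeta>] by blast
      then show ?thesis by (intro exI[of _ a]) (simp add: \<delta>_def)
    qed
    have "uniformly_continuous_on (cball 0 (1 - \<delta>/2)) \<phi>"
      using \<open>\<delta> > 0\<close> by (intro compact_uniformly_continuous continuous_on_subset[OF cont]) auto
    then obtain d where "d > 0" and d: "\<And>x y. x \<in> cball 0 (1 - \<delta>/2) \<Longrightarrow> y \<in> cball 0 (1 - \<delta>/2) \<Longrightarrow> dist y x < d \<Longrightarrow> dist (\<phi> y) (\<phi> x) < e"
      unfolding uniformly_continuous_on_def using \<open>e > 0\<close> by metis
    have bdry: "dist (\<phi> y) (\<phi> x) < e"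
      if xy: "x \<in> ball 0 1" "y \<in> ball 0 1" "dist y x < \<delta>/2" "cmod x > 1 - \<delta>/2" for x y
    proof -
      have "x \<noteq> 0" using xy(4) \<open>\<delta> \<le> 1\<close> by auto
      define \<zeta> where "\<zeta> = x / of_real (cmod x)"
      have \<zeta>: "cmod \<zeta> = 1" using \<open>x \<noteq> 0\<close> by (simp add: \<zeta>_def norm_divide)
      have "dist \<zeta> x = 1 - cmod x"
      proof -
        have "\<zeta> - x = \<zeta> * of_real (1 - cmod x)" using \<open>x \<noteq> 0\<close> by (simp add: \<zeta>_def field_simps)
        then show ?thesis using \<zeta> xy(1) by (simp add: dist_norm norm_mult del: of_real_diff)
      qed
      then have "dist \<zeta> x < \<delta>/2" using xy by simp
      then have "dist \<zeta> y < \<delta>" using xy dist_triangle[of \<zeta> y x] by (simp add: dist_commute)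
      moreover have "dist \<zeta> x < \<delta>" using \<open>dist \<zeta> x < \<delta>/2\<close> \<open>\<delta> > 0\<close> by linarith
      ultimately obtain a where "dist a (\<phi> x) \<le> e'" "dist a (\<phi> y) \<le> e'"
        using \<delta>[OF \<zeta>] xy(1,2) by (metis IntI mem_ball)
      then show ?thesis using e'(2) dist_triangle3[of "\<phi> y" "\<phi> x" a] by linarith
    qed
    define d' where "d' = min d (min (\<delta>/2) (1/2))"
    show "\<exists>d>0. \<forall>x\<in>ball 0 1. \<forall>x'\<in>ball 0 1. dist x' x < d \<longrightarrow> dist (\<phi> x') (\<phi> x) < e"
    proof (intro exI[of _ d'] conjI ballI impI)
      show "d' > 0" using \<open>d > 0\<close> \<open>\<delta> > 0\<close> by (simp add: d'_def)
      fix x y :: complex assume xy: "x \<in> ball 0 1" "y \<in> ball 0 1" "dist y x < d'"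
      consider "cmod x \<le> 1 - \<delta>/2" "cmod y \<le> 1 - \<delta>/2" | "cmod x > 1 - \<delta>/2" | "cmod y > 1 - \<delta>/2"
        by linarith
      then show "dist (\<phi> y) (\<phi> x) < e"
      proof cases
        case 1 then show ?thesis using d xy by (simp add: d'_def)
      next
        case 2 then show ?thesis using bdry xy by (simp add: d'_def)
      next
        case 3 then show ?thesis using bdry[of y x] xy by (simp add: d'_def dist_commute)
      qed
    qed
  qed
qed

lemma mult_unit_circle:
  assumes "cmod c = 1"
  shows "(\<lambda>x. c * x) ` sphere 0 1 = sphere 0 1"
proof
  show "sphere 0 1 \<subseteq> (\<lambda>x. c * x) ` sphere 0 1"
  proof
    fix z :: complex assume "z \<in> sphere 0 1"
    moreover have "c \<noteq> 0" using assms by auto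
    ultimately show "z \<in> (\<lambda>x. c * x) ` sphere 0 1"
      using assms by (intro image_eqI[of _ _ "z / c"]) (auto simp: norm_divide)
  qed
qed (use assms in \<open>auto simp: norm_mult\<close>)

text \<open>
  Finitely many rotated copies of the arc cover the circle. The product of the correspondingly rotated
  functions \<open>\<Phi> - a\<close> vanishes on the whole circle, hence at the centre.
\<close>

lemma constant_on_arc_imp_value_at_centre:
  fixes \<Phi> :: "complex \<Rightarrow> complex"
  assumes cont: "continuous_on (cball 0 1) \<Phi>" and hol: "\<Phi> holomorphic_on ball 0 1"
    and \<zeta>: "cmod \<zeta> = 1" and "0 < \<alpha>"
    and const: "\<And>t. 0 < t \<Longrightarrow> t < \<alpha> \<Longrightarrow> \<Phi> (\<zeta> * exp (\<i> * of_real t)) = a"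
  shows "\<Phi> 0 = a"
proof -
  obtain N :: nat where N: "N > 0" "2*pi / real N < \<alpha>"
  proof -
    obtain n :: nat where "2*pi/\<alpha> < real n" using reals_Archimedean2 by blast
    moreover have "0 < 2*pi/\<alpha>" using \<open>0 < \<alpha>\<close> by simp
    ultimately have "real n > 0" by linarith
    moreover from this have "2*pi / real n < \<alpha>"
      using \<open>2*pi/\<alpha> < real n\<close> \<open>0 < \<alpha>\<close> by (simp add: field_simps)
    ultimately have "n > 0" "2*pi / real n < \<alpha>" by auto
    then show thesis using that by blast
  qed
  define \<omega> where "\<omega> = (\<lambda>k::nat. exp (\<i> * of_real (2*pi * real k / real N)))"
  have n\<omega>: "cmod (\<omega> k) = 1" for k by (simp add: \<omega>_def)
  define H where "H = (\<lambda>z. \<Prod>k\<in>{..N+1}. (\<Phi> (\<omega> k * z) - a))"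
  have zero: "H z = 0" if z: "cmod z = 1" for z
  proof -
    define \<beta> where "\<beta> = Arg2pi (z / \<zeta>)"
    have \<beta>: "0 \<le> \<beta>" "\<beta> < 2*pi" by (auto simp: \<beta>_def Arg2pi_ge_0 Arg2pi_lt_2pi)
    have "cmod (z/\<zeta>) = 1" using z \<zeta> by (simp add: norm_divide)
    then have "exp (\<i> * of_real \<beta>) = z / \<zeta>" by (simp add: \<beta>_def complex_norm_eq_1_exp)
    then have zb: "z = \<zeta> * exp (\<i> * of_real \<beta>)" using \<zeta> by (auto simp: field_simps)
    \<comment> \<open>The rotation by \<open>2 * pi * k / N\<close> takes \<open>z\<close> past the beginning of the arc, and by less than the length of the arc.\<close>
    define x where "x = (2*pi - \<beta>) * real N / (2*pi)"
    have "0 < x" "x \<le> real N" using \<beta> N by (auto simp: x_def field_simps)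
    define k where "k = nat \<lfloor>x\<rfloor> + 1"
    have k: "x < real k" "real k \<le> x + 1" "k \<le> N + 1"
      using \<open>0 < x\<close> \<open>x \<le> real N\<close> unfolding k_def by linarith+
    define t where "t = \<beta> + 2*pi * real k / real N - 2*pi"
    have xe: "2*pi*x / real N = 2*pi - \<beta>" using N by (simp add: x_def)
    have "2*pi*x / real N < 2*pi * real k / real N" using k N by (intro divide_strict_right_mono mult_strict_left_mono) auto
    then have "0 < t" using xe by (simp add: t_def)
    have "2*pi*real k / real N \<le> 2*pi * (x+1) / real N" using k N by (intro divide_right_mono mult_left_mono) auto
    also have "\<dots> = 2*pi - \<beta> + 2*pi / real N" using xe by (simp add: distrib_left add_divide_distrib)
    finally have "t < \<alpha>" using N by (simp add: t_def)
    have "\<omega> k * z = \<zeta> * exp (\<i> * of_real (2*pi * real k / real N) + \<i> * of_real \<beta>)"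
      by (simp add: \<omega>_def zb exp_add)
    also have "\<i> * of_real (2*pi * real k / real N) + \<i> * of_real \<beta> = \<i> * of_real t + 2 * of_real pi * \<i>"
      by (simp add: t_def algebra_simps)
    also have "exp (\<i> * of_real t + 2 * of_real pi * \<i>) = exp (\<i> * of_real t)"
      by (simp add: exp_add exp_two_pi_i)
    finally have "\<Phi> (\<omega> k * z) - a = 0" using const[OF \<open>0 < t\<close> \<open>t < \<alpha>\<close>] by simp
    then show ?thesis using k unfolding H_def by (intro prod_zero) auto
  qed
  have "cmod (H 0) \<le> 0"
  proof (rule maximum_modulus_frontier[where S = "cball 0 1" and f = H and \<xi> = 0])
    show "H holomorphic_on interior (cball 0 1)"
      unfolding H_def using n\<omega>
      by (intro holomorphic_intros holomorphic_on_compose_gen[OF _ hol, unfolded o_def]) (auto simp: norm_mult)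
    show "continuous_on (closure (cball 0 1)) H"
      unfolding H_def using n\<omega>
      by (auto intro!: continuous_intros continuous_on_compose2[OF cont] simp: norm_mult)
  qed (use zero in auto)
  then have "H 0 = 0" by simp
  then show ?thesis by (auto simp: H_def)
qed

lemma connected_circle_embedding_minus_point:
  fixes f :: "complex \<Rightarrow> complex"
  assumes f: "circle_embedding f" and \<gamma>: "\<gamma> = f ` sphere 0 1" and "a \<in> \<gamma>"
  shows "connected (\<gamma> - {a})"
proof -
  obtain x0 where x0: "cmod x0 = 1" "f x0 = a" using \<open>a \<in> \<gamma>\<close> \<gamma> by auto
    have rot: "(\<lambda>z. x0 * z) ` sphere 0 1 = sphere 0 1" by (rule mult_unit_circle[OF x0(1)])
    have f': "circle_embedding (\<lambda>z. f (x0 * z))"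
      unfolding circle_embedding_def
    proof
      show "continuous_on (sphere 0 1) (\<lambda>z. f (x0 * z))"
      proof -
        have "continuous_on (sphere 0 1) f" using f by (simp add: circle_embedding_def)
        moreover have "continuous_on (sphere 0 1) (\<lambda>z. x0 * z)" by (intro continuous_intros)
        ultimately show ?thesis by (rule continuous_on_compose2) (simp add: rot)
      qed
      show "inj_on (\<lambda>z. f (x0 * z)) (sphere 0 1)"
      proof (rule inj_onI)
        fix x y assume xy: "x \<in> sphere 0 1" "y \<in> sphere 0 1" "f (x0 * x) = f (x0 * y)"
        have "inj_on f (sphere 0 1)" using f by (simp add: circle_embedding_def)
        from inj_onD[OF this xy(3)] have "x0 * x = x0 * y"
          using xy(1,2) x0(1) by (simp add: norm_mult)
        then show "x = y" using x0 by auto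
      qed
    qed
    have "(\<lambda>z. f (x0 * z)) ` sphere 0 1 = f ` (\<lambda>z. x0 * z) ` sphere 0 1" by (simp add: image_image)
    then have "(\<lambda>z. f (x0 * z)) ` sphere 0 1 = \<gamma>" by (simp only: rot \<gamma>)
    moreover have "pathstart ((\<lambda>z. f (x0 * z)) \<circ> circlepath 0 1) = a"
      using x0 by (simp add: pathstart_compose)
    ultimately show ?thesis
      using connected_simple_path_endless[OF circle_embedding_simple_path(1)[OF f']]
        circle_embedding_simple_path(2,3)[OF f'] by simp
qed

text \<open>
  Suppose that \<open>\<zeta>\<close> and \<open>\<zeta>'\<close> are different and have the common value \<open>a\<close>. The two radii to them cut
  the disc into two sectors, and as \<open>\<Phi>\<close> is not constant on an arc, each sector has a boundary point with value
  different from \<open>a\<close>. Half radii to two such points have images that can be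
  joined along \<open>\<gamma> - {a}\<close> without meeting the image \<open>Jc\<close> of the two full radii. Since \<open>\<gamma>\<close> and \<open>Jc\<close> have only
  \<open>a\<close> in common, Janiszewski's theorem joins the midpoints in the complement of \<open>\<gamma> \<union> Jc\<close>, which
  contradicts their lying in different sectors.
\<close>

lemma boundary_values_injective:
  fixes f \<Phi> :: "complex \<Rightarrow> complex"
  assumes f: "circle_embedding f" and \<gamma>: "\<gamma> = f ` sphere 0 1"
    and cont: "continuous_on (cball 0 1) \<Phi>" and hol\<Phi>: "\<Phi> holomorphic_on ball 0 1"
    and injb: "inj_on \<Phi> (ball 0 1)" and im: "\<Phi> ` ball 0 1 = inside \<gamma>"
    and sphere_sub: "\<And>z. cmod z = 1 \<Longrightarrow> \<Phi> z \<in> \<gamma>"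
    and \<zeta>: "cmod \<zeta> = 1" and \<zeta>': "cmod \<zeta>' = 1" and eq: "\<Phi> \<zeta> = \<Phi> \<zeta>'"
  shows "\<zeta> = \<zeta>'"
proof (rule ccontr)
  note J = Jordan_circle_embedding[OF f \<gamma>]
  have in_compl: "inside \<gamma> \<subseteq> - \<gamma>" using inside_Un_outside[of \<gamma>] by blast
  obtain \<psi> where \<psi>: "continuous_on (inside \<gamma>) \<psi>" "\<psi> ` inside \<gamma> = ball 0 1"
    "\<And>z. z \<in> ball 0 1 \<Longrightarrow> \<psi> (\<Phi> z) = z" "\<And>w. w \<in> inside \<gamma> \<Longrightarrow> \<Phi> (\<psi> w) = w"
    using Riemann_map_inverse[OF hol\<Phi> injb im] by metis
  have inball: "\<Phi> z \<in> inside \<gamma> \<longleftrightarrow> cmod z < 1" if "cmod z \<le> 1" for z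
  proof
    assume "\<Phi> z \<in> inside \<gamma>" then have "\<Phi> z \<notin> \<gamma>" using in_compl by blast
    then have "cmod z \<noteq> 1" using sphere_sub[of z] by blast
    then show "cmod z < 1" using that by linarith
  next
    assume "cmod z < 1" then show "\<Phi> z \<in> inside \<gamma>" using im by auto
  qed
  assume ne: "\<zeta> \<noteq> \<zeta>'"
  define a where "a = \<Phi> \<zeta>"
  have "a \<in> \<gamma>" using sphere_sub \<zeta> by (simp add: a_def)
  have "\<zeta> \<noteq> 0" "\<zeta>' \<noteq> 0" using \<zeta> \<zeta>' by auto
  define e where "e = (\<lambda>t::real. exp (\<i> * of_real t))"
  have ne1: "cmod (e t) = 1" for t by (simp add: e_def)
  have e_add: "e (s + t) = e s * e t" for s t by (simp add: e_def exp_add distrib_left)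
  define \<alpha> where "\<alpha> = Arg2pi (\<zeta>' / \<zeta>)"
  have "cmod (\<zeta>'/\<zeta>) = 1" using \<zeta> \<zeta>' by (simp add: norm_divide)
  then have "e \<alpha> = \<zeta>' / \<zeta>" unfolding \<alpha>_def e_def by (simp add: complex_norm_eq_1_exp)
  then have \<zeta>'e: "\<zeta>' = \<zeta> * e \<alpha>" using \<open>\<zeta> \<noteq> 0\<close> by simp
  have "\<alpha> \<noteq> 0" using ne \<zeta>'e by (auto simp: e_def)
  then have \<alpha>: "0 < \<alpha>" "\<alpha> < 2*pi" using Arg2pi_ge_0[of "\<zeta>'/\<zeta>"] Arg2pi_lt_2pi[of "\<zeta>'/\<zeta>"] by (auto simp: \<alpha>_def)
  have "\<Phi> 0 \<noteq> a" using inball[of 0] \<open>a \<in> \<gamma>\<close> in_compl by auto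
  obtain t1 where t1: "0 < t1" "t1 < \<alpha>" "\<Phi> (\<zeta> * e t1) \<noteq> a"
    using constant_on_arc_imp_value_at_centre[OF cont hol\<Phi> \<zeta> \<alpha>(1)] \<open>\<Phi> 0 \<noteq> a\<close> unfolding e_def by metis
  have "0 < 2*pi - \<alpha>" using \<alpha> by simp
  then obtain t where t: "0 < t" "t < 2*pi - \<alpha>" "\<Phi> (\<zeta>' * e t) \<noteq> a"
    using constant_on_arc_imp_value_at_centre[OF cont hol\<Phi> \<zeta>'] \<open>\<Phi> 0 \<noteq> a\<close> unfolding e_def by metis
  define t2 where "t2 = \<alpha> + t"
  have t2: "\<alpha> < t2" "t2 < 2*pi" "\<Phi> (\<zeta> * e t2) \<noteq> a"
    using t by (auto simp: t2_def \<zeta>'e e_add mult.assoc)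
  define R where "R = closed_segment 0 \<zeta> \<union> closed_segment 0 \<zeta>'"
  define Jc where "Jc = \<Phi> ` R"
  have Rball: "R \<subseteq> cball 0 1" unfolding R_def using \<zeta> \<zeta>' by (simp add: closed_segment_subset)
  have "compact Jc" unfolding Jc_def R_def using Rball[unfolded R_def]
    by (intro compact_continuous_image continuous_on_subset[OF cont]) auto
  have seg: "x \<in> closed_segment 0 y \<longleftrightarrow> (\<exists>u. 0 \<le> u \<and> u \<le> 1 \<and> x = of_real u * y)" for x y :: complex
    by (auto simp: closed_segment_def scaleR_conv_of_real)
  have Rs: "x = \<zeta> \<or> x = \<zeta>'" if "x \<in> R" "cmod x = 1" for x
    using that \<zeta> \<zeta>' by (auto simp: R_def seg norm_mult)
  have J\<gamma>: "\<gamma> \<inter> Jc = {a}"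
  proof
    show "\<gamma> \<inter> Jc \<subseteq> {a}"
    proof
      fix y assume "y \<in> \<gamma> \<inter> Jc"
      then obtain x where x: "x \<in> R" "y = \<Phi> x" "y \<in> \<gamma>" by (auto simp: Jc_def)
      then have "cmod x = 1" using inball[of x] Rball in_compl by force
      then show "y \<in> {a}" using Rs x eq by (auto simp: a_def)
    qed
    show "{a} \<subseteq> \<gamma> \<inter> Jc" using \<open>a \<in> \<gamma>\<close> by (auto simp: Jc_def a_def R_def)
  qed
  have conn_del: "connected (\<gamma> - {a})" by (rule connected_circle_embedding_minus_point[OF f \<gamma> \<open>a \<in> \<gamma>\<close>])
  define \<xi> where "\<xi> = (\<lambda>s. \<zeta> * e s)"
  have n\<xi>: "cmod (\<xi> s) = 1" for s using \<zeta> by (simp add: \<xi>_def norm_mult ne1)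
  have \<xi>0: "\<xi> 0 = \<zeta>" "\<xi> \<alpha> = \<zeta>'" by (simp_all add: \<xi>_def \<zeta>'e) (simp add: e_def)
  define g where "g = (\<lambda>s. \<Phi> ` closed_segment (\<xi> s / 2) (\<xi> s))"
  have offR: "of_real u * \<xi> s \<notin> R" if "0 < u" "0 < s" "s < 2*pi" "s \<noteq> \<alpha>" for u s
  proof
    assume "of_real u * \<xi> s \<in> R"
    then obtain v b where vb: "b = 0 \<or> b = \<alpha>" "0 \<le> v" "of_real u * \<xi> s = of_real v * \<xi> b"
      unfolding R_def Un_iff seg using \<xi>0 by metis
    have "u = v"
    proof -
      have "cmod (of_real u * \<xi> s) = cmod (of_real v * \<xi> b)" using vb by simp
      then show ?thesis using vb(2) that(1) by (simp add: norm_mult n\<xi>)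
    qed
    then have "e s = e b" using vb that \<open>\<zeta> \<noteq> 0\<close> by (auto simp: \<xi>_def)
    moreover have "Arg2pi (e s) = s" "Arg2pi (e b) = b"
      using that(2,3) vb(1) \<alpha> by (auto intro!: Arg2pi_unique[where r = 1] simp: e_def)
    ultimately have "s = b" by metis
    then show False using vb(1) that(2,4) by auto
  qed
  have segpt: "\<exists>u. 1/2 \<le> u \<and> u \<le> 1 \<and> x = of_real u * \<xi> s" if "x \<in> closed_segment (\<xi> s / 2) (\<xi> s)" for x s
  proof -
    from that obtain u where u: "0 \<le> u" "u \<le> 1" "x = (1 - u) *\<^sub>R (\<xi> s / 2) + u *\<^sub>R \<xi> s"
      by (auto simp: closed_segment_def)
    then have "x = of_real ((1 + u)/2) * \<xi> s" by (simp add: scaleR_conv_of_real field_simps)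
    then show ?thesis using u by (intro exI[of _ "(1+u)/2"]) auto
  qed
  have g: "connected (g s)" "g s \<inter> Jc = {}" "\<Phi> (\<xi> s / 2) \<in> g s" "\<Phi> (\<xi> s) \<in> g s"
    if s: "0 < s" "s < 2*pi" "s \<noteq> \<alpha>" "\<Phi> (\<xi> s) \<noteq> a" for s
  proof -
    have sub: "closed_segment (\<xi> s / 2) (\<xi> s) \<subseteq> cball 0 1"
      using n\<xi> by (intro closed_segment_subset) (auto simp: norm_divide)
    show "connected (g s)" unfolding g_def
      by (intro connected_continuous_image continuous_on_subset[OF cont sub]) auto
    show "\<Phi> (\<xi> s / 2) \<in> g s" "\<Phi> (\<xi> s) \<in> g s" by (auto simp: g_def)
    show "g s \<inter> Jc = {}"
    proof (rule ccontr)
      assume "g s \<inter> Jc \<noteq> {}"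
      then obtain x r where x: "x \<in> closed_segment (\<xi> s / 2) (\<xi> s)" and r: "r \<in> R" and xr: "\<Phi> x = \<Phi> r"
        by (auto simp: g_def Jc_def)
      obtain u where u: "1/2 \<le> u" "u \<le> 1" "x = of_real u * \<xi> s" using segpt[OF x] by blast
      then have cx: "cmod x = u" by (simp add: norm_mult n\<xi>)
      show False
      proof (cases "u = 1")
        case True
        then have "\<Phi> x = \<Phi> (\<xi> s)" using u by simp
        moreover have "\<Phi> (\<xi> s) \<in> \<gamma>" using sphere_sub n\<xi> by blast
        moreover have "\<Phi> r \<in> Jc" using r by (simp add: Jc_def)
        ultimately have "\<Phi> (\<xi> s) \<in> \<gamma> \<inter> Jc" using xr by simp
        then show False using J\<gamma> s(4) by blast
      next
        case False
        then have "cmod x < 1" using u cx by simp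
        then have "\<Phi> r \<in> inside \<gamma>" using inball[of x] xr by auto
        then have "cmod r < 1" using inball[of r] Rball r by auto
        then have "x = r" using injb xr \<open>cmod x < 1\<close> by (auto dest: inj_onD)
        then show False using offR[of u s] u s r by auto
      qed
    qed
  qed
  have s1: "0 < t1" "t1 < 2*pi" "t1 \<noteq> \<alpha>" "\<Phi> (\<xi> t1) \<noteq> a" and s2: "0 < t2" "t2 < 2*pi" "t2 \<noteq> \<alpha>" "\<Phi> (\<xi> t2) \<noteq> a"
    using t1 t2 \<alpha> by (auto simp: \<xi>_def)
  have \<xi>\<gamma>: "\<Phi> (\<xi> t1) \<in> \<gamma> - {a}" "\<Phi> (\<xi> t2) \<in> \<gamma> - {a}"
    using sphere_sub n\<xi> s1 s2 by auto
  have hin: "\<Phi> (\<xi> s / 2) \<in> inside \<gamma>" for s using inball[of "\<xi> s / 2"] n\<xi> by (simp add: norm_divide)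
  have "connected_component (- (\<gamma> \<union> Jc)) (\<Phi> (\<xi> t1 / 2)) (\<Phi> (\<xi> t2 / 2))"
  proof (rule Janiszewski)
    show "compact \<gamma>" by fact
    show "closed Jc" using \<open>compact Jc\<close> by (rule compact_imp_closed)
    show "connected (\<gamma> \<inter> Jc)" by (simp add: J\<gamma>)
    show "connected_component (- \<gamma>) (\<Phi> (\<xi> t1 / 2)) (\<Phi> (\<xi> t2 / 2))"
      unfolding connected_component_def
      by (rule exI[of _ "inside \<gamma>"]) (use J(3) hin in_compl in simp)
    have "g t1 \<inter> (\<gamma> - {a}) \<noteq> {}" using g(4)[OF s1] \<xi>\<gamma>(1) by blast
    then have "connected (g t1 \<union> (\<gamma> - {a}))"
      by (rule connected_Un[OF g(1)[OF s1] conn_del])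
    moreover have "(g t1 \<union> (\<gamma> - {a})) \<inter> g t2 \<noteq> {}" using g(4)[OF s2] \<xi>\<gamma>(2) by blast
    ultimately have "connected (g t1 \<union> (\<gamma> - {a}) \<union> g t2)"
      by (metis connected_Un g(1)[OF s2])
    then show "connected_component (- Jc) (\<Phi> (\<xi> t1 / 2)) (\<Phi> (\<xi> t2 / 2))"
      unfolding connected_component_def using g(2,3)[OF s1] g(2,3)[OF s2] J\<gamma>
      by (intro exI[of _ "g t1 \<union> (\<gamma> - {a}) \<union> g t2"]) auto
  qed
  then obtain W where W: "connected W" "W \<inter> (\<gamma> \<union> Jc) = {}" "\<Phi> (\<xi> t1 / 2) \<in> W" "\<Phi> (\<xi> t2 / 2) \<in> W"
    unfolding connected_component_def by auto
  have Win: "W \<subseteq> inside \<gamma>"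
    by (rule connected_subset_inside[OF W(1) _ W(3) hin]) (use W in auto)
  define X where "X = \<psi> ` W"
  have "connected X" unfolding X_def
    by (intro connected_continuous_image W continuous_on_subset[OF \<psi>(1) Win])
  have XR: "x \<notin> R" and Xb: "cmod x < 1" if xX: "x \<in> X" for x
  proof -
    obtain w where w: "w \<in> W" "x = \<psi> w" using xX by (auto simp: X_def)
    show "cmod x < 1" using w Win \<psi>(2) by (metis image_eqI mem_ball_0 subsetD)
    then have "\<Phi> x = w" using w \<psi>(4)[of w] Win by auto
    then have "x \<in> R \<Longrightarrow> w \<in> Jc" by (auto simp: Jc_def)
    then show "x \<notin> R" using W(2) w(1) by blast
  qed
  have half: "\<xi> s / 2 \<in> X" if "\<Phi> (\<xi> s / 2) \<in> W" for s
  proof -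
    have "\<xi> s / 2 \<in> ball 0 1" using n\<xi> by (simp add: norm_divide)
    then have "\<psi> (\<Phi> (\<xi> s / 2)) = \<xi> s / 2" by (rule \<psi>(3))
    then show ?thesis using that unfolding X_def by (metis image_eqI)
  qed
  have nonneg: "x / \<zeta> \<notin> \<real>\<^sub>\<ge>\<^sub>0" if "x \<in> X" for x
  proof
    assume "x / \<zeta> \<in> \<real>\<^sub>\<ge>\<^sub>0"
    then obtain u where u: "0 \<le> u" "x / \<zeta> = of_real u" by (auto elim: nonneg_Reals_cases)
    then have x: "x = of_real u * \<zeta>" using \<open>\<zeta> \<noteq> 0\<close> by (simp add: field_simps)
    then have "cmod x = u" using u \<zeta> by (simp add: norm_mult)
    then have "x \<in> R" using x u Xb[OF that] by (auto simp: R_def seg)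
    then show False using XR that by blast
  qed
  \<comment> \<open>Measured from \<open>\<zeta>\<close>, the angle is continuous off the first radius; on the connected set \<open>X\<close> it cannot jump over the angle \<open>\<alpha>\<close> of the second.\<close>
  have "continuous_on X (\<lambda>x. Arg2pi (x / \<zeta>))"
  proof (rule continuous_at_imp_continuous_on, rule ballI)
    fix x assume "x \<in> X"
    then have "isCont Arg2pi (x / \<zeta>)" using nonneg continuous_at_Arg2pi by blast
    then show "isCont (\<lambda>x. Arg2pi (x / \<zeta>)) x"
      using isCont_o2[of x "\<lambda>x. x / \<zeta>" Arg2pi] by (auto intro: continuous_intros simp: \<open>\<zeta> \<noteq> 0\<close>)
  qed
  then have con: "connected ((\<lambda>x. Arg2pi (x / \<zeta>)) ` X)" using \<open>connected X\<close> by (intro connected_continuous_image)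
  have arg: "Arg2pi (\<xi> s / 2 / \<zeta>) = s" if "0 < s" "s < 2*pi" for s
    using that \<open>\<zeta> \<noteq> 0\<close> by (intro Arg2pi_unique[where r = "1/2"]) (auto simp: \<xi>_def e_def)
  have "t1 \<in> (\<lambda>x. Arg2pi (x / \<zeta>)) ` X" "t2 \<in> (\<lambda>x. Arg2pi (x / \<zeta>)) ` X"
    using arg[of t1] arg[of t2] s1 s2 half W by (metis image_eqI)+
  then have "\<alpha> \<in> (\<lambda>x. Arg2pi (x / \<zeta>)) ` X"
    by (rule connectedD_interval[OF con]) (use t1 t2 in auto)
  then obtain x where x: "x \<in> X" "\<alpha> = Arg2pi (x / \<zeta>)" by auto
  have "x / \<zeta> = of_real (cmod (x/\<zeta>)) * e \<alpha>" unfolding x(2) e_def by (rule Arg2pi_eq)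
  then have "x = of_real (cmod x) * \<zeta>'" using \<zeta> \<open>\<zeta> \<noteq> 0\<close> by (simp add: \<zeta>'e norm_divide field_simps)
  then have "x \<in> R" using Xb[OF x(1)] unfolding R_def seg Un_iff by (metis norm_ge_zero less_imp_le)
  then show False using XR x by blast
qed

text \<open>
  Uniform continuity gives the extension. It takes the circle to \<open>\<gamma>\<close>, because the inverse of \<open>\<phi>\<close> is continuous on
  the inside and a boundary point cannot be one of its values; by compactness no point of \<open>\<gamma>\<close> is missed.
\<close>

theorem Caratheodory_extension:
  fixes f \<phi> :: "complex \<Rightarrow> complex"
  assumes f: "circle_embedding f" and \<gamma>: "\<gamma> = f ` sphere 0 1"
    and hol: "\<phi> holomorphic_on ball 0 1" and inj: "inj_on \<phi> (ball 0 1)"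
    and im: "\<phi> ` ball 0 1 = inside \<gamma>"
  obtains \<Phi> where "continuous_on (cball 0 1) \<Phi>" "inj_on \<Phi> (cball 0 1)"
    "\<And>z. z \<in> ball 0 1 \<Longrightarrow> \<Phi> z = \<phi> z" "\<Phi> ` sphere 0 1 = \<gamma>"
proof -
  note J = Jordan_circle_embedding[OF f \<gamma>]
  have in_compl: "inside \<gamma> \<subseteq> - \<gamma>" using inside_Un_outside[of \<gamma>] by blast
  obtain \<psi> where \<psi>: "continuous_on (inside \<gamma>) \<psi>" "\<psi> ` inside \<gamma> = ball 0 1"
    "\<And>z. z \<in> ball 0 1 \<Longrightarrow> \<psi> (\<phi> z) = z" "\<And>w. w \<in> inside \<gamma> \<Longrightarrow> \<phi> (\<psi> w) = w"
    using Riemann_map_inverse[OF hol inj im] by metis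
  obtain \<Phi> where "uniformly_continuous_on (closure (ball 0 1)) \<Phi>" and ext: "\<And>z. z \<in> ball 0 1 \<Longrightarrow> \<phi> z = \<Phi> z"
    using uniformly_continuous_on_extension_on_closure[OF Riemann_map_uniformly_continuous[OF f \<gamma> hol inj im]] by metis
  then have cont: "continuous_on (cball 0 1) \<Phi>"
    by (simp add: uniformly_continuous_imp_continuous)
  have hol\<Phi>: "\<Phi> holomorphic_on ball 0 1" using hol ext by (metis holomorphic_transform)
  have clo: "closure (inside \<gamma>) = inside \<gamma> \<union> \<gamma>"
    using J(9) by (metis closure_Un_frontier)
  have ball_im: "\<Phi> ` ball 0 1 = inside \<gamma>" using im ext by (auto simp: image_iff)
  have cball_im: "\<Phi> ` cball 0 1 = inside \<gamma> \<union> \<gamma>"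
  proof
    have "\<Phi> ` closure (ball 0 1) \<subseteq> closure (\<Phi> ` ball 0 1)"
      by (rule continuous_image_closure_subset[of "cball 0 1"]) (use cont in auto)
    then show "\<Phi> ` cball 0 1 \<subseteq> inside \<gamma> \<union> \<gamma>" by (simp add: ball_im clo)
    have "compact (\<Phi> ` cball 0 1)" using cont by (intro compact_continuous_image) auto
    then have "closure (\<Phi> ` ball 0 1) \<subseteq> \<Phi> ` cball 0 1"
      by (intro closure_minimal compact_imp_closed) auto
    then show "inside \<gamma> \<union> \<gamma> \<subseteq> \<Phi> ` cball 0 1" by (simp add: ball_im clo)
  qed
  have sphere_sub: "\<Phi> z \<in> \<gamma>" if z: "cmod z = 1" for z
  proof (rule ccontr)
    assume "\<Phi> z \<notin> \<gamma>"
    moreover have "\<Phi> z \<in> inside \<gamma> \<union> \<gamma>" using cball_im z by (metis image_eqI mem_cball_0 order_refl)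
    ultimately have "\<Phi> z \<in> inside \<gamma>" by blast
    then have "isCont \<psi> (\<Phi> z)" using \<psi>(1) J(2) by (simp add: continuous_on_eq_continuous_at)
    moreover have "(\<Phi> \<longlongrightarrow> \<Phi> z) (at z within ball 0 1)"
    proof -
      have "(\<Phi> \<longlongrightarrow> \<Phi> z) (at z within cball 0 1)" using cont z by (simp add: continuous_on_def)
      then show ?thesis by (rule tendsto_within_subset) auto
    qed
    ultimately have "((\<lambda>x. \<psi> (\<Phi> x)) \<longlongrightarrow> \<psi> (\<Phi> z)) (at z within ball 0 1)"
      by (rule isCont_tendsto_compose)
    moreover have "\<forall>\<^sub>F x in at z within ball 0 1. \<psi> (\<Phi> x) = x"
      unfolding eventually_at_filter using ext \<psi>(3) by (intro always_eventually) (metis)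
    ultimately have "((\<lambda>x. x) \<longlongrightarrow> \<psi> (\<Phi> z)) (at z within ball 0 1)"
      using tendsto_cong by fastforce
    moreover have "((\<lambda>x. x) \<longlongrightarrow> z) (at z within ball 0 1)" by (rule tendsto_ident_at)
    moreover have "at z within ball 0 1 \<noteq> bot"
      using z by (simp add: trivial_limit_within islimpt_ball)
    ultimately have "\<psi> (\<Phi> z) = z" using tendsto_unique by blast
    then show False using \<psi>(2) \<open>\<Phi> z \<in> inside \<gamma>\<close> z by force
  qed
  have inball: "\<Phi> z \<in> inside \<gamma> \<longleftrightarrow> cmod z < 1" if "cmod z \<le> 1" for z
  proof
    assume "\<Phi> z \<in> inside \<gamma>" then have "\<Phi> z \<notin> \<gamma>" using in_compl by blast
    then have "cmod z \<noteq> 1" using sphere_sub[of z] by blast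
    then show "cmod z < 1" using that by linarith
  next
    assume "cmod z < 1" then show "\<Phi> z \<in> inside \<gamma>" using ball_im by auto
  qed
  have sphere_im: "\<Phi> ` sphere 0 1 = \<gamma>"
  proof
    show "\<Phi> ` sphere 0 1 \<subseteq> \<gamma>" using sphere_sub by auto
    show "\<gamma> \<subseteq> \<Phi> ` sphere 0 1"
    proof
      fix y assume "y \<in> \<gamma>"
      then obtain z where z: "z \<in> cball 0 1" "\<Phi> z = y" using cball_im by (metis UnCI imageE)
      then have "cmod z = 1" using inball[of z] \<open>y \<in> \<gamma>\<close> in_compl by force
      then show "y \<in> \<Phi> ` sphere 0 1" using z by auto
    qed
  qed
  have injb: "inj_on \<Phi> (ball 0 1)" using inj ext by (metis inj_on_cong)
  show thesis
  proof
    show "continuous_on (cball 0 1) \<Phi>" by fact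
    show "inj_on \<Phi> (cball 0 1)"
    proof (rule inj_onI)
      fix x y assume xy: "x \<in> cball 0 1" "y \<in> cball 0 1" "\<Phi> x = \<Phi> y"
      show "x = y"
      proof (cases "cmod x < 1")
        case True
        then have "cmod y < 1" using inball[of x] inball[of y] xy by auto
        then show ?thesis using True injb xy by (auto dest: inj_onD)
      next
        case False
        then have "cmod x = 1" "cmod y = 1" using inball[of x] inball[of y] xy by auto
        then show ?thesis
          using boundary_values_injective[OF f \<gamma> cont hol\<Phi> injb ball_im sphere_sub] xy by blast
      qed
    qed
    show "\<Phi> ` sphere 0 1 = \<gamma>" by fact
    show "\<Phi> z = \<phi> z" if "z \<in> ball 0 1" for z using ext that by simp
  qed
qed

section \<open>Isotopies of curves\<close>

lemma homotopic_with_canon_iff: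
  fixes f g :: "'a::topological_space \<Rightarrow> 'b::topological_space"
  shows "homotopic_with_canon P X S f g \<longleftrightarrow>
    (\<exists>h. continuous_on ({0..1::real} \<times> X) h \<and> h ` ({0..1} \<times> X) \<subseteq> S \<and>
       (\<forall>x. h (0, x) = f x) \<and> (\<forall>x. h (1, x) = g x) \<and> (\<forall>t\<in>{0..1}. P (\<lambda>x. h (t, x))))"
  unfolding homotopic_with_def prod_topology_subtopology_eu continuous_map_subtopology_eu
  by (simp add: image_subset_iff_funcset conj_assoc)

lemma homotopic_with_compose_right:
  assumes "homotopic_with_canon (\<lambda>h. inj_on h X) X S f g"
    and "continuous_on X k" "k ` X \<subseteq> X" "inj_on k X"
  shows "homotopic_with_canon (\<lambda>h. inj_on h X) X S (f \<circ> k) (g \<circ> k)"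
proof -
  obtain h where h: "continuous_on ({0..1::real} \<times> X) h" "h ` ({0..1} \<times> X) \<subseteq> S"
    "\<forall>x. h (0, x) = f x" "\<forall>x. h (1, x) = g x" "\<forall>t\<in>{0..1}. inj_on (\<lambda>x. h (t, x)) X"
    using assms(1) unfolding homotopic_with_canon_iff by (elim exE conjE) (rule that; assumption)
  define h' where "h' = (\<lambda>(t::real, x). h (t, k x))"
  have "continuous_on ({0..1} \<times> X) (\<lambda>p. h (fst p, k (snd p)))"
    using assms(3) by (intro continuous_on_compose2[OF h(1)] continuous_intros continuous_on_compose2[OF assms(2)]) auto
  then have "continuous_on ({0..1} \<times> X) h'" by (simp add: h'_def case_prod_beta)
  moreover have "h' ` ({0..1} \<times> X) \<subseteq> S" using h(2) assms(3) by (force simp: h'_def)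
  moreover have "inj_on (\<lambda>x. h' (t, x)) X" if "t \<in> {0..1}" for t
    using comp_inj_on[OF assms(4) inj_on_subset[OF bspec[OF h(5) that] assms(3)]] by (simp add: h'_def o_def)
  ultimately show ?thesis
    using h(3,4) unfolding homotopic_with_canon_iff
    by (intro exI[of _ h']) (auto simp: h'_def)
qed

lemma isotopicI:
  fixes h :: "real \<times> complex \<Rightarrow> 'a::topological_space"
  assumes "continuous_on ({0..1} \<times> unit_circle) h" "h ` ({0..1} \<times> unit_circle) \<subseteq> S"
    "\<And>t. t \<in> {0..1} \<Longrightarrow> inj_on (\<lambda>x. h (t, x)) unit_circle"
    "(\<lambda>x. h (0, x)) ` unit_circle = \<gamma>" "(\<lambda>x. h (1, x)) ` unit_circle = \<delta>"
  shows "isotopic S \<gamma> \<delta>"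
  unfolding isotopic_def homotopic_with_canon_iff using assms
  by (intro exI[of _ "\<lambda>x. h (0, x)"] exI[of _ "\<lambda>x. h (1, x)"] conjI exI[of _ h]) auto

lemma isotopicE:
  fixes S :: "'a::topological_space set"
  assumes "isotopic S \<gamma> \<delta>"
  obtains h where "continuous_on ({0..1} \<times> unit_circle) h" "h ` ({0..1} \<times> unit_circle) \<subseteq> S"
    "\<forall>t\<in>{0..1::real}. inj_on (\<lambda>x. h (t, x)) unit_circle"
    "(\<lambda>x. h (0, x)) ` unit_circle = \<gamma>" "(\<lambda>x. h (1, x)) ` unit_circle = \<delta>"
proof -
  obtain f g where fg: "homotopic_with_canon (\<lambda>h. inj_on h unit_circle) unit_circle S f g"
    "f ` unit_circle = \<gamma>" "g ` unit_circle = \<delta>" using assms by (auto simp: isotopic_def)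
  from fg(1) obtain h where h: "continuous_on ({0..1::real} \<times> unit_circle) h" "h ` ({0..1} \<times> unit_circle) \<subseteq> S"
    "\<forall>x. h (0, x) = f x" "\<forall>x. h (1, x) = g x" "\<forall>t\<in>{0..1}. inj_on (\<lambda>x. h (t, x)) unit_circle"
    unfolding homotopic_with_canon_iff by (elim exE conjE) (rule that; assumption)
  then show thesis using fg by (intro that[of h]) auto
qed

lemma isotopic_subset: "isotopic S \<gamma> \<delta> \<Longrightarrow> S \<subseteq> T \<Longrightarrow> isotopic T \<gamma> \<delta>"
  by (elim isotopicE) (rule isotopicI; auto)

lemma isotopic_sym: "isotopic S \<gamma> \<delta> \<Longrightarrow> isotopic S \<delta> \<gamma>"
  unfolding isotopic_def using homotopic_with_sym by blast

lemma isotopic_image: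
  assumes "isotopic S \<gamma> \<delta>" "continuous_on S k" "inj_on k S" "k ` S \<subseteq> T"
  shows "isotopic T (k ` \<gamma>) (k ` \<delta>)"
proof -
  obtain h where h: "continuous_on ({0..1::real} \<times> unit_circle) h" "h ` ({0..1} \<times> unit_circle) \<subseteq> S"
    "\<forall>t\<in>{0..1::real}. inj_on (\<lambda>x. h (t, x)) unit_circle"
    "(\<lambda>x. h (0, x)) ` unit_circle = \<gamma>" "(\<lambda>x. h (1, x)) ` unit_circle = \<delta>"
    by (rule isotopicE[OF assms(1)])
  show ?thesis
  proof -
    have "continuous_on ({0..1} \<times> unit_circle) (k \<circ> h)"
      using h assms by (intro continuous_on_compose) (auto intro: continuous_on_subset)
    moreover have "(k \<circ> h) ` ({0..1} \<times> unit_circle) \<subseteq> T" using h(2) assms(4) by force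
    moreover have "inj_on (\<lambda>x. (k \<circ> h) (t, x)) unit_circle" if "t \<in> {0..1}" for t
    proof -
      have "inj_on k ((\<lambda>x. h (t, x)) ` unit_circle)"
        using h(2) that by (intro inj_on_subset[OF assms(3)]) auto
      from comp_inj_on[OF bspec[OF h(3) that] this] show ?thesis by (simp add: o_def)
    qed
    moreover have "(\<lambda>x. (k \<circ> h) (0, x)) ` unit_circle = k ` \<gamma>" "(\<lambda>x. (k \<circ> h) (1, x)) ` unit_circle = k ` \<delta>"
      by (simp_all add: h(4,5)[symmetric] image_image)
    ultimately show ?thesis by (rule isotopicI)
  qed
qed

text \<open>
  The two isotopies may parametrize the middle curve differently, so one of them is composed with a
  homeomorphism of the circle.
\<close>

lemma isotopic_trans:
  fixes S :: "'a::t2_space set"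
  assumes "isotopic S \<gamma> \<delta>" "isotopic S \<delta> \<epsilon>"
  shows "isotopic S \<gamma> \<epsilon>"
proof -
  let ?C = "unit_circle"
  let ?H = "homotopic_with_canon (\<lambda>h. inj_on h ?C) ?C S"
  obtain f1 g1 f2 g2 where 1: "?H f1 g1" "f1 ` ?C = \<gamma>" "g1 ` ?C = \<delta>"
    and 2: "?H f2 g2" "f2 ` ?C = \<delta>" "g2 ` ?C = \<epsilon>"
    using assms unfolding isotopic_def by metis
  have g1: "continuous_on ?C g1" "inj_on g1 ?C" and f2: "continuous_on ?C f2" "inj_on f2 ?C"
    using homotopic_with_imp_continuous[OF 1(1)] homotopic_with_imp_continuous[OF 2(1)]
      homotopic_with_imp_property[OF 1(1)] homotopic_with_imp_property[OF 2(1)] by auto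
  obtain f2' where f2': "homeomorphism ?C \<delta> f2 f2'"
    using homeomorphism_compact[OF compact_sphere f2(1) 2(2) f2(2)] by blast
  define k where "k = f2' \<circ> g1"
  have k: "continuous_on ?C k" unfolding k_def
    using g1 f2' 1(3) by (intro continuous_on_compose) (auto simp: homeomorphism_def)
  have kim: "k ` ?C = ?C" using f2' 1(3) by (metis homeomorphism_image2 image_comp k_def)
  have "inj_on f2' \<delta>" using f2' by (intro inj_on_inverseI[of _ f2]) (auto simp: homeomorphism_def)
  then have kinj: "inj_on k ?C" unfolding k_def using g1 1(3) by (intro comp_inj_on) auto
  have f2k: "f2 (k x) = g1 x" if "x \<in> ?C" for x
    using f2' 1(3) that by (auto simp: k_def homeomorphism_def)
  have "?H (f2 \<circ> k) (g2 \<circ> k)"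
    by (rule homotopic_with_compose_right[OF 2(1) k _ kinj]) (simp add: kim)
  then have "?H g1 (g2 \<circ> k)"
    by (rule homotopic_with_eq) (use f2k in \<open>auto simp: inj_on_def\<close>)
  with 1(1) have "?H f1 (g2 \<circ> k)" by (rule homotopic_with_trans)
  moreover have "(g2 \<circ> k) ` ?C = \<epsilon>" using kim 2(3) by (metis image_comp)
  ultimately show ?thesis
    unfolding isotopic_def by (intro exI[of _ f1] exI[of _ "g2 \<circ> k"] conjI 1(2))
qed

lemma isotopic_refl:
  assumes "circle_embedding f" "f ` unit_circle = \<gamma>" "\<gamma> \<subseteq> S"
  shows "isotopic S \<gamma> \<gamma>"
proof (rule isotopicI[where h = "f \<circ> snd"])
  show "continuous_on ({0..1} \<times> unit_circle) (f \<circ> snd)"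
    using assms by (intro continuous_on_compose continuous_intros) (auto simp: circle_embedding_def)
qed (use assms in \<open>auto simp: circle_embedding_def\<close>)

lemma simple_closed_curve_iff:
  fixes S :: "'a::t2_space set"
  shows "simple_closed_curve S \<gamma> \<longleftrightarrow> (\<exists>f. circle_embedding f \<and> f ` unit_circle = \<gamma>) \<and> \<gamma> \<subseteq> S"
proof -
  have "\<gamma> homeomorphic unit_circle \<longleftrightarrow> (\<exists>f. circle_embedding f \<and> f ` unit_circle = \<gamma>)"
  proof
    assume "\<gamma> homeomorphic unit_circle"
    then obtain f g where "homeomorphism unit_circle \<gamma> f g"
      using homeomorphic_sym homeomorphic_def by metis
    then show "\<exists>f. circle_embedding f \<and> f ` unit_circle = \<gamma>"
      by (intro exI[of _ f]) (auto simp: homeomorphism_def circle_embedding_def intro: inj_on_inverseI)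
  next
    assume "\<exists>f. circle_embedding f \<and> f ` unit_circle = \<gamma>"
    then obtain f where "circle_embedding f" "f ` unit_circle = \<gamma>" by blast
    then have "\<exists>g. homeomorphism unit_circle \<gamma> f g"
      unfolding circle_embedding_def by (metis compact_sphere homeomorphism_compact)
    then show "\<gamma> homeomorphic unit_circle"
      using homeomorphic_sym homeomorphic_def by metis
  qed
  then show ?thesis by (auto simp: simple_closed_curve_def)
qed

lemma equiv_isotopy_rel:
  fixes S :: "'a::t2_space set"
  shows "equiv {\<gamma>. essential S \<gamma>} (isotopy_rel S)"
proof (rule equivI)
  show "isotopy_rel S \<subseteq> {\<gamma>. essential S \<gamma>} \<times> {\<gamma>. essential S \<gamma>}" by (auto simp: isotopy_rel_def)
  show "refl_on {\<gamma>. essential S \<gamma>} (isotopy_rel S)"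
  proof (rule refl_onI)
    fix \<gamma> assume "\<gamma> \<in> {\<gamma>. essential S \<gamma>}"
    then have "essential S \<gamma>" "simple_closed_curve S \<gamma>" by (auto simp: essential_def)
    then show "(\<gamma>, \<gamma>) \<in> isotopy_rel S"
      using isotopic_refl by (auto simp: simple_closed_curve_iff isotopy_rel_def)
  qed
  show "sym (isotopy_rel S)" by (auto simp: sym_def isotopy_rel_def intro: isotopic_sym)
  show "trans (isotopy_rel S)" by (auto simp: trans_def isotopy_rel_def intro: isotopic_trans)
qed

text \<open>
  An isotopy in \<open>S\<close> is a homotopy of loops that avoids \<open>p\<close>, and the winding number of a
  simple loop about \<open>p\<close> is nonzero exactly if \<open>p\<close> lies inside.
\<close>

lemma isotopic_inside_iff:
  fixes S :: "complex set"
  assumes iso: "isotopic S \<gamma> \<delta>" and p: "p \<notin> S"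
  shows "p \<in> inside \<gamma> \<longleftrightarrow> p \<in> inside \<delta>"
proof -
  obtain h where h: "continuous_on ({0..1::real} \<times> unit_circle) h" "h ` ({0..1} \<times> unit_circle) \<subseteq> S"
    "\<forall>t\<in>{0..1::real}. inj_on (\<lambda>x. h (t, x)) unit_circle"
    "(\<lambda>x. h (0, x)) ` unit_circle = \<gamma>" "(\<lambda>x. h (1, x)) ` unit_circle = \<delta>"
    by (rule isotopicE[OF iso])
  have emb: "circle_embedding (\<lambda>x. h (t, x))" if "t \<in> {0..1}" for t
    unfolding circle_embedding_def
    using that h(3) by (auto intro!: continuous_on_compose2[OF h(1)] continuous_intros)
  let ?c = "circlepath 0 1"
  let ?p = "\<lambda>t. (\<lambda>x. h (t, x)) \<circ> ?c"
  have in_iff: "p \<in> inside ((\<lambda>x. h (t, x)) ` unit_circle) \<longleftrightarrow> winding_number (?p t) p \<noteq> 0" if "t \<in> {0..1}" for t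
  proof -
    note sp = circle_embedding_simple_path[OF emb[OF that]]
    have "p \<notin> path_image (?p t)" using p h(2) that unfolding sp(3) image_subset_iff by auto
    then have "p \<in> inside (path_image (?p t)) \<or> p \<in> outside (path_image (?p t))"
      using inside_Un_outside[of "path_image (?p t)"] by blast
    moreover have "winding_number (?p t) p \<noteq> 0" if "p \<in> inside (path_image (?p t))"
      using simple_closed_path_norm_winding_number_inside[OF sp(1) that] by auto
    moreover have "winding_number (?p t) p = 0" if "p \<in> outside (path_image (?p t))"
      using winding_number_zero_in_outside[OF simple_path_imp_path[OF sp(1)] sp(2) that] .
    ultimately show ?thesis using sp(3) inside_Int_outside[of "path_image (?p t)"] by auto
  qed
  have "homotopic_loops (- {p}) (?p 0) (?p 1)"
  proof -
    have cc: "continuous_on {0..1} ?c"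
      using simple_path_circlepath[of 0 1] by (simp add: simple_path_imp_path flip: path_def)
    have cl: "?c 1 = ?c 0" by (simp add: circlepath)
    have cS: "?c s \<in> unit_circle" for s by (simp add: circlepath norm_mult)
    have "continuous_on ({0..1} \<times> {0..1}) (\<lambda>p::real\<times>real. (fst p, ?c (snd p)))"
      by (intro continuous_on_Pair continuous_on_fst continuous_on_id continuous_on_compose2[OF cc] continuous_on_snd) auto
    then have "continuous_on ({0..1} \<times> {0..1}) (\<lambda>p. h (fst p, ?c (snd p)))"
      by (rule continuous_on_compose2[OF h(1)]) (use cS in auto)
    moreover have "p \<notin> (\<lambda>p. h (fst p, ?c (snd p))) ` ({0..1} \<times> {0..1})"
      using h(2) p cS unfolding image_subset_iff by fastforce
    ultimately show ?thesis
      unfolding homotopic_loops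
      by (intro exI[of _ "\<lambda>p. h (fst p, ?c (snd p))"])
         (use cl in \<open>auto simp: pathfinish_def pathstart_def image_subset_iff\<close>)
  qed
  then have "winding_number (?p 0) p = winding_number (?p 1) p"
    by (rule winding_number_homotopic_loops)
  then show ?thesis using in_iff[of 0] in_iff[of 1] h(4,5) by simp
qed

section \<open>Parallel Jordan curves are isotopic\<close>

text \<open>
  A Moebius transformation of the disc moves the preimage of \<open>q\<close> to the centre.
\<close>

lemma Jordan_Riemann_map:
  fixes f :: "complex \<Rightarrow> complex"
  assumes f: "circle_embedding f" and \<gamma>: "\<gamma> = f ` unit_circle" and q: "q \<in> inside \<gamma>"
  obtains \<Phi> where "continuous_on (cball 0 1) \<Phi>" "inj_on \<Phi> (cball 0 1)" "\<Phi> holomorphic_on ball 0 1"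
    "\<Phi> ` ball 0 1 = inside \<gamma>" "\<Phi> ` unit_circle = \<gamma>" "\<Phi> 0 = q"
proof -
  note J = Jordan_circle_embedding[OF f \<gamma>]
  have "simply_connected (inside \<gamma>)"
    using simply_connected_inside_simple_path[OF circle_embedding_simple_path(1)[OF f]]
    by (simp add: circle_embedding_simple_path(3)[OF f] \<gamma>)
  moreover have "inside \<gamma> \<noteq> UNIV" using J(4) not_bounded_UNIV by metis
  ultimately obtain F G where FG: "F holomorphic_on inside \<gamma>" "G holomorphic_on ball 0 1"
    "\<And>z. z \<in> inside \<gamma> \<Longrightarrow> F z \<in> ball 0 1" "\<And>z. z \<in> inside \<gamma> \<Longrightarrow> G (F z) = z"
    "\<And>z. z \<in> ball 0 1 \<Longrightarrow> G z \<in> inside \<gamma>" "\<And>z. z \<in> ball 0 1 \<Longrightarrow> F (G z) = z"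
    using Riemann_mapping_theorem[of "inside \<gamma>"] J(1,2) by metis
  have a: "F q \<in> ball 0 1" using FG(3) q by blast
  obtain m k where mk: "m (F q) = 0" "m holomorphic_on ball 0 1" "m ` ball 0 1 \<subseteq> ball 0 1"
    "k holomorphic_on ball 0 1" "k ` ball 0 1 \<subseteq> ball 0 1"
    "\<And>z. z \<in> ball 0 1 \<Longrightarrow> m (k z) = z" "\<And>z. z \<in> ball 0 1 \<Longrightarrow> k (m z) = z"
    using ball_biholomorphism_exists[OF a] by metis
  define \<phi> where "\<phi> = G \<circ> k"
  have hol: "\<phi> holomorphic_on ball 0 1"
    unfolding \<phi>_def by (rule holomorphic_on_compose_gen[OF mk(4) FG(2) mk(5)])
  have inj: "inj_on \<phi> (ball 0 1)"
  proof (rule inj_on_inverseI)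
    fix z :: complex assume z: "z \<in> ball 0 1"
    then have "k z \<in> ball 0 1" using mk(5) by blast
    then show "(m \<circ> F) (\<phi> z) = z" using FG(6) mk(6) z by (simp add: \<phi>_def)
  qed
  have im: "\<phi> ` ball 0 1 = inside \<gamma>"
  proof
    show "\<phi> ` ball 0 1 \<subseteq> inside \<gamma>" using mk(5) FG(5) by (auto simp: \<phi>_def simp del: mem_ball_0)
    show "inside \<gamma> \<subseteq> \<phi> ` ball 0 1"
    proof
      fix w assume w: "w \<in> inside \<gamma>"
      then have "m (F w) \<in> ball 0 1" using FG(3) mk(3) by blast
      moreover have "\<phi> (m (F w)) = w" using FG(3,4) mk(7) w by (simp add: \<phi>_def)
      ultimately show "w \<in> \<phi> ` ball 0 1" by (metis imageI)
    qed
  qed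
  obtain \<Phi> where \<Phi>: "continuous_on (cball 0 1) \<Phi>" "inj_on \<Phi> (cball 0 1)"
    "\<And>z. z \<in> ball 0 1 \<Longrightarrow> \<Phi> z = \<phi> z" "\<Phi> ` unit_circle = \<gamma>"
    using Caratheodory_extension[OF f \<gamma> hol inj im] by metis
  show thesis
  proof (rule that[OF \<Phi>(1,2)])
    show "\<Phi> holomorphic_on ball 0 1" using hol \<Phi>(3) holomorphic_transform by metis
    show "\<Phi> ` ball 0 1 = inside \<gamma>" using im \<Phi>(3) by (metis image_cong)
    have "k 0 = F q" using mk(1,7) a by metis
    then show "\<Phi> 0 = q" using \<Phi>(3)[of 0] FG(4) q by (simp add: \<phi>_def)
  qed (rule \<Phi>(4))
qed

lemma circle_embedding_compose:
  assumes "circle_embedding f" "continuous_on (f ` unit_circle) k" "inj_on k (f ` unit_circle)"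
  shows "circle_embedding (k \<circ> f)"
  using assms unfolding circle_embedding_def by (simp add: continuous_on_compose comp_inj_on del: comp_apply)

lemma image_mult_unit_circle:
  "r > 0 \<Longrightarrow> (\<lambda>x. of_real r * x) ` unit_circle = sphere (0::complex) r"
proof
  assume r: "r > 0"
  show "sphere (0::complex) r \<subseteq> (\<lambda>x. of_real r * x) ` unit_circle"
  proof
    fix z :: complex assume "z \<in> sphere 0 r"
    then show "z \<in> (\<lambda>x. of_real r * x) ` unit_circle"
      using r by (intro image_eqI[of _ _ "z / of_real r"]) (auto simp: norm_divide)
  qed
qed (auto simp: norm_mult)

text \<open>
  If \<open>l\<close> is a continuous logarithm of \<open>f - q\<close> along the circle, then \<open>- l\<close> is one of \<open>1 / (f - q)\<close>. So the
  winding number of the inverted curve about \<open>0\<close> is minus that of \<open>f\<close> about \<open>q\<close>, in particular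
  nonzero.
\<close>

lemma zero_inside_inversion:
  fixes f :: "complex \<Rightarrow> complex"
  assumes f: "circle_embedding f" and \<gamma>: "\<gamma> = f ` unit_circle" and q: "q \<in> inside \<gamma>"
  shows "0 \<in> inside ((\<lambda>z. 1 / (z - q)) ` \<gamma>)" "circle_embedding (\<lambda>x. 1 / (f x - q))"
proof -
  have qn: "q \<notin> \<gamma>" using q inside_no_overlap[of \<gamma>] by blast
  then have nz: "f x - q \<noteq> 0" if "x \<in> unit_circle" for x using that \<gamma> by auto
  show emb: "circle_embedding (\<lambda>x. 1 / (f x - q))"
    using f nz unfolding circle_embedding_def
    by (auto intro!: continuous_intros simp: inj_on_def)
  let ?c = "circlepath 0 1"
  note sp = circle_embedding_simple_path[OF f]
  note sp' = circle_embedding_simple_path[OF emb]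
  have qp: "q \<notin> path_image (f \<circ> ?c)" using qn \<gamma> sp(3) by simp
  obtain l where l: "path l" "pathfinish l - pathstart l = 2 * of_real pi * \<i> * winding_number (f \<circ> ?c) q"
    "\<And>t. t \<in> {0..1} \<Longrightarrow> (f \<circ> ?c) t = q + exp (l t)"
    using winding_number_as_continuous_log[OF simple_path_imp_path[OF sp(1)] qp] by metis
  have w: "winding_number (f \<circ> ?c) q \<noteq> 0"
    using simple_closed_path_norm_winding_number_inside[OF sp(1)] q \<gamma> sp(3) by force
  have eq: "((\<lambda>x. 1 / (f x - q)) \<circ> ?c) t = (exp \<circ> (\<lambda>t. - l t)) t" if "t \<in> {0..1}" for t
    using l(3)[OF that] by (simp add: exp_minus field_simps)
  have pl: "path (\<lambda>t. - l t)" using l(1) unfolding path_def by (intro continuous_intros)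
  have "winding_number ((\<lambda>x. 1 / (f x - q)) \<circ> ?c) 0 = winding_number (exp \<circ> (\<lambda>t. - l t)) 0"
    by (rule winding_number_cong) (use eq in auto)
  also have "\<dots> = (- pathfinish l + pathstart l) / (2 * of_real pi * \<i>)"
    by (subst winding_number_compose_exp[OF pl]) (simp add: pathstart_def pathfinish_def)
  also have "- pathfinish l + pathstart l = - (2 * of_real pi * \<i> * winding_number (f \<circ> ?c) q)"
    using l(2) by (simp add: algebra_simps)
  also have "- (2 * of_real pi * \<i> * winding_number (f \<circ> ?c) q) / (2 * of_real pi * \<i>) = - winding_number (f \<circ> ?c) q"
    by simp
  finally have "winding_number ((\<lambda>x. 1 / (f x - q)) \<circ> ?c) 0 = - winding_number (f \<circ> ?c) q" .
  with w have "winding_number ((\<lambda>x. 1 / (f x - q)) \<circ> ?c) 0 \<noteq> 0" by (metis neg_equal_0_iff_equal)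
  moreover have "0 \<notin> path_image ((\<lambda>x. 1 / (f x - q)) \<circ> ?c)"
    unfolding sp'(3) using nz by auto
  ultimately have "0 \<in> inside (path_image ((\<lambda>x. 1 / (f x - q)) \<circ> ?c))"
    using winding_number_zero_in_outside[OF simple_path_imp_path[OF sp'(1)] sp'(2)]
      inside_Un_outside[of "path_image ((\<lambda>x. 1 / (f x - q)) \<circ> ?c)"] by blast
  then show "0 \<in> inside ((\<lambda>z. 1 / (z - q)) ` \<gamma>)"
    unfolding sp'(3) \<gamma> by (simp add: image_image)
qed

text \<open>
  The inversion maps the inside without \<open>q\<close> to a connected set that avoids the inverted curve and
  is unbounded, because of the points near \<open>q\<close>. So this set is outside the inverted curve.
\<close>

lemma inversion_exchanges_sides:
  fixes f :: "complex \<Rightarrow> complex"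
  assumes f: "circle_embedding f" and \<gamma>: "\<gamma> = f ` unit_circle" and q: "q \<in> inside \<gamma>"
    and w: "w \<in> inside ((\<lambda>z. 1 / (z - q)) ` \<gamma>) \<union> (\<lambda>z. 1 / (z - q)) ` \<gamma>" "w \<noteq> 0"
  shows "q + 1 / w \<notin> inside \<gamma>"
proof -
  note J = Jordan_circle_embedding[OF f \<gamma>]
  define \<iota> where "\<iota> = (\<lambda>z. 1 / (z - q))"
  define \<gamma>' where "\<gamma>' = \<iota> ` \<gamma>"
  have emb: "circle_embedding (\<lambda>x. 1 / (f x - q))" by (rule zero_inside_inversion(2)[OF f \<gamma> q])
  have \<gamma>'_eq: "\<gamma>' = (\<lambda>x. 1 / (f x - q)) ` unit_circle" by (simp add: \<gamma>'_def \<gamma> \<iota>_def image_image)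
  note J' = Jordan_circle_embedding[OF emb \<gamma>'_eq]
  have qn: "q \<notin> \<gamma>" using q inside_no_overlap[of \<gamma>] by blast
  have \<iota>inv: "q + 1 / \<iota> z = z" if "z \<noteq> q" for z using that by (simp add: \<iota>_def)
  have Vout: "\<iota> z \<in> outside \<gamma>'" if z: "z \<in> inside \<gamma>" "z \<noteq> q" for z
  proof -
    define V where "V = \<iota> ` (inside \<gamma> - {q})"
    have "connected (inside \<gamma> - {q})"
      using J(2,3) by (simp add: connected_open_delete)
    then have conV: "connected V" unfolding V_def \<iota>_def
      by (intro connected_continuous_image continuous_intros) auto
    have dV: "V \<inter> \<gamma>' = {}"
    proof (rule ccontr)
      assume "V \<inter> \<gamma>' \<noteq> {}"
      then obtain x y where "x \<in> inside \<gamma>" "x \<noteq> q" "y \<in> \<gamma>" "\<iota> x = \<iota> y" by (auto simp: V_def \<gamma>'_def)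
      then have "x = y" using \<iota>inv[of x] \<iota>inv[of y] qn by metis
      then show False using \<open>x \<in> inside \<gamma>\<close> \<open>y \<in> \<gamma>\<close> inside_no_overlap[of \<gamma>] by blast
    qed
    have "\<not> bounded V"
    proof
      assume "bounded V"
      then obtain b where b: "b > 0" "\<And>v. v \<in> V \<Longrightarrow> cmod v \<le> b" unfolding bounded_pos by blast
      obtain e where e: "e > 0" "ball q e \<subseteq> inside \<gamma>" using q J(2) openE by blast
      define d where "d = min (e/2) (1 / (2*b))"
      have d: "d > 0" "d < e" "d < 1/b" using e b by (auto simp: d_def min_def field_simps)
      have "\<iota> (q + of_real d) \<in> V" unfolding V_def using d e(2) by (intro imageI) (auto simp: dist_norm subset_iff)
      then have "1/d \<le> b" using b(2) d(1) by (force simp: \<iota>_def norm_divide)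
      then show False using d b by (simp add: field_simps)
    qed
    moreover have "V \<subseteq> inside \<gamma>'" if "v \<in> V" "v \<in> inside \<gamma>'" for v
      using connected_subset_inside[OF conV dV that] .
    ultimately have "V \<inter> inside \<gamma>' = {}" using J'(4) bounded_subset by blast
    moreover have "\<iota> z \<in> V" using z by (simp add: V_def)
    ultimately show ?thesis using dV inside_Un_outside[of \<gamma>'] by blast
  qed
  show ?thesis
  proof
    assume a: "q + 1 / w \<in> inside \<gamma>"
    have "\<iota> (q + 1/w) = w" by (simp add: \<iota>_def)
    then have "w \<in> outside \<gamma>'" using Vout[OF a] w by auto
    then show False
      using w(1) inside_Int_outside[of \<gamma>'] outside_no_overlap[of \<gamma>'] unfolding \<gamma>'_def \<iota>_def by blast
  qed
qed

text \<open>
  Near \<open>0\<close> the derivative of \<open>\<Phi>\<close> is close to its value \<open>a\<close> at \<open>0\<close>. Therefore all the functions of the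
  straight-line homotopy from \<open>\<Phi>\<close> to multiplication by \<open>a\<close> differ from the latter by a map with
  Lipschitz constant \<open>cmod a / 2\<close>, which makes them injective.
\<close>

lemma homotopy_to_derivative_near_zero:
  assumes hol: "\<Phi> holomorphic_on ball 0 1" and "inj_on \<Phi> (ball 0 1)"
  obtains r where "0 < r" "r \<le> 1" "deriv \<Phi> 0 \<noteq> 0"
    "\<And>t z w. t \<in> {0..1} \<Longrightarrow> z \<in> ball 0 r \<Longrightarrow> w \<in> ball 0 r \<Longrightarrow>
       cmod ((((1 - of_real t) * \<Phi> z + of_real t * deriv \<Phi> 0 * z) - ((1 - of_real t) * \<Phi> w + of_real t * deriv \<Phi> 0 * w))
          - deriv \<Phi> 0 * (z - w)) \<le> cmod (deriv \<Phi> 0) / 2 * cmod (z - w)"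
proof -
  define a where "a = deriv \<Phi> 0"
  have "a \<noteq> 0" unfolding a_def using holomorphic_injective_imp_regular[OF hol _ assms(2)] by auto
  have "isCont (deriv \<Phi>) 0"
    using continuous_on_interior[OF holomorphic_on_imp_continuous_on[OF holomorphic_deriv[OF hol open_ball]], of 0]
    by simp
  then have "\<exists>d>0. \<forall>z. dist z 0 < d \<longrightarrow> dist (deriv \<Phi> z) (deriv \<Phi> 0) < cmod a / 2"
    unfolding continuous_at_eps_delta by (rule allE[of _ "cmod a / 2"]) (use \<open>a \<noteq> 0\<close> in simp)
  then obtain r0 where "r0 > 0" and r0: "\<And>z. cmod z < r0 \<Longrightarrow> cmod (deriv \<Phi> z - a) < cmod a / 2"
    unfolding a_def dist_norm by auto
  define r where "r = min r0 1"
  have "r > 0" using \<open>r0 > 0\<close> by (simp add: r_def)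
  have Lip: "cmod ((\<Phi> z - a * z) - (\<Phi> w - a * w)) \<le> cmod a / 2 * cmod (z - w)"
    if "z \<in> ball 0 r" "w \<in> ball 0 r" for z w
  proof (rule field_differentiable_bound[of "ball 0 r"])
    show "((\<lambda>z. \<Phi> z - a * z) has_field_derivative deriv \<Phi> x - a) (at x within ball 0 r)"
      if "x \<in> ball 0 r" for x
    proof -
      have "(\<Phi> has_field_derivative deriv \<Phi> x) (at x)"
        using holomorphic_derivI[OF hol] that by (simp add: r_def)
      from DERIV_diff[OF this DERIV_cmult_Id[of a x]] show ?thesis
        by (rule has_field_derivative_at_within)
    qed
    show "cmod (deriv \<Phi> x - a) \<le> cmod a / 2" if "x \<in> ball 0 r" for x
      using r0[of x] that by (simp add: r_def)
  qed (use that in auto)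
  define u where "u = (\<lambda>t z. (1 - of_real t) * \<Phi> z + of_real t * a * z)"
  have udiff: "cmod ((u t z - u t w) - a * (z - w)) \<le> cmod a / 2 * cmod (z - w)"
    if "t \<in> {0..1}" "z \<in> ball 0 r" "w \<in> ball 0 r" for t z w
  proof -
    have "(u t z - u t w) - a * (z - w) = of_real (1 - t) * ((\<Phi> z - a * z) - (\<Phi> w - a * w))"
      by (simp add: u_def algebra_simps)
    then have "cmod ((u t z - u t w) - a * (z - w)) = (1 - t) * cmod ((\<Phi> z - a * z) - (\<Phi> w - a * w))"
      using that(1) by (simp add: norm_mult del: of_real_diff)
    also have "\<dots> \<le> 1 * cmod ((\<Phi> z - a * z) - (\<Phi> w - a * w))"
      using that(1) by (intro mult_right_mono) auto
    finally show ?thesis using Lip[OF that(2,3)] by simp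
  qed
  show thesis
  proof (rule that[of r])
    show "r \<le> 1" by (simp add: r_def)
  qed (use \<open>r > 0\<close> \<open>a \<noteq> 0\<close> udiff in \<open>auto simp: a_def u_def\<close>)
qed

text \<open>
  Invert the plane about a point \<open>q\<close> inside \<open>\<gamma>\<close>, and let \<open>\<Phi>\<close> be the extended Riemann map of
  the inside of the inverted curve with \<open>\<Phi> 0 = 0\<close>. The curves \<open>q + 1 / \<Phi> (t x)\<close> start at \<open>\<gamma>\<close> for \<open>t = 1\<close> and stay
  out of the inside. At a small radius \<open>t = \<epsilon>\<close> the map \<open>\<Phi>\<close> is deformed to its derivative, after which the
  curve is a large round circle about \<open>q\<close>, and this is translated to the origin.
\<close>

lemma isotopic_large_circle:
  fixes f :: "complex \<Rightarrow> complex"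
  assumes f: "circle_embedding f" and \<gamma>: "\<gamma> = f ` unit_circle"
  obtains L where "L > B" "L > 0" "isotopic (- inside \<gamma>) \<gamma> (sphere 0 L)"
proof -
  note J = Jordan_circle_embedding[OF f \<gamma>]
  obtain q where q: "q \<in> inside \<gamma>" using J(1) by blast
  define \<iota> where "\<iota> = (\<lambda>z. 1 / (z - q))"
  define \<gamma>' where "\<gamma>' = \<iota> ` \<gamma>"
  have zin: "0 \<in> inside \<gamma>'" and emb: "circle_embedding (\<lambda>x. 1 / (f x - q))"
    using zero_inside_inversion[OF f \<gamma> q] by (auto simp: \<gamma>'_def \<iota>_def)
  have \<gamma>'_eq: "\<gamma>' = (\<lambda>x. 1 / (f x - q)) ` unit_circle" by (simp add: \<gamma>'_def \<gamma> \<iota>_def image_image)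
  have qn: "q \<notin> \<gamma>" using q inside_no_overlap[of \<gamma>] by blast
  have \<iota>inv: "q + 1 / \<iota> z = z" if "z \<noteq> q" for z using that by (simp add: \<iota>_def)
  have inv_notin: "q + 1 / w \<notin> inside \<gamma>" if "w \<in> inside \<gamma>' \<union> \<gamma>'" "w \<noteq> 0" for w
    using inversion_exchanges_sides[OF f \<gamma> q] that unfolding \<gamma>'_def \<iota>_def by blast
  obtain \<Phi> where \<Phi>: "continuous_on (cball 0 1) \<Phi>" "inj_on \<Phi> (cball 0 1)" "\<Phi> holomorphic_on ball 0 1"
    "\<Phi> ` ball 0 1 = inside \<gamma>'" "\<Phi> ` unit_circle = \<gamma>'" "\<Phi> 0 = 0"
    by (rule Jordan_Riemann_map[OF emb \<gamma>'_eq zin])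
  have \<Phi>nz: "\<Phi> z \<noteq> 0" if "z \<in> cball 0 1" "z \<noteq> 0" for z
    using inj_onD[OF \<Phi>(2), of z 0] \<Phi>(6) that by auto
  have \<Phi>in: "\<Phi> z \<in> inside \<gamma>' \<union> \<gamma>'" if "z \<in> cball 0 1" for z
  proof (cases "cmod z < 1")
    case True then show ?thesis using \<Phi>(4) by auto
  next
    case False then show ?thesis using \<Phi>(5) that by auto
  qed
  define a where "a = deriv \<Phi> 0"
  have "inj_on \<Phi> (ball 0 1)" using \<Phi>(2) by (rule inj_on_subset) auto
  then obtain r where r: "0 < r" "r \<le> 1" "a \<noteq> 0" and
    lin: "\<And>t z w. t \<in> {0..1} \<Longrightarrow> z \<in> ball 0 r \<Longrightarrow> w \<in> ball 0 r \<Longrightarrow>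
       cmod ((((1 - of_real t) * \<Phi> z + of_real t * a * z) - ((1 - of_real t) * \<Phi> w + of_real t * a * w))
          - a * (z - w)) \<le> cmod a / 2 * cmod (z - w)"
    using homotopy_to_derivative_near_zero[OF \<Phi>(3)] unfolding a_def by metis
  have "r > 0" "a \<noteq> 0" by fact+
  define u where "u = (\<lambda>t z. (1 - of_real t) * \<Phi> z + of_real t * a * z)"
  have udiff: "cmod ((u t z - u t w) - a * (z - w)) \<le> cmod a / 2 * cmod (z - w)"
    if "t \<in> {0..1}" "z \<in> ball 0 r" "w \<in> ball 0 r" for t z w
    using lin[OF that] by (simp only: u_def)
  have uinj: "u t z \<noteq> u t w" if "t \<in> {0..1}" "z \<in> ball 0 r" "w \<in> ball 0 r" "z \<noteq> w" for t z w
  proof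
    assume "u t z = u t w"
    then have "cmod a * cmod (z - w) \<le> cmod a / 2 * cmod (z - w)"
      using udiff[OF that(1-3)] by (simp add: norm_mult)
    then show False using that(4) \<open>a \<noteq> 0\<close> by simp
  qed
  have u0: "u t 0 = 0" for t by (simp add: u_def \<Phi>(6))
  have ubd: "cmod (u t z) \<le> 2 * cmod a * cmod z" if "t \<in> {0..1}" "z \<in> ball 0 r" for t z
  proof -
    have "cmod (u t z - a * z) \<le> cmod a / 2 * cmod z"
      using udiff[OF that, of 0] \<open>r > 0\<close> by (simp add: u0)
    then have "cmod (u t z) \<le> cmod a / 2 * cmod z + cmod a * cmod z"
      by (metis add.commute add_left_mono norm_mult norm_triangle_sub order_trans)
    also have "\<dots> \<le> 2 * cmod a * cmod z" by (simp add: mult_right_mono)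
    finally show ?thesis .
  qed
  obtain b where b: "b > 0" "inside \<gamma> \<subseteq> ball q b"
    using bounded_subset_ballD[OF J(4)] by blast
  \<comment> \<open>Points \<open>q + w\<close> with \<open>cmod w \<ge> m\<close> are clear of the inside, and remain so during the translation by \<open>- q\<close>.\<close>
  define m where "m = max B 0 + cmod q + b + 1"
  have "m > 0" using b by (simp add: m_def add_pos_nonneg add_nonneg_pos)
  define \<epsilon> where "\<epsilon> = min (r/2) (1 / (2 * cmod a * m))"
  have \<epsilon>: "\<epsilon> > 0" "\<epsilon> < r" "2 * cmod a * \<epsilon> * m \<le> 1"
    using \<open>r > 0\<close> \<open>m > 0\<close> \<open>a \<noteq> 0\<close> by (auto simp: \<epsilon>_def min_def field_simps)
  have "\<epsilon> < 1" using \<epsilon>(2) r(2) by linarith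
  define K where "K = 1 / (cmod a * \<epsilon>)"
  have "K \<ge> 2 * m" using \<epsilon> \<open>a \<noteq> 0\<close> by (simp add: K_def field_simps)
  have iso1: "isotopic (- inside \<gamma>) \<gamma> ((\<lambda>x. q + 1 / \<Phi> (of_real \<epsilon> * x)) ` unit_circle)"
  proof (rule isotopicI[where h = "\<lambda>p. q + 1 / \<Phi> (of_real (1 - fst p * (1 - \<epsilon>)) * snd p)"])
    have sc: "0 < 1 - t * (1 - \<epsilon>)" "1 - t * (1 - \<epsilon>) \<le> 1" if "t \<in> {0..1}" for t
    proof -
      have "t * (1 - \<epsilon>) \<le> 1 * (1 - \<epsilon>)" using that \<open>\<epsilon> < 1\<close> by (intro mult_right_mono) auto
      also have "\<dots> < 1" using \<epsilon> by simp
      finally show "0 < 1 - t * (1 - \<epsilon>)" by simp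
      show "1 - t * (1 - \<epsilon>) \<le> 1" using that \<open>\<epsilon> < 1\<close> by simp
    qed
    have arg: "of_real (1 - t * (1 - \<epsilon>)) * x \<in> cball 0 1" "of_real (1 - t * (1 - \<epsilon>)) * x \<noteq> 0"
      if "t \<in> {0..1}" "x \<in> unit_circle" for t x
      using sc[OF that(1)] that(2) by (auto simp: norm_mult simp del: of_real_diff of_real_mult)
    show "continuous_on ({0..1} \<times> unit_circle) (\<lambda>p. q + 1 / \<Phi> (of_real (1 - fst p * (1 - \<epsilon>)) * snd p))"
      using arg \<Phi>nz
      by (intro continuous_intros continuous_on_compose2[OF \<Phi>(1)]) (auto simp del: of_real_diff of_real_mult mem_cball_0 mult_eq_0_iff)
    show "(\<lambda>p. q + 1 / \<Phi> (of_real (1 - fst p * (1 - \<epsilon>)) * snd p)) ` ({0..1} \<times> unit_circle) \<subseteq> - inside \<gamma>"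
    proof (clarify)
      fix t :: real and x :: complex
      assume tx: "t \<in> {0..1}" "x \<in> unit_circle"
        and i: "q + 1 / \<Phi> (of_real (1 - fst (t, x) * (1 - \<epsilon>)) * snd (t, x)) \<in> inside \<gamma>"
      then show False using inv_notin[OF \<Phi>in[OF arg(1)[OF tx]] \<Phi>nz[OF arg[OF tx]]] by (simp del: of_real_diff of_real_mult)
    qed
    show "inj_on (\<lambda>x. q + 1 / \<Phi> (of_real (1 - fst (t, x) * (1 - \<epsilon>)) * snd (t, x))) unit_circle"
      if "t \<in> {0..1}" for t
    proof (rule inj_onI)
      fix x y assume xy: "x \<in> unit_circle" "y \<in> unit_circle"
        "q + 1 / \<Phi> (of_real (1 - fst (t, x) * (1 - \<epsilon>)) * snd (t, x)) = q + 1 / \<Phi> (of_real (1 - fst (t, y) * (1 - \<epsilon>)) * snd (t, y))"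
      then have "\<Phi> (of_real (1 - t * (1 - \<epsilon>)) * x) = \<Phi> (of_real (1 - t * (1 - \<epsilon>)) * y)"
        using \<Phi>nz[OF arg[OF that]] by (simp del: of_real_diff of_real_mult)
      then have "of_real (1 - t * (1 - \<epsilon>)) * x = of_real (1 - t * (1 - \<epsilon>)) * y"
        using inj_onD[OF \<Phi>(2)] arg(1)[OF that] xy(1,2) by blast
      then show "x = y" using sc[OF that] by (simp del: of_real_diff of_real_mult)
    qed
    have "(\<lambda>x. q + 1 / \<Phi> x) ` unit_circle = (\<lambda>w. q + 1 / w) ` \<gamma>'" by (simp add: \<Phi>(5)[symmetric] image_image)
    also have "\<dots> = (\<lambda>z. q + 1 / \<iota> z) ` \<gamma>" by (simp add: \<gamma>'_def image_image)
    also have "\<dots> = (\<lambda>z. z) ` \<gamma>"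
    proof (rule image_cong)
      fix z assume "z \<in> \<gamma>"
      then have "z \<noteq> q" using qn by blast
      then show "q + 1 / \<iota> z = z" by (rule \<iota>inv)
    qed simp
    finally show "(\<lambda>x. q + 1 / \<Phi> (of_real (1 - fst (0, x) * (1 - \<epsilon>)) * snd (0, x))) ` unit_circle = \<gamma>" by simp
  qed simp
  have far: "q + 1 / u t (of_real \<epsilon> * x) \<notin> inside \<gamma>" "u t (of_real \<epsilon> * x) \<noteq> 0"
    if "t \<in> {0..1}" "x \<in> unit_circle" for t x
  proof -
    have inb: "of_real \<epsilon> * x \<in> ball 0 r" "of_real \<epsilon> * x \<noteq> 0" using that \<epsilon> by (auto simp: norm_mult)
    show nz: "u t (of_real \<epsilon> * x) \<noteq> 0" using uinj[OF that(1) inb(1), of 0] inb \<open>r > 0\<close> u0 by simp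
    have "cmod (u t (of_real \<epsilon> * x)) * m \<le> 2 * cmod a * \<epsilon> * m"
      using ubd[OF that(1) inb(1)] that(2) \<epsilon> \<open>m > 0\<close> by (intro mult_right_mono) (auto simp: norm_mult)
    then have "cmod (1 / u t (of_real \<epsilon> * x)) \<ge> m"
      using \<epsilon>(3) nz by (simp add: norm_divide field_simps)
    moreover have "m > b" by (simp add: m_def add_nonneg_pos)
    ultimately show "q + 1 / u t (of_real \<epsilon> * x) \<notin> inside \<gamma>"
      using b(2) by (auto simp: dist_norm subset_iff)
  qed
  have iso2: "isotopic (- inside \<gamma>) ((\<lambda>x. q + 1 / \<Phi> (of_real \<epsilon> * x)) ` unit_circle) ((\<lambda>x. q + 1 / (a * of_real \<epsilon> * x)) ` unit_circle)"
  proof (rule isotopicI[where h = "\<lambda>p. q + 1 / u (fst p) (of_real \<epsilon> * snd p)"])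
    have sub: "of_real \<epsilon> * x \<in> cball 0 1" if "x \<in> unit_circle" for x :: complex
      using that \<epsilon> \<open>\<epsilon> < 1\<close> by (simp add: norm_mult)
    have "continuous_on ({0..1} \<times> unit_circle) (\<lambda>p. \<Phi> (of_real \<epsilon> * snd p))"
      by (rule continuous_on_compose2[OF \<Phi>(1)]) (use sub in \<open>auto intro!: continuous_intros simp del: mem_cball_0\<close>)
    then have "continuous_on ({0..1} \<times> unit_circle) (\<lambda>p. u (fst p) (of_real \<epsilon> * snd p))"
      unfolding u_def by (intro continuous_intros)
    then show "continuous_on ({0..1} \<times> unit_circle) (\<lambda>p. q + 1 / u (fst p) (of_real \<epsilon> * snd p))"
      by (intro continuous_intros) (use far(2) in auto)
    show "(\<lambda>p. q + 1 / u (fst p) (of_real \<epsilon> * snd p)) ` ({0..1} \<times> unit_circle) \<subseteq> - inside \<gamma>"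
      using far(1) by auto
    show "inj_on (\<lambda>x. q + 1 / u (fst (t, x)) (of_real \<epsilon> * snd (t, x))) unit_circle" if t: "t \<in> {0..1}" for t
    proof (rule inj_onI)
      fix x y assume xy: "x \<in> unit_circle" "y \<in> unit_circle"
        "q + 1 / u (fst (t, x)) (of_real \<epsilon> * snd (t, x)) = q + 1 / u (fst (t, y)) (of_real \<epsilon> * snd (t, y))"
      have "u t (of_real \<epsilon> * x) = u t (of_real \<epsilon> * y)" using xy(3) by simp
      moreover have "of_real \<epsilon> * x \<in> ball 0 r" "of_real \<epsilon> * y \<in> ball 0 r" using xy \<epsilon> by (auto simp: norm_mult)
      ultimately have "of_real \<epsilon> * x = of_real \<epsilon> * y" using uinj[OF t] by blast
      then show "x = y" using \<epsilon> by simp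
    qed
  qed (auto simp: u_def mult.assoc)
  have circ: "(\<lambda>x. q + 1 / (a * of_real \<epsilon> * x)) ` unit_circle = (\<lambda>x. q + of_real K * x) ` unit_circle"
  proof -
    have anz: "of_real (cmod a) \<noteq> (0::complex)" using \<open>a \<noteq> 0\<close> by simp
    define c where "c = of_real (cmod a) / a"
    have c: "cmod c = 1" using \<open>a \<noteq> 0\<close> by (simp add: c_def norm_divide)
    have "1 / (a * of_real \<epsilon> * x) = of_real K * (c * inverse x)" if "x \<in> unit_circle" for x
      using that \<open>a \<noteq> 0\<close> \<epsilon> anz by (auto simp: K_def c_def field_simps)
    then have "(\<lambda>x. q + 1 / (a * of_real \<epsilon> * x)) ` unit_circle = (\<lambda>x. q + of_real K * (c * inverse x)) ` unit_circle"
      by (intro image_cong) auto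
    also have "\<dots> = (\<lambda>y. q + of_real K * y) ` (\<lambda>x. c * x) ` inverse ` unit_circle"
      by (simp only: image_image)
    also have "inverse ` unit_circle = unit_circle"
    proof
      show "inverse ` unit_circle \<subseteq> unit_circle" by (auto simp: norm_inverse)
      show "unit_circle \<subseteq> inverse ` unit_circle"
      proof
        fix z :: complex assume "z \<in> unit_circle"
        then show "z \<in> inverse ` unit_circle" by (intro image_eqI[of _ _ "inverse z"]) (auto simp: norm_inverse)
      qed
    qed
    finally show ?thesis by (simp only: mult_unit_circle[OF c])
  qed
  have "K > 0" using \<open>K \<ge> 2 * m\<close> \<open>m > 0\<close> by linarith
  have iso3: "isotopic (- inside \<gamma>) ((\<lambda>x. q + of_real K * x) ` unit_circle) (sphere 0 K)"
  proof (rule isotopicI[where h = "\<lambda>p. (1 - of_real (fst p)) * q + of_real K * snd p"])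
    show "continuous_on ({0..1} \<times> unit_circle) (\<lambda>p. (1 - of_real (fst p)) * q + of_real K * snd p)"
      by (intro continuous_intros)
    show "(\<lambda>p. (1 - of_real (fst p)) * q + of_real K * snd p) ` ({0..1} \<times> unit_circle) \<subseteq> - inside \<gamma>"
    proof (clarify)
      fix t :: real and x :: complex
      assume tx: "t \<in> {0..1}" "x \<in> unit_circle"
        and i: "(1 - of_real (fst (t, x))) * q + of_real K * snd (t, x) \<in> inside \<gamma>"
      then have "dist q ((1 - of_real t) * q + of_real K * x) < b" using b(2) by auto
      moreover have "dist q ((1 - of_real t) * q + of_real K * x) = cmod (of_real t * q - of_real K * x)"
        by (simp add: dist_norm algebra_simps)
      moreover have "cmod (of_real K * x) \<le> cmod (of_real t * q - of_real K * x) + cmod (of_real t * q)"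
        by (metis add.commute norm_minus_commute norm_triangle_sub)
      moreover have "cmod (of_real t * q) \<le> 1 * cmod q" using tx unfolding norm_mult by (intro mult_right_mono) auto
      moreover have "cmod (of_real K * x) = K" using tx \<open>K > 0\<close> by (simp add: norm_mult)
      moreover have "2 * m \<ge> m" "m > b + cmod q" using \<open>m > 0\<close> by (auto simp: m_def)
      ultimately show False using \<open>K \<ge> 2 * m\<close> by linarith
    qed
    show "inj_on (\<lambda>x. (1 - of_real (fst (t, x))) * q + of_real K * snd (t, x)) unit_circle" for t :: real
      using \<open>K > 0\<close> by (auto simp: inj_on_def)
  qed (use image_mult_unit_circle[OF \<open>K > 0\<close>] in auto)
  show thesis
  proof (rule that)
    have "2 * m > m" using \<open>m > 0\<close> by linarith
    moreover have "m > B" using b(1) norm_ge_zero[of q] max.cobounded1[of B 0] unfolding m_def by linarith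
    ultimately show "K > B" using \<open>K \<ge> 2 * m\<close> by linarith
    show "isotopic (- inside \<gamma>) \<gamma> (sphere 0 K)"
      using isotopic_trans[OF iso1 isotopic_trans[OF iso2[unfolded circ] iso3]] .
  qed fact
qed

text \<open>
  It carries an isotopy from the plane into the unit disc without moving the points of a smaller disc. The
  modulus \<open>s\<close> becomes \<open>1 - (1 - r) * r / s\<close> for \<open>s \<ge> r\<close>, which increases from \<open>r\<close> to \<open>1\<close>.
\<close>

lemma radial_compression:
  assumes r: "0 < r" "r < 1"
  obtains \<theta> :: "complex \<Rightarrow> complex" where "continuous_on UNIV \<theta>" "inj \<theta>"
    "\<And>z. cmod z \<le> r \<Longrightarrow> \<theta> z = z" "\<And>z. \<theta> z \<in> ball 0 1"
    "\<And>L. L > 0 \<Longrightarrow> \<exists>m>0. m < 1 \<and> (r < L \<longrightarrow> r < m) \<and> \<theta> ` sphere 0 L = sphere 0 m"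
proof -
  define \<mu> where "\<mu> = (\<lambda>s. (1 - (1 - r) * r / max s r) / max s r)"
  have \<mu>pos: "\<mu> s > 0" for s
  proof -
    have "(1 - r) * r / max s r \<le> (1 - r) * 1"
      using r by (simp add: divide_le_eq mult_left_mono)
    also have "\<dots> < 1" using r by simp
    finally have "1 - (1 - r) * r / max s r > 0" by simp
    then show ?thesis using r by (simp add: \<mu>_def)
  qed
  have \<mu>small: "\<mu> s = 1" if "s \<le> r" for s using that r by (simp add: \<mu>_def max_def)
  have \<mu>large: "s * \<mu> s = 1 - (1 - r) * r / s" if "s \<ge> r" for s
    using that r by (simp add: \<mu>_def max_def)
  have mono: "s * \<mu> s < t * \<mu> t" if "0 \<le> s" "s < t" for s t
  proof -
    have 1: "s * \<mu> s < t * \<mu> t" if "r \<le> s" "s < t" for s t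
    proof -
      have "(1 - r) * r / t < (1 - r) * r / s" using that r by (intro divide_strict_left_mono) auto
      then show ?thesis using that by (simp add: \<mu>large)
    qed
    show ?thesis
    proof (cases "r \<le> s")
      case True then show ?thesis using 1 that by blast
    next
      case False
      show ?thesis
      proof (cases "t \<le> r")
        case True then show ?thesis using that False by (simp add: \<mu>small)
      next
        case t: False
        have "s * \<mu> s < r * \<mu> r" using False by (simp add: \<mu>small)
        also have "\<dots> < t * \<mu> t" using t by (intro 1) auto
        finally show ?thesis .
      qed
    qed
  qed
  have lt1: "s * \<mu> s < 1" if "0 \<le> s" for s
  proof (cases "s \<le> r")
    case True then show ?thesis using r by (simp add: \<mu>small)
  next
    case False
    then have "(1 - r) * r / s > 0" using r by simp
    then show ?thesis using False \<mu>large[of s] by simp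
  qed
  define \<theta> where "\<theta> = (\<lambda>z::complex. of_real (\<mu> (cmod z)) * z)"
  have n\<theta>: "cmod (\<theta> z) = cmod z * \<mu> (cmod z)" for z
    using \<mu>pos[of "cmod z"] by (simp add: \<theta>_def norm_mult)
  show thesis
  proof
    show "continuous_on UNIV \<theta>"
      unfolding \<theta>_def \<mu>_def using r by (intro continuous_intros) auto
    show "inj \<theta>"
    proof (rule injI)
      fix z w assume eq: "\<theta> z = \<theta> w"
      have "cmod z = cmod w"
      proof (rule ccontr)
        assume "cmod z \<noteq> cmod w"
        then show False
          using mono[of "cmod z" "cmod w"] mono[of "cmod w" "cmod z"] n\<theta>[of z] n\<theta>[of w] eq
          by (metis less_irrefl linorder_neqE_linordered_idom norm_ge_zero)
      qed
      then show "z = w" using eq \<mu>pos[of "cmod w"] by (simp add: \<theta>_def)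
    qed
    show "\<theta> z = z" if "cmod z \<le> r" for z using that by (simp add: \<theta>_def \<mu>small)
    show "\<theta> z \<in> ball 0 1" for z using lt1[of "cmod z"] by (simp add: n\<theta>)
    show "\<exists>m>0. m < 1 \<and> (r < L \<longrightarrow> r < m) \<and> \<theta> ` sphere 0 L = sphere 0 m" if "L > 0" for L
    proof (intro exI[of _ "L * \<mu> L"] conjI impI)
      show "L * \<mu> L > 0" using that \<mu>pos by simp
      show "L * \<mu> L < 1" using lt1 that by simp
      show "r < L * \<mu> L" if "r < L" using mono[of r L] r that by (simp add: \<mu>small)
      show "\<theta> ` sphere 0 L = sphere 0 (L * \<mu> L)"
      proof
        show "\<theta> ` sphere 0 L \<subseteq> sphere 0 (L * \<mu> L)" using n\<theta> by auto
        show "sphere 0 (L * \<mu> L) \<subseteq> \<theta> ` sphere 0 L"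
        proof
          fix z :: complex assume z: "z \<in> sphere 0 (L * \<mu> L)"
          then have "cmod (z / of_real (\<mu> L)) = L" using \<mu>pos[of L] by (simp add: norm_divide)
          then show "z \<in> \<theta> ` sphere 0 L"
            using \<mu>pos[of L] by (intro image_eqI[of _ _ "z / of_real (\<mu> L)"]) (auto simp: \<theta>_def)
        qed
      qed
    qed
  qed
qed

lemma inside_subset_convex:
  fixes S T :: "complex set"
  assumes "S \<subseteq> T" "convex T"
  shows "inside S \<subseteq> T"
  using outside_subset_convex[OF assms(2,1)] inside_Int_outside[of S] by blast

text \<open>
  The isotopy to a large circle is compressed into the disc. The compression fixes \<open>\<gamma>\<close>
  and its inside, so by injectivity nothing else is moved into the inside. The large circle becomes a circle
  in the disc, which expands to the unit circle.
\<close>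

lemma isotopic_unit_circle_in_disc:
  fixes f :: "complex \<Rightarrow> complex"
  assumes f: "circle_embedding f" and \<gamma>: "\<gamma> = f ` unit_circle" and sub: "\<gamma> \<subseteq> ball 0 1"
  shows "isotopic (cball 0 1 - inside \<gamma>) \<gamma> unit_circle"
proof -
  note J = Jordan_circle_embedding[OF f \<gamma>]
  obtain r where r: "0 < r" "r < 1" "\<gamma> \<subseteq> cball 0 r"
  proof -
    obtain z where z: "z \<in> \<gamma>" "\<And>w. w \<in> \<gamma> \<Longrightarrow> cmod w \<le> cmod z"
      using continuous_attains_sup[OF J(11,13), of cmod] by (auto intro: continuous_intros)
    then have "cmod z < 1" using sub by auto
    show thesis
    proof (rule that[of "(1 + cmod z)/2"])
      show "0 < (1 + cmod z)/2" by (simp add: add_pos_nonneg)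
      show "\<gamma> \<subseteq> cball 0 ((1 + cmod z)/2)" using z(2) \<open>cmod z < 1\<close> by fastforce
    qed (use \<open>cmod z < 1\<close> in simp)
  qed
  have inr: "inside \<gamma> \<subseteq> cball 0 r" using inside_subset_convex[OF r(3)] by simp
  obtain \<theta> :: "complex \<Rightarrow> complex" where \<theta>: "continuous_on UNIV \<theta>" "inj \<theta>"
    "\<And>z. cmod z \<le> r \<Longrightarrow> \<theta> z = z" "\<And>z. \<theta> z \<in> ball 0 1"
    "\<And>L. L > 0 \<Longrightarrow> \<exists>m>0. m < 1 \<and> (r < L \<longrightarrow> r < m) \<and> \<theta> ` sphere 0 L = sphere 0 m"
    using radial_compression[OF r(1,2)] by metis
  obtain L where L: "L > r" "L > 0" "isotopic (- inside \<gamma>) \<gamma> (sphere 0 L)"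
    using isotopic_large_circle[OF f \<gamma>] by metis
  obtain m where m: "0 < m" "m < 1" "r < m" "\<theta> ` sphere 0 L = sphere 0 m"
    using \<theta>(5)[OF L(2)] L(1) by blast
  have avoid: "\<theta> z \<notin> inside \<gamma>" if "z \<notin> inside \<gamma>" for z
  proof
    assume a: "\<theta> z \<in> inside \<gamma>"
    then have "\<theta> (\<theta> z) = \<theta> z" using inr by (intro \<theta>(3)) auto
    then have "\<theta> z = z" using \<theta>(2) by (simp add: inj_eq)
    then show False using a that by simp
  qed
  have "isotopic (cball 0 1 - inside \<gamma>) (\<theta> ` \<gamma>) (\<theta> ` sphere 0 L)"
  proof (rule isotopic_image[OF L(3)])
    show "continuous_on (- inside \<gamma>) \<theta>" using \<theta>(1) continuous_on_subset by blast
    show "inj_on \<theta> (- inside \<gamma>)" using \<theta>(2) inj_on_subset by blast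
    have "cmod (\<theta> z) \<le> 1" for z using \<theta>(4)[of z] by simp
    then show "\<theta> ` (- inside \<gamma>) \<subseteq> cball 0 1 - inside \<gamma>" using avoid by auto
  qed
  moreover have "\<theta> ` \<gamma> = \<gamma>"
  proof -
    have "\<theta> ` \<gamma> = (\<lambda>z. z) ` \<gamma>" by (rule image_cong) (use \<theta>(3) r(3) in auto)
    then show ?thesis by simp
  qed
  ultimately have 1: "isotopic (cball 0 1 - inside \<gamma>) \<gamma> (sphere 0 m)" by (simp add: m(4))
  have 2: "isotopic (cball 0 1 - inside \<gamma>) (sphere 0 m) unit_circle"
  proof (rule isotopicI[where h = "\<lambda>p. of_real (m + fst p * (1 - m)) * snd p"])
    have b: "m \<le> m + t * (1 - m)" "m + t * (1 - m) \<le> 1" if "t \<in> {0..1}" for t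
    proof -
      show "m \<le> m + t * (1 - m)" using that m by simp
      have "t * (1 - m) \<le> 1 * (1 - m)" using that m by (intro mult_right_mono) auto
      then show "m + t * (1 - m) \<le> 1" by simp
    qed
    have n: "cmod (of_real (m + t * (1 - m)) * x) = m + t * (1 - m)" if "t \<in> {0..1}" "x \<in> unit_circle" for t x
      using b(1)[OF that(1)] m that(2) unfolding norm_mult norm_of_real by simp
    show "continuous_on ({0..1} \<times> unit_circle) (\<lambda>p. complex_of_real (m + fst p * (1 - m)) * snd p)"
      by (intro continuous_intros)
    show "(\<lambda>p. complex_of_real (m + fst p * (1 - m)) * snd p) ` ({0..1} \<times> unit_circle) \<subseteq> cball 0 1 - inside \<gamma>"
    proof
      fix y assume "y \<in> (\<lambda>p. complex_of_real (m + fst p * (1 - m)) * snd p) ` ({0..1} \<times> unit_circle)"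
      then obtain t x where tx: "t \<in> {0..1}" "x \<in> unit_circle" "y = of_real (m + t * (1 - m)) * x" by force
      then have "cmod y = m + t * (1 - m)" using n by blast
      then have "cmod y \<le> 1" "cmod y > r" using b[OF tx(1)] m(3) by auto
      then show "y \<in> cball 0 1 - inside \<gamma>" using inr by auto
    qed
    show "inj_on (\<lambda>x. complex_of_real (m + fst (t, x) * (1 - m)) * snd (t, x)) unit_circle" if "t \<in> {0..1}" for t
    proof (rule inj_onI)
      fix x y assume "complex_of_real (m + fst (t, x) * (1 - m)) * snd (t, x) = complex_of_real (m + fst (t, y) * (1 - m)) * snd (t, y)"
      moreover have "complex_of_real (m + t * (1 - m)) \<noteq> 0" using b(1)[OF that] m by (simp only: of_real_eq_0_iff)
      ultimately show "x = y" by (simp del: of_real_add of_real_mult)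
    qed
  qed (use image_mult_unit_circle[OF m(1)] in auto)
  show ?thesis by (rule isotopic_trans[OF 1 2])
qed

lemma clopen_contains_connected:
  fixes V W S :: "complex set"
  assumes "open W" "closed (W \<union> S)" "connected V" "V \<inter> S = {}" "V \<inter> W \<noteq> {}"
  shows "V \<subseteq> W"
proof -
  have o: "open (- (W \<union> S))" using assms(2) by (rule open_Compl)
  have "W \<inter> V = {} \<or> - (W \<union> S) \<inter> V = {}"
    by (rule connectedD[OF assms(3) assms(1) o]) (use assms(4) in blast)+
  then show ?thesis using assms(4,5) by blast
qed

text \<open>
  The extended Riemann map of the inside of \<open>\<delta>\<close> turns \<open>\<delta>\<close> into the unit circle and \<open>\<gamma>\<close> into a Jordan
  curve in the disc.
\<close>

theorem isotopic_nested_Jordan_curves: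
  fixes f g :: "complex \<Rightarrow> complex"
  assumes f: "circle_embedding f" and \<gamma>: "\<gamma> = f ` unit_circle"
    and g: "circle_embedding g" and \<delta>: "\<delta> = g ` unit_circle"
    and nest: "\<gamma> \<union> inside \<gamma> \<subseteq> inside \<delta>"
  shows "isotopic ((inside \<delta> \<union> \<delta>) - inside \<gamma>) \<gamma> \<delta>"
proof -
  note J\<gamma> = Jordan_circle_embedding[OF f \<gamma>]
  note J\<delta> = Jordan_circle_embedding[OF g \<delta>]
  obtain q where q: "q \<in> inside \<delta>" using J\<delta>(1) by blast
  obtain \<Phi> where \<Phi>: "continuous_on (cball 0 1) \<Phi>" "inj_on \<Phi> (cball 0 1)" 
    "\<Phi> ` ball 0 1 = inside \<delta>" "\<Phi> ` unit_circle = \<delta>"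
    using Jordan_Riemann_map[OF g \<delta> q] by metis
  have im: "\<Phi> ` cball 0 1 = inside \<delta> \<union> \<delta>"
  proof -
    have "cball (0::complex) 1 = ball 0 1 \<union> unit_circle" by auto
    then show ?thesis by (simp only: image_Un \<Phi>(3,4))
  qed
  obtain \<Psi> where hom: "homeomorphism (cball 0 1) (inside \<delta> \<union> \<delta>) \<Phi> \<Psi>"
    using homeomorphism_compact[OF compact_cball \<Phi>(1) im \<Phi>(2)] by blast
  have \<Psi>\<Phi>: "\<Psi> (\<Phi> z) = z" if "z \<in> cball 0 1" for z using hom that by (simp add: homeomorphism_def)
  have \<Phi>\<Psi>: "\<Phi> (\<Psi> w) = w" if "w \<in> inside \<delta> \<union> \<delta>" for w using hom that by (simp add: homeomorphism_def)
  have cont\<Psi>: "continuous_on (inside \<delta> \<union> \<delta>) \<Psi>" using hom by (simp add: homeomorphism_def)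
  have inj\<Psi>: "inj_on \<Psi> (inside \<delta> \<union> \<delta>)" using \<Phi>\<Psi> by (rule inj_on_inverseI)
  have \<Psi>ball: "\<Psi> w \<in> ball 0 1" if w: "w \<in> inside \<delta>" for w
  proof -
    obtain z where "z \<in> ball 0 1" "w = \<Phi> z" using w \<Phi>(3) by blast
    then show ?thesis using \<Psi>\<Phi>[of z] by simp
  qed
  have sub: "\<gamma> \<subseteq> inside \<delta> \<union> \<delta>" "inside \<gamma> \<union> \<gamma> \<subseteq> inside \<delta> \<union> \<delta>" using nest by auto
  define \<gamma>1 where "\<gamma>1 = \<Psi> ` \<gamma>"
  have emb1: "circle_embedding (\<Psi> \<circ> f)"
    using sub(1) unfolding \<gamma>
    by (intro circle_embedding_compose[OF f] continuous_on_subset[OF cont\<Psi>] inj_on_subset[OF inj\<Psi>])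
  have \<gamma>1_eq: "\<gamma>1 = (\<Psi> \<circ> f) ` unit_circle" by (simp add: \<gamma>1_def \<gamma> image_comp)
  note J1 = Jordan_circle_embedding[OF emb1 \<gamma>1_eq]
  have \<gamma>1b: "\<gamma>1 \<subseteq> ball 0 1" unfolding \<gamma>1_def using nest \<Psi>ball by blast
  have iso: "isotopic (cball 0 1 - inside \<gamma>1) \<gamma>1 unit_circle"
    by (rule isotopic_unit_circle_in_disc[OF emb1 \<gamma>1_eq \<gamma>1b])
  define W where "W = \<Psi> ` inside \<gamma>"
  \<comment> \<open>The preimage \<open>W\<close> of the inside of \<open>\<gamma>\<close> must not be touched by the isotopy in the disc, which avoids the inside of \<open>\<gamma>1\<close>.\<close>
  have W_in: "W \<subseteq> inside \<gamma>1"
  proof (rule ccontr)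
    assume n: "\<not> W \<subseteq> inside \<gamma>1"
    have conW: "connected W" unfolding W_def
      by (intro connected_continuous_image continuous_on_subset[OF cont\<Psi>] J\<gamma>) (use nest in auto)
    have disW: "W \<inter> \<gamma>1 = {}"
    proof -
      have "W \<inter> \<gamma>1 = \<Psi> ` (inside \<gamma> \<inter> \<gamma>)"
        unfolding W_def \<gamma>1_def using sub(2) by (intro inj_on_image_Int[OF inj\<Psi>, symmetric]) auto
      then show ?thesis by simp
    qed
    obtain x where x: "x \<in> W" "x \<in> outside \<gamma>1"
      using n disW inside_Un_outside[of \<gamma>1] by blast
    have "W = ball 0 1 \<inter> \<Phi> -` inside \<gamma>"
    proof
      show "W \<subseteq> ball 0 1 \<inter> \<Phi> -` inside \<gamma>" using nest \<Psi>ball \<Phi>\<Psi> unfolding W_def by fastforce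
      show "ball 0 1 \<inter> \<Phi> -` inside \<gamma> \<subseteq> W"
      proof
        fix z assume z: "z \<in> ball 0 1 \<inter> \<Phi> -` inside \<gamma>"
        then have "\<Psi> (\<Phi> z) = z" by (intro \<Psi>\<Phi>) auto
        then show "z \<in> W" using z unfolding W_def by (metis IntD2 imageI vimageD)
      qed
    qed
    moreover have "open (ball 0 1 \<inter> \<Phi> -` inside \<gamma>)"
      by (intro continuous_open_preimage continuous_on_subset[OF \<Phi>(1)] J\<gamma>) auto
    ultimately have "open W" by simp
    have "compact (inside \<gamma> \<union> \<gamma>)"
      using J\<gamma>(4,9) by (metis closure_Un_frontier compact_closure)
    then have "compact (\<Psi> ` (inside \<gamma> \<union> \<gamma>))"
      by (intro compact_continuous_image continuous_on_subset[OF cont\<Psi> sub(2)])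
    then have "closed (W \<union> \<gamma>1)" unfolding W_def \<gamma>1_def image_Un[symmetric] by (rule compact_imp_closed)
    then have "outside \<gamma>1 \<subseteq> W"
      using clopen_contains_connected[OF \<open>open W\<close> _ J1(7)] x outside_no_overlap[of \<gamma>1] by blast
    moreover have "W \<subseteq> ball 0 1" unfolding W_def using nest \<Psi>ball by blast
    ultimately have "bounded (outside \<gamma>1)" using bounded_ball bounded_subset by blast
    then show False using J1(8) by blast
  qed
  have "isotopic ((inside \<delta> \<union> \<delta>) - inside \<gamma>) (\<Phi> ` \<gamma>1) (\<Phi> ` unit_circle)"
  proof (rule isotopic_image[OF iso])
    show "continuous_on (cball 0 1 - inside \<gamma>1) \<Phi>" using \<Phi>(1) by (rule continuous_on_subset) auto
    show "inj_on \<Phi> (cball 0 1 - inside \<gamma>1)" using \<Phi>(2) by (rule inj_on_subset) auto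
    show "\<Phi> ` (cball 0 1 - inside \<gamma>1) \<subseteq> inside \<delta> \<union> \<delta> - inside \<gamma>"
    proof (rule image_subsetI)
      fix z assume z: "z \<in> cball 0 1 - inside \<gamma>1"
      then have "\<Phi> z \<in> inside \<delta> \<union> \<delta>" using im by blast
      moreover have "\<Phi> z \<notin> inside \<gamma>"
      proof
        assume "\<Phi> z \<in> inside \<gamma>"
        then have "z \<in> W" using \<Psi>\<Phi>[of z] z unfolding W_def by (metis DiffD1 imageI)
        then show False using W_in z by blast
      qed
      ultimately show "\<Phi> z \<in> inside \<delta> \<union> \<delta> - inside \<gamma>" by blast
    qed
  qed
  moreover have "\<Phi> ` \<gamma>1 = \<gamma>"
  proof -
    have "\<Phi> ` \<gamma>1 = (\<lambda>w. w) ` \<gamma>"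
      unfolding \<gamma>1_def image_image by (rule image_cong) (use \<Phi>\<Psi> sub in auto)
    then show ?thesis by simp
  qed
  ultimately show ?thesis by (simp add: \<Phi>(4))
qed

lemma disjoint_Jordan_curves_cases:
  fixes f g :: "complex \<Rightarrow> complex"
  assumes f: "circle_embedding f" and \<gamma>: "\<gamma> = f ` unit_circle"
    and g: "circle_embedding g" and \<delta>: "\<delta> = g ` unit_circle"
    and disj: "\<gamma> \<inter> \<delta> = {}"
  obtains "\<gamma> \<union> inside \<gamma> \<subseteq> inside \<delta>" | "\<delta> \<union> inside \<delta> \<subseteq> inside \<gamma>" | "inside \<gamma> \<inter> inside \<delta> = {}"
proof -
  have one: "\<gamma> \<union> inside \<gamma> \<subseteq> inside \<delta> \<or> \<gamma> \<subseteq> outside \<delta>"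
    if f: "circle_embedding f" and \<gamma>: "\<gamma> = f ` unit_circle"
    and g: "circle_embedding g" and \<delta>: "\<delta> = g ` unit_circle"
    and disj: "\<gamma> \<inter> \<delta> = {}" for f g :: "complex \<Rightarrow> complex" and \<gamma> \<delta>
  proof -
    note J\<gamma> = Jordan_circle_embedding[OF f \<gamma>] and J\<delta> = Jordan_circle_embedding[OF g \<delta>]
    obtain x where x: "x \<in> \<gamma>" using J\<gamma>(13) by blast
    then have "x \<in> inside \<delta> \<or> x \<in> outside \<delta>" using disj inside_Un_outside[of \<delta>] by blast
    then show ?thesis
    proof
      assume "x \<in> outside \<delta>"
      then show ?thesis using connected_subset_outside[OF J\<gamma>(12) disj x] by blast
    next
      assume "x \<in> inside \<delta>"
      then have sub: "\<gamma> \<subseteq> inside \<delta>" using connected_subset_inside[OF J\<gamma>(12) disj x] by blast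
      have con: "connected (\<delta> \<union> outside \<delta>)"
        using J\<delta>(7,10) by (metis closure_Un_frontier connected_imp_connected_closure sup_commute)
      have dis: "(\<delta> \<union> outside \<delta>) \<inter> \<gamma> = {}" using sub disj inside_Int_outside[of \<delta>] by blast
      have "\<not> (\<delta> \<union> outside \<delta>) \<subseteq> inside \<gamma>" using J\<gamma>(4) J\<delta>(8) bounded_subset by blast
      then obtain y where "y \<in> \<delta> \<union> outside \<delta>" "y \<in> outside \<gamma>"
        using dis inside_Un_outside[of \<gamma>] by blast
      then have "\<delta> \<union> outside \<delta> \<subseteq> outside \<gamma>" using connected_subset_outside[OF con dis] by blast
      then have "inside \<gamma> \<subseteq> inside \<delta>"
        using inside_Int_outside[of \<gamma>] inside_Un_outside[of \<delta>] by blast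
      then show ?thesis using sub by blast
    qed
  qed
  note J\<gamma> = Jordan_circle_embedding[OF f \<gamma>] and J\<delta> = Jordan_circle_embedding[OF g \<delta>]
  consider "\<gamma> \<union> inside \<gamma> \<subseteq> inside \<delta>" | "\<delta> \<union> inside \<delta> \<subseteq> inside \<gamma>" | "\<gamma> \<subseteq> outside \<delta>" "\<delta> \<subseteq> outside \<gamma>"
    using one[OF f \<gamma> g \<delta> disj] one[OF g \<delta> f \<gamma>] disj by blast
  then show thesis
  proof cases
    case 3
    have "inside \<gamma> \<inter> inside \<delta> = {}"
    proof (rule ccontr)
      assume "inside \<gamma> \<inter> inside \<delta> \<noteq> {}"
      then obtain x where x: "x \<in> inside \<gamma>" "x \<in> inside \<delta>" by blast
      have "inside \<gamma> \<inter> \<delta> = {}" using 3 inside_Int_outside[of \<gamma>] by blast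
      then have "inside \<gamma> \<subseteq> inside \<delta>" using connected_subset_inside[OF J\<gamma>(3) _ x] by blast
      then have "closure (inside \<gamma>) \<subseteq> closure (inside \<delta>)" by (rule closure_mono)
      then have "\<gamma> \<subseteq> inside \<delta> \<union> \<delta>" using J\<gamma>(9) J\<delta>(9) by (metis Un_subset_iff closure_Un_frontier)
      then show False using 3 J\<gamma>(13) disj inside_Int_outside[of \<delta>] by blast
    qed
    then show thesis by (rule that(3))
  qed (use that in auto)
qed

section \<open>Curve graphs of homeomorphic surfaces\<close>

lemma homeomorphism_image_image:
  assumes "homeomorphism S T k k'" "A \<subseteq> S"
  shows "k' ` k ` A = A"
proof -
  have "k' ` k ` A = (\<lambda>x. x) ` A"
    unfolding image_image by (rule image_cong) (use assms in \<open>auto simp: homeomorphism_def\<close>)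
  then show ?thesis by simp
qed

lemma homeomorphism_surface_boundary:
  fixes S :: "'a::topological_space set" and T :: "'b::topological_space set"
  assumes hom: "homeomorphism S T k k'"
  shows "k ` surface_boundary S \<subseteq> surface_boundary T"
proof (rule image_subsetI)
  fix x assume x: "x \<in> surface_boundary S"
  then have xS: "x \<in> S" by (simp add: surface_boundary_def)
  have "\<nexists>U. openin (top_of_set T) U \<and> k x \<in> U \<and> U homeomorphic ball (0::complex) 1"
  proof
    assume "\<exists>U. openin (top_of_set T) U \<and> k x \<in> U \<and> U homeomorphic ball (0::complex) 1"
    then obtain U where U: "openin (top_of_set T) U" "k x \<in> U" "U homeomorphic ball (0::complex) 1" by blast
    have UT: "U \<subseteq> T" using U(1) openin_imp_subset by blast
    have "openin (top_of_set S) (k' ` U)"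
      using homeomorphism_imp_open_map[OF homeomorphism_symD[OF hom] U(1)] .
    moreover have "x \<in> k' ` U" using U(2) hom xS by (metis homeomorphism_apply1 imageI)
    moreover have "k' ` U homeomorphic ball (0::complex) 1"
    proof -
      have "homeomorphism U (k' ` U) k' k"
        by (rule homeomorphism_of_subsets[OF homeomorphism_symD[OF hom] UT]) (use hom UT in \<open>auto simp: homeomorphism_def\<close>)
      then have "k' ` U homeomorphic U" using homeomorphic_def homeomorphic_sym by blast
      then show ?thesis using U(3) homeomorphic_trans by blast
    qed
    ultimately show False using x by (auto simp: surface_boundary_def)
  qed
  moreover have "k x \<in> T" using hom xS by (auto simp: homeomorphism_def)
  ultimately show "k x \<in> surface_boundary T" by (simp add: surface_boundary_def)
qed

lemma homeomorphism_surface_boundary_eq: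
  fixes S :: "'a::topological_space set" and T :: "'b::topological_space set"
  assumes hom: "homeomorphism S T k k'"
  shows "k ` surface_boundary S = surface_boundary T"
proof
  show "surface_boundary T \<subseteq> k ` surface_boundary S"
  proof
    fix y assume y: "y \<in> surface_boundary T"
    then have "y \<in> T" by (simp add: surface_boundary_def)
    then have "k (k' y) = y" using hom by (simp add: homeomorphism_def)
    then show "y \<in> k ` surface_boundary S"
      using homeomorphism_surface_boundary[OF homeomorphism_symD[OF hom]] y by (metis image_eqI image_subset_iff)
  qed
qed (rule homeomorphism_surface_boundary[OF hom])

lemma homeomorphism_components_image:
  fixes S :: "'a::topological_space set" and T :: "'b::topological_space set"
  assumes hom: "homeomorphism S T k k'" and "\<beta> \<in> components S"
  shows "k ` \<beta> \<in> components T"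
proof -
  have b: "\<beta> \<noteq> {}" "\<beta> \<subseteq> S" "connected \<beta>" "\<And>D. D \<noteq> {} \<Longrightarrow> \<beta> \<subseteq> D \<Longrightarrow> D \<subseteq> S \<Longrightarrow> connected D \<Longrightarrow> D = \<beta>"
    using assms(2)[unfolded in_components_maximal] by simp_all
  have ck: "continuous_on S k" "continuous_on T k'" "k ` S = T" "k' ` T = S"
    "\<And>x. x \<in> S \<Longrightarrow> k' (k x) = x" "\<And>y. y \<in> T \<Longrightarrow> k (k' y) = y"
    using hom by (auto simp: homeomorphism_def)
  show ?thesis unfolding in_components_maximal
  proof (intro conjI allI impI)
    show "k ` \<beta> \<noteq> {}" "k ` \<beta> \<subseteq> T" using b ck(3) by auto
    show "connected (k ` \<beta>)" using b ck by (intro connected_continuous_image continuous_on_subset[OF ck(1)])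
    fix D assume D: "D \<noteq> {} \<and> k ` \<beta> \<subseteq> D \<and> D \<subseteq> T \<and> connected D"
    have "k' ` k ` \<beta> \<subseteq> k' ` D" using D by (intro image_mono) simp
    then have "\<beta> \<subseteq> k' ` D" using homeomorphism_image_image[OF hom b(2)] by simp
    moreover have "connected (k' ` D)" using D by (intro connected_continuous_image continuous_on_subset[OF ck(2)]) auto
    moreover have "k' ` D \<subseteq> k' ` T" using D by (intro image_mono) simp
    then have "k' ` D \<subseteq> S" using ck(4) by simp
    moreover have "k' ` D \<noteq> {}" using D by simp
    ultimately have "k' ` D = \<beta>" using b(4)[of "k' ` D"] by simp
    then have "k ` k' ` D = k ` \<beta>" by simp
    then show "D = k ` \<beta>" using homeomorphism_image_image[OF homeomorphism_symD[OF hom]] D by simp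
  qed
qed

lemma homeomorphism_isotopic_iff:
  fixes S :: "'a::topological_space set" and T :: "'b::topological_space set"
  assumes hom: "homeomorphism S T k k'" and sub: "\<gamma> \<subseteq> S" "\<delta> \<subseteq> S"
  shows "isotopic T (k ` \<gamma>) (k ` \<delta>) \<longleftrightarrow> isotopic S \<gamma> \<delta>"
proof
  assume "isotopic S \<gamma> \<delta>"
  then show "isotopic T (k ` \<gamma>) (k ` \<delta>)"
    by (rule isotopic_image) (use hom in \<open>auto simp: homeomorphism_def intro: inj_on_inverseI\<close>)
next
  assume "isotopic T (k ` \<gamma>) (k ` \<delta>)"
  then have "isotopic S (k' ` k ` \<gamma>) (k' ` k ` \<delta>)"
    by (rule isotopic_image) (use hom in \<open>auto simp: homeomorphism_def intro: inj_on_inverseI\<close>)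
  moreover have "k' ` k ` \<gamma> = \<gamma>" "k' ` k ` \<delta> = \<delta>"
    using homeomorphism_image_image[OF hom] sub by simp_all
  ultimately show "isotopic S \<gamma> \<delta>" by simp
qed

lemma homeomorphism_essential:
  fixes S :: "'a::t2_space set" and T :: "'b::t2_space set"
  assumes hom: "homeomorphism S T k k'" and ess: "essential S \<gamma>"
  shows "essential T (k ` \<gamma>)"
proof -
  have ck: "continuous_on S k" "continuous_on T k'" "k ` S = T" "k' ` T = S"
    "\<And>x. x \<in> S \<Longrightarrow> k' (k x) = x" "\<And>y. y \<in> T \<Longrightarrow> k (k' y) = y"
    using hom by (auto simp: homeomorphism_def)
  have inj: "inj_on k S" using ck(5) by (rule inj_on_inverseI)
  have sub: "\<gamma> \<subseteq> S" using ess by (simp add: essential_def simple_closed_curve_def)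
  have k'k: "k' ` k ` \<gamma> = \<gamma>" by (rule homeomorphism_image_image[OF hom sub])
  have "simple_closed_curve T (k ` \<gamma>)"
  proof -
    obtain f where f: "circle_embedding f" "f ` unit_circle = \<gamma>"
      using ess by (auto simp: essential_def simple_closed_curve_iff)
    have "circle_embedding (k \<circ> f)"
    proof -
      have "continuous_on unit_circle (k \<circ> f)"
        using f sub ck(1) by (intro continuous_on_compose) (auto simp: circle_embedding_def intro: continuous_on_subset)
      moreover have "inj_on (k \<circ> f) unit_circle"
        using f sub inj by (intro comp_inj_on) (auto simp: circle_embedding_def intro: inj_on_subset)
      ultimately show ?thesis by (simp add: circle_embedding_def del: comp_apply)
    qed
    moreover have "(k \<circ> f) ` unit_circle = k ` \<gamma>" using f(2) by (metis image_comp)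
    ultimately show ?thesis using sub ck(3) unfolding simple_closed_curve_iff by blast
  qed
  moreover have "\<not> peripheral T (k ` \<gamma>)"
  proof
    assume "peripheral T (k ` \<gamma>)"
    then obtain \<beta> where \<beta>: "\<beta> \<in> components (surface_boundary T)" "isotopic T (k ` \<gamma>) \<beta>"
      by (auto simp: peripheral_def)
    have sT: "surface_boundary T \<subseteq> T" "surface_boundary S \<subseteq> S" by (auto simp: surface_boundary_def)
    have homb: "homeomorphism (surface_boundary T) (surface_boundary S) k' k"
      by (rule homeomorphism_of_subsets[OF homeomorphism_symD[OF hom] sT(1)])
         (use sT homeomorphism_surface_boundary_eq[OF homeomorphism_symD[OF hom]] in auto)
    have "k' ` \<beta> \<in> components (surface_boundary S)"
      by (rule homeomorphism_components_image[OF homb \<beta>(1)])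
    moreover have "isotopic S (k' ` k ` \<gamma>) (k' ` \<beta>)"
      by (rule isotopic_image[OF \<beta>(2) ck(2)]) (use ck in \<open>auto intro: inj_on_inverseI\<close>)
    ultimately show False using ess k'k by (auto simp: essential_def peripheral_def)
  qed
  moreover have "\<not> bounds_disk T (k ` \<gamma>)"
  proof
    assume "bounds_disk T (k ` \<gamma>)"
    then obtain D h h' where D: "D \<subseteq> T" "homeomorphism (cball (0::complex) 1) D h h'" "h ` unit_circle = k ` \<gamma>"
      by (auto simp: bounds_disk_def)
    have "homeomorphism D (k' ` D) k' k"
      by (rule homeomorphism_of_subsets[OF homeomorphism_symD[OF hom] D(1)]) (use D ck in auto)
    then have "homeomorphism (cball 0 1) (k' ` D) (k' \<circ> h) (h' \<circ> k)"
      using D(2) homeomorphism_compose by blast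
    moreover have "(k' \<circ> h) ` unit_circle = \<gamma>" using D(3) k'k by (metis image_comp)
    moreover have "k' ` D \<subseteq> S" using D(1) ck(4) by blast
    ultimately show False using ess unfolding essential_def bounds_disk_def by blast
  qed
  ultimately show ?thesis by (simp add: essential_def)
qed

definition graph_hom :: "'u sgraph \<Rightarrow> 'v sgraph \<Rightarrow> ('u \<Rightarrow> 'v) \<Rightarrow> bool" where
  "graph_hom G H h \<longleftrightarrow> h ` fst G \<subseteq> fst H \<and> (\<forall>u v. {u, v} \<in> snd G \<longrightarrow> {h u, h v} \<in> snd H)"

lemma proper_coloring_comp:
  "graph_hom G H h \<Longrightarrow> proper_coloring H k f \<Longrightarrow> proper_coloring G k (f \<circ> h)"
  by (auto simp: graph_hom_def proper_coloring_def image_subset_iff)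

lemma fold_coloring_comp:
  "graph_hom G H h \<Longrightarrow> fold_coloring H a b f \<Longrightarrow> fold_coloring G a b (f \<circ> h)"
  unfolding graph_hom_def fold_coloring_def by (auto simp: image_subset_iff)

lemma fold_coloring_of_proper_coloring:
  "proper_coloring G k f \<Longrightarrow> fold_coloring G k 1 (\<lambda>v. {f v})"
  by (auto simp: proper_coloring_def fold_coloring_def)

lemma curve_classes_isotopic:
  fixes S :: "'a::t2_space set"
  assumes "u \<in> curve_classes S" "\<gamma> \<in> u"
  shows "essential S \<gamma>" "\<delta> \<in> u \<longleftrightarrow> essential S \<delta> \<and> isotopic S \<gamma> \<delta>"
proof -
  have q: "u \<in> {\<gamma>. essential S \<gamma>} // isotopy_rel S" using assms(1) by (simp add: curve_classes_def)
  show ess: "essential S \<gamma>"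
    using in_quotient_imp_subset[OF equiv_isotopy_rel q] assms(2) by auto
  have "\<delta> \<in> u \<longleftrightarrow> (\<gamma>, \<delta>) \<in> isotopy_rel S"
  proof
    assume "\<delta> \<in> u"
    then show "(\<gamma>, \<delta>) \<in> isotopy_rel S"
      using in_quotient_imp_in_rel[OF equiv_isotopy_rel q] assms(2) by simp
  qed (rule in_quotient_imp_closed[OF equiv_isotopy_rel q assms(2)])
  then show "\<delta> \<in> u \<longleftrightarrow> essential S \<delta> \<and> isotopic S \<gamma> \<delta>"
    using ess by (simp add: isotopy_rel_def)
qed

lemma curve_class_ex:
  fixes S :: "'a::t2_space set"
  assumes "u \<in> curve_classes S"
  shows "\<exists>\<gamma>. \<gamma> \<in> u"
  using in_quotient_imp_non_empty[OF equiv_isotopy_rel] assms unfolding curve_classes_def by blast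

lemma curve_class_of_essential:
  fixes S :: "'a::t2_space set"
  assumes "essential S \<gamma>"
  shows "isotopy_rel S `` {\<gamma>} \<in> curve_classes S" "\<gamma> \<in> isotopy_rel S `` {\<gamma>}"
  using assms equiv_class_self[OF equiv_isotopy_rel, of \<gamma> S] by (auto simp: curve_classes_def quotientI)

lemma curve_graph_edgeD:
  assumes "{u, v} \<in> snd (curve_graph S)"
  obtains \<gamma> \<delta> where "u \<in> curve_classes S" "v \<in> curve_classes S" "u \<noteq> v" "\<gamma> \<in> u" "\<delta> \<in> v" "\<gamma> \<inter> \<delta> = {}"
  using assms unfolding curve_graph_def by (auto simp: doubleton_eq_iff)

lemma curve_graph_edgeI:
  assumes "u \<in> curve_classes S" "v \<in> curve_classes S" "u \<noteq> v" "\<gamma> \<in> u" "\<delta> \<in> v" "\<gamma> \<inter> \<delta> = {}"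
  shows "{u, v} \<in> snd (curve_graph S)"
  unfolding curve_graph_def snd_conv
  by (intro CollectI exI[of _ u] exI[of _ v] conjI bexI[of _ \<gamma>] bexI[of _ \<delta>] refl assms)

text \<open>
  All notions that enter the curve graph are topological; the boundary is so by its definition through
  disc neighbourhoods. Homomorphisms in both directions suffice to compare the chromatic numbers.
\<close>

lemma homeomorphic_curve_graph_hom:
  fixes S :: "'a::t2_space set" and T :: "'b::t2_space set"
  assumes "S homeomorphic T"
  shows "\<exists>h. graph_hom (curve_graph S) (curve_graph T) h"
proof -
  obtain k k' where hom: "homeomorphism S T k k'" using assms by (auto simp: homeomorphic_def)
  have ck: "k ` S = T" "\<And>x. x \<in> S \<Longrightarrow> k' (k x) = x" using hom by (auto simp: homeomorphism_def)
  have inj: "inj_on k S" using ck(2) by (rule inj_on_inverseI)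
  have esub: "\<gamma> \<subseteq> S" if "essential S \<gamma>" for \<gamma> using that by (simp add: essential_def simple_closed_curve_def)
  define r where "r = (\<lambda>u. SOME \<gamma>. \<gamma> \<in> (u :: 'a set set))"
  have r: "r u \<in> u" if "u \<in> curve_classes S" for u
    unfolding r_def using curve_class_ex[OF that] by (rule someI_ex)
  define h where "h = (\<lambda>u. isotopy_rel T `` {k ` r u})"
  have ess: "essential T (k ` r u)" "essential S (r u)" if "u \<in> curve_classes S" for u
    using homeomorphism_essential[OF hom] curve_classes_isotopic(1)[OF that r[OF that]] by auto
  have mem: "k ` \<gamma> \<in> h u" if u: "u \<in> curve_classes S" and g: "\<gamma> \<in> u" for u \<gamma>
  proof -
    have e: "essential S \<gamma>" and i: "isotopic S (r u) \<gamma>"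
      using curve_classes_isotopic[OF u r[OF u]] g by auto
    then have "isotopic T (k ` r u) (k ` \<gamma>)"
      using homeomorphism_isotopic_iff[OF hom] esub ess(2)[OF u] by blast
    then show ?thesis using ess(1)[OF u] homeomorphism_essential[OF hom e] by (simp add: h_def isotopy_rel_def)
  qed
  have hc: "h u \<in> curve_classes T" if "u \<in> curve_classes S" for u
    unfolding h_def using curve_class_of_essential(1) ess(1)[OF that] by blast
  have "{h u, h v} \<in> snd (curve_graph T)" if edge: "{u, v} \<in> snd (curve_graph S)" for u v
  proof -
    obtain \<gamma> \<delta> where e: "u \<in> curve_classes S" "v \<in> curve_classes S" "u \<noteq> v" "\<gamma> \<in> u" "\<delta> \<in> v" "\<gamma> \<inter> \<delta> = {}"
      using edge by (rule curve_graph_edgeD)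
    have sub: "\<gamma> \<subseteq> S" "\<delta> \<subseteq> S"
      using esub curve_classes_isotopic(1)[OF e(1,4)] curve_classes_isotopic(1)[OF e(2,5)] by auto
    have "h u \<noteq> h v"
    proof
      assume "h u = h v"
      then have "k ` \<delta> \<in> h u" using mem[OF e(2,5)] by simp
      then have "isotopic T (k ` \<gamma>) (k ` \<delta>)"
        using curve_classes_isotopic(2)[OF hc[OF e(1)] mem[OF e(1,4)]] by blast
      then have "isotopic S \<gamma> \<delta>" using homeomorphism_isotopic_iff[OF hom sub] by blast
      then have "\<delta> \<in> u"
        using curve_classes_isotopic(2)[OF e(1,4)] curve_classes_isotopic(1)[OF e(2,5)] by blast
      then have "u = v"
        using quotient_disj[OF equiv_isotopy_rel, of u S v] e by (auto simp: curve_classes_def)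
      then show False using e(3) by blast
    qed
    moreover have "k ` \<gamma> \<inter> k ` \<delta> = {}"
      using inj_on_image_Int[OF inj sub] e(6) by simp
    ultimately show ?thesis
      using curve_graph_edgeI[OF hc[OF e(1)] hc[OF e(2)] _ mem[OF e(1,4)] mem[OF e(2,5)]] by blast
  qed
  then show ?thesis using hc by (intro exI[of _ h]) (auto simp: graph_hom_def curve_graph_def)
qed

section \<open>A planar model and its colouring\<close>

definition diam_disc :: "real \<Rightarrow> real \<Rightarrow> complex set" where
  "diam_disc a b = ball (of_real ((a + b) / 2)) ((b - a) / 2)"

definition diam_cdisc :: "real \<Rightarrow> real \<Rightarrow> complex set" where
  "diam_cdisc a b = cball (of_real ((a + b) / 2)) ((b - a) / 2)"

definition diam_circle :: "real \<Rightarrow> real \<Rightarrow> complex set" where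
  "diam_circle a b = sphere (of_real ((a + b) / 2)) ((b - a) / 2)"

lemma dist_diameter_centre:
  "(dist (of_real ((a + b) / 2)) z)\<^sup>2 = ((b - a) / 2)\<^sup>2 + ((Re z - a) * (Re z - b) + (Im z)\<^sup>2)"
  by (simp add: dist_norm cmod_power2) (simp add: power2_eq_square field_simps)

lemma in_diam_disc_iff: "a < b \<Longrightarrow> z \<in> diam_disc a b \<longleftrightarrow> (Re z - a) * (Re z - b) + (Im z)\<^sup>2 < 0"
proof -
  assume "a < b"
  then have "z \<in> diam_disc a b \<longleftrightarrow> (dist (of_real ((a + b) / 2)) z)\<^sup>2 < ((b - a) / 2)\<^sup>2"
    unfolding diam_disc_def mem_ball by (intro iffI power_strict_mono) (auto dest: power2_less_imp_less)
  then show ?thesis unfolding dist_diameter_centre by simp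
qed

lemma in_diam_cdisc_iff: "a < b \<Longrightarrow> z \<in> diam_cdisc a b \<longleftrightarrow> (Re z - a) * (Re z - b) + (Im z)\<^sup>2 \<le> 0"
proof -
  assume "a < b"
  then have "z \<in> diam_cdisc a b \<longleftrightarrow> (dist (of_real ((a + b) / 2)) z)\<^sup>2 \<le> ((b - a) / 2)\<^sup>2"
    unfolding diam_cdisc_def mem_cball by (intro iffI power_mono) (auto dest: power2_le_imp_le)
  then show ?thesis unfolding dist_diameter_centre by simp
qed

lemma diam_circle_eq: "diam_circle a b = diam_cdisc a b - diam_disc a b"
  by (auto simp: diam_circle_def diam_cdisc_def diam_disc_def)

lemma diam_disc_subset_diam_cdisc: "diam_disc a b \<subseteq> diam_cdisc a b"
  by (auto simp: diam_cdisc_def diam_disc_def)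

text \<open>
  On the smaller disc the product \<open>(Re z - a) * (b - Re z)\<close> is larger than the corresponding product for the
  inner diameter.
\<close>

lemma diam_cdisc_nested:
  assumes "a < a'" "a' < b'" "b' < b"
  shows "diam_cdisc a' b' \<subseteq> diam_disc a b"
proof
  fix z assume "z \<in> diam_cdisc a' b'"
  then have q: "(Re z - a') * (Re z - b') + (Im z)\<^sup>2 \<le> 0" using in_diam_cdisc_iff assms by blast
  then have "(Re z - a') * (Re z - b') \<le> 0" by (smt (verit) zero_le_power2)
  then have r: "a' \<le> Re z" "Re z \<le> b'" using assms by (auto simp: mult_le_0_iff)
  have "(Re z - a') * (b' - Re z) \<le> (Re z - a) * (b' - Re z)" using r assms by (intro mult_right_mono) auto
  also have "\<dots> < (Re z - a) * (b - Re z)" using r assms by (intro mult_strict_left_mono) auto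
  finally have "(Re z - a) * (Re z - b) < (Re z - a') * (Re z - b')" by (simp add: algebra_simps)
  then show "z \<in> diam_disc a b" using q in_diam_disc_iff assms by (smt (verit))
qed

lemma diam_cdisc_disjoint:
  assumes "a < b" "b < a'" "a' < b'"
  shows "diam_cdisc a b \<inter> diam_cdisc a' b' = {}"
proof -
  have r: "a \<le> Re z \<and> Re z \<le> b" if "z \<in> diam_cdisc a b" "a < b" for z a b
  proof -
    have "(Re z - a) * (Re z - b) + (Im z)\<^sup>2 \<le> 0" using in_diam_cdisc_iff that by blast
    then have "(Re z - a) * (Re z - b) \<le> 0" by (smt (verit) zero_le_power2)
    then show ?thesis using that by (auto simp: mult_le_0_iff)
  qed
  show ?thesis
  proof (rule equals0I)
    fix z assume "z \<in> diam_cdisc a b \<inter> diam_cdisc a' b'"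
    then show False using r[of z a b] r[of z a' b'] assms by auto
  qed
qed

lemma diam_circle_embedding:
  assumes "a < b"
  shows "circle_embedding (\<lambda>x. of_real ((a + b) / 2) + of_real ((b - a) / 2) * x)"
    "(\<lambda>x. of_real ((a + b) / 2) + of_real ((b - a) / 2) * x) ` unit_circle = diam_circle a b"
proof -
  have r: "(b - a) / 2 > 0" using assms by simp
  show "circle_embedding (\<lambda>x. of_real ((a + b) / 2) + of_real ((b - a) / 2) * x :: complex)"
    using r unfolding circle_embedding_def by (auto intro!: continuous_intros inj_onI)
  have "(\<lambda>x. of_real ((a + b) / 2) + of_real ((b - a) / 2) * x) ` unit_circle
      = (\<lambda>x. of_real ((a + b) / 2) + x) ` (\<lambda>x. of_real ((b - a) / 2) * x) ` unit_circle"
    by (simp only: image_image)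
  also have "\<dots> = (\<lambda>x. of_real ((a + b) / 2) + x) ` sphere 0 ((b - a) / 2)"
    by (simp only: image_mult_unit_circle[OF r])
  also have "\<dots> = diam_circle a b" unfolding diam_circle_def by (simp only: sphere_translation[symmetric] add_0_right)
  finally show "(\<lambda>x. of_real ((a + b) / 2) + of_real ((b - a) / 2) * x) ` unit_circle = diam_circle a b" .
qed

lemma inside_diam_circle: "a < b \<Longrightarrow> inside (diam_circle a b) = diam_disc a b"
  using inside_frontier_eq_interior[of "diam_cdisc a b"]
  by (simp add: diam_circle_def diam_cdisc_def diam_disc_def)

text \<open>
  For \<open>1 \<le> k < n\<close> the hole \<open>k\<close> has the diameter from \<open>l k\<close> to \<open>r k\<close>. The remaining hole is the exterior of
  the outer circle. It is treated as hole \<open>0\<close> at its right end \<open>r 0\<close> and as hole \<open>n\<close> at its left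
  end \<open>l n\<close>, so that every gap between neighbours has the form from \<open>r k\<close> to \<open>l (Suc k)\<close>.
\<close>

locale beaded_disc =
  fixes n :: nat and l r :: "nat \<Rightarrow> real"
  assumes n5: "5 \<le> n"
    and hole_ord: "\<And>k. k \<in> {1..<n} \<Longrightarrow> l k < r k"
    and gap_ord: "\<And>k. k < n \<Longrightarrow> r k < l (Suc k)"
begin

definition hole :: "nat \<Rightarrow> complex set" where "hole k = diam_disc (l k) (r k)"

definition centre :: "nat \<Rightarrow> complex" where "centre k = of_real ((l k + r k) / 2)"

definition surface :: "complex set" where
  "surface = diam_cdisc (r 0) (l n) - (\<Union>k\<in>{1..<n}. hole k)"

lemma r_less_l: "i < j \<Longrightarrow> j \<le> n \<Longrightarrow> r i < l j"
proof (induction j)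
  case (Suc j)
  show ?case
  proof (cases "i = j")
    case True then show ?thesis using gap_ord Suc.prems by simp
  next
    case False
    then have "r i < l j" using Suc by simp
    also have "l j < r j" using False Suc.prems by (intro hole_ord) auto
    also have "r j < l (Suc j)" using Suc.prems by (intro gap_ord) auto
    finally show ?thesis .
  qed
qed simp

lemma l_le_l: "1 \<le> i \<Longrightarrow> i \<le> j \<Longrightarrow> j \<le> n \<Longrightarrow> l i \<le> l j"
  using r_less_l[of i j] hole_ord[of i] by (cases "i = j") force+

lemma r_le_r: "i \<le> j \<Longrightarrow> j < n \<Longrightarrow> r i \<le> r j"
  using r_less_l[of i j] hole_ord[of j] by (cases "i = j") force+

lemma outer_ord: "r 0 < l n" using r_less_l[of 0 n] n5 by simp

lemma hole_subset_outer: "k \<in> {1..<n} \<Longrightarrow> diam_cdisc (l k) (r k) \<subseteq> diam_disc (r 0) (l n)"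
  using r_less_l[of 0 k] r_less_l[of k n] hole_ord[of k] by (intro diam_cdisc_nested) auto

lemma centre_in_hole: "k \<in> {1..<n} \<Longrightarrow> centre k \<in> hole k"
  using hole_ord[of k] by (simp add: centre_def hole_def diam_disc_def)

lemma cdisc_holes_disjoint: "j \<in> {1..<n} \<Longrightarrow> k \<in> {1..<n} \<Longrightarrow> j \<noteq> k \<Longrightarrow> diam_cdisc (l j) (r j) \<inter> diam_cdisc (l k) (r k) = {}"
  using diam_cdisc_disjoint[of "l j" "r j" "l k" "r k"] diam_cdisc_disjoint[of "l k" "r k" "l j" "r j"]
    r_less_l[of j k] r_less_l[of k j] hole_ord[of j] hole_ord[of k]
  by (cases "j < k") force+

lemma hole_not_surface: "k \<in> {1..<n} \<Longrightarrow> hole k \<inter> surface = {}" by (auto simp: surface_def)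

lemma centre_notin_surface: "k \<in> {1..<n} \<Longrightarrow> centre k \<notin> surface" using centre_in_hole hole_not_surface by blast

lemma connected_hole: "connected (hole k)" by (simp add: hole_def diam_disc_def)

definition holes_inside :: "complex set \<Rightarrow> nat set" where
  "holes_inside \<gamma> = {k \<in> {1..<n}. centre k \<in> inside \<gamma>}"

lemma isotopic_holes_inside: "isotopic surface \<gamma> \<delta> \<Longrightarrow> holes_inside \<gamma> = holes_inside \<delta>"
  using isotopic_inside_iff centre_notin_surface unfolding holes_inside_def by blast

lemma not_in_surface_cases:
  assumes "x \<notin> surface"
  obtains "x \<in> - diam_cdisc (r 0) (l n)" | k where "k \<in> {1..<n}" "x \<in> hole k"
  using assms by (auto simp: surface_def)

lemma exterior_subset_outside: "\<gamma> \<subseteq> surface \<Longrightarrow> - diam_cdisc (r 0) (l n) \<subseteq> outside \<gamma>"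
  by (rule outside_subset_convex) (auto simp: surface_def diam_cdisc_def)

lemma hole_inside:
  assumes "\<gamma> \<subseteq> surface" "k \<in> {1..<n}" "x \<in> hole k" "x \<in> inside \<gamma>"
  shows "k \<in> holes_inside \<gamma>" "hole k \<subseteq> inside \<gamma>"
proof -
  have "hole k \<inter> \<gamma> = {}" using assms(1) hole_not_surface[OF assms(2)] by blast
  then show "hole k \<subseteq> inside \<gamma>" using connected_subset_inside[OF connected_hole _ assms(3,4)] by blast
  then show "k \<in> holes_inside \<gamma>" using centre_in_hole assms(2) by (auto simp: holes_inside_def)
qed

lemma holes_inside_subset_hole:
  assumes "\<gamma> \<subseteq> surface" "k \<in> holes_inside \<gamma>"
  shows "hole k \<subseteq> inside \<gamma>"
  using hole_inside(2)[OF assms(1), of k "centre k"] assms(2) centre_in_hole by (auto simp: holes_inside_def)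

text \<open>
  A hole that meets the region would be enclosed by \<open>\<delta>\<close> and not by \<open>\<gamma>\<close>; the exterior of the model is
  outside of every curve.
\<close>

lemma region_subset_surface:
  assumes "\<delta> \<subseteq> surface" "\<gamma> \<subseteq> surface" "holes_inside \<delta> = holes_inside \<gamma>"
  shows "(inside \<delta> \<union> \<delta>) - inside \<gamma> \<subseteq> surface"
proof
  fix x assume x: "x \<in> (inside \<delta> \<union> \<delta>) - inside \<gamma>"
  show "x \<in> surface"
  proof (rule ccontr)
    assume n: "x \<notin> surface"
    then have xin: "x \<in> inside \<delta>" using x assms(1) by blast
    from n show False
    proof (cases rule: not_in_surface_cases)
      case 1
      then show False using exterior_subset_outside[OF assms(1)] xin inside_Int_outside[of \<delta>] by blast
    next
      case (2 k)
      then have "k \<in> holes_inside \<gamma>" using hole_inside(1)[OF assms(1) 2 xin] assms(3) by simp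
      then show False using holes_inside_subset_hole[OF assms(2)] 2(2) x by blast
    qed
  qed
qed

text \<open>
  If no hole is enclosed, the inside belongs to the surface, and the extended Riemann map shows
  that the curve bounds a disc.
\<close>

lemma essential_holes_inside_nonempty:
  assumes "essential surface \<gamma>"
  shows "holes_inside \<gamma> \<noteq> {}"
proof
  assume e: "holes_inside \<gamma> = {}"
  obtain f where f: "circle_embedding f" "\<gamma> = f ` unit_circle" and sub: "\<gamma> \<subseteq> surface"
    using assms by (auto simp: essential_def simple_closed_curve_iff)
  note J = Jordan_circle_embedding[OF f]
  have ins: "inside \<gamma> \<subseteq> surface"
  proof
    fix x assume x: "x \<in> inside \<gamma>"
    show "x \<in> surface"
    proof (rule ccontr)
      assume "x \<notin> surface"
      then show False
      proof (cases rule: not_in_surface_cases)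
        case 1 then show False using exterior_subset_outside[OF sub] x inside_Int_outside[of \<gamma>] by blast
      next
        case (2 k) then show False using hole_inside(1)[OF sub 2 x] e by blast
      qed
    qed
  qed
  obtain q where "q \<in> inside \<gamma>" using J(1) by blast
  then obtain \<Phi> where \<Phi>: "continuous_on (cball 0 1) \<Phi>" "inj_on \<Phi> (cball 0 1)" 
    "\<Phi> ` ball 0 1 = inside \<gamma>" "\<Phi> ` unit_circle = \<gamma>"
    using Jordan_Riemann_map[OF f] by metis
  have "cball (0::complex) 1 = ball 0 1 \<union> unit_circle" by auto
  then have im: "\<Phi> ` cball 0 1 \<subseteq> surface" using \<Phi>(3,4) ins sub by (simp only: image_Un) blast
  obtain \<Psi> where "homeomorphism (cball 0 1) (\<Phi> ` cball 0 1) \<Phi> \<Psi>"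
    using homeomorphism_compact[OF compact_cball \<Phi>(1) refl \<Phi>(2)] by blast
  then have "bounds_disk surface \<gamma>" using im \<Phi>(4) unfolding bounds_disk_def by blast
  then show False using assms by (simp add: essential_def)
qed

text \<open>
  If the insides were disjoint, equal sets of holes would be empty; so curves with equal sets are nested and bound
  a region of the surface, through which one can be moved to the other.
\<close>

lemma disjoint_essential_curves:
  assumes "essential surface \<gamma>" "essential surface \<delta>" "\<gamma> \<inter> \<delta> = {}" "\<not> isotopic surface \<gamma> \<delta>"
  shows "holes_inside \<gamma> \<noteq> holes_inside \<delta>"
    "holes_inside \<gamma> \<subseteq> holes_inside \<delta> \<or> holes_inside \<delta> \<subseteq> holes_inside \<gamma> \<or> holes_inside \<gamma> \<inter> holes_inside \<delta> = {}"
proof -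
  obtain f where f: "circle_embedding f" "\<gamma> = f ` unit_circle" and sf: "\<gamma> \<subseteq> surface"
    using assms(1) by (auto simp: essential_def simple_closed_curve_iff)
  obtain g where g: "circle_embedding g" "\<delta> = g ` unit_circle" and sg: "\<delta> \<subseteq> surface"
    using assms(2) by (auto simp: essential_def simple_closed_curve_iff)
  show "holes_inside \<gamma> \<subseteq> holes_inside \<delta> \<or> holes_inside \<delta> \<subseteq> holes_inside \<gamma> \<or> holes_inside \<gamma> \<inter> holes_inside \<delta> = {}"
    by (rule disjoint_Jordan_curves_cases[OF f g assms(3)]) (auto simp: holes_inside_def)
  show "holes_inside \<gamma> \<noteq> holes_inside \<delta>"
  proof
    assume eq: "holes_inside \<gamma> = holes_inside \<delta>"
    have "isotopic surface \<gamma> \<delta>"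
    proof (rule disjoint_Jordan_curves_cases[OF f g assms(3)])
      assume "\<gamma> \<union> inside \<gamma> \<subseteq> inside \<delta>"
      then show ?thesis
        using isotopic_nested_Jordan_curves[OF f g] isotopic_subset region_subset_surface[OF sg sf eq[symmetric]] by blast
    next
      assume "\<delta> \<union> inside \<delta> \<subseteq> inside \<gamma>"
      then have "isotopic surface \<delta> \<gamma>"
        using isotopic_nested_Jordan_curves[OF g f] isotopic_subset region_subset_surface[OF sf sg eq] by blast
      then show ?thesis by (rule isotopic_sym)
    next
      assume "inside \<gamma> \<inter> inside \<delta> = {}"
      then have "holes_inside \<gamma> = {}" using eq by (auto simp: holes_inside_def)
      then show ?thesis using essential_holes_inside_nonempty[OF assms(1)] by blast
    qed
    then show False using assms(4) by blast
  qed
qed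

theorem proper_coloring_exists:
  "\<exists>f. proper_coloring (curve_graph surface) (n * (nat \<lfloor>log 2 (real n)\<rfloor> + 1)) f"
proof -
  let ?N = "n * (nat \<lfloor>log 2 (real n)\<rfloor> + 1)"
  have "n \<ge> 1" using n5 by simp
  then obtain c :: "nat set \<Rightarrow> nat" where
    c1: "\<And>A. A \<subseteq> {..<n} \<Longrightarrow> A \<noteq> {} \<Longrightarrow> c A < ?N" and
    c2: "\<And>A B. A \<subseteq> {..<n} \<Longrightarrow> B \<subseteq> {..<n} \<Longrightarrow> A \<noteq> {} \<Longrightarrow> B \<noteq> {} \<Longrightarrow> A \<noteq> B \<Longrightarrow>
       A \<subseteq> B \<or> B \<subseteq> A \<or> A \<inter> B = {} \<Longrightarrow> c A \<noteq> c B"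
    using colouring_of_nested_or_disjoint_sets by metis
  define f where "f = (\<lambda>u. c (holes_inside (SOME \<gamma>. \<gamma> \<in> (u :: complex set set))))"
  have hs: "holes_inside \<gamma> \<subseteq> {..<n}" for \<gamma> by (auto simp: holes_inside_def)
  have f: "f u = c (holes_inside \<gamma>)" if u: "u \<in> curve_classes surface" "\<gamma> \<in> u" for u \<gamma>
  proof -
    have "(SOME \<gamma>. \<gamma> \<in> u) \<in> u" using u(2) by (rule someI)
    then have "isotopic surface \<gamma> (SOME \<gamma>. \<gamma> \<in> u)" using curve_classes_isotopic(2)[OF u] by blast
    then show ?thesis using isotopic_holes_inside by (simp add: f_def)
  qed
  have "f u < ?N" if u: "u \<in> curve_classes surface" for u
  proof -
    obtain \<gamma> where g: "\<gamma> \<in> u" using curve_class_ex[OF u] by blast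
    have "holes_inside \<gamma> \<noteq> {}" using essential_holes_inside_nonempty curve_classes_isotopic(1)[OF u g] by blast
    then show ?thesis using c1[OF hs] f[OF u g] by simp
  qed
  moreover have "f u \<noteq> f v" if edge: "{u, v} \<in> snd (curve_graph surface)" for u v
  proof -
    obtain \<gamma> \<delta> where e: "u \<in> curve_classes surface" "v \<in> curve_classes surface" "u \<noteq> v" "\<gamma> \<in> u" "\<delta> \<in> v" "\<gamma> \<inter> \<delta> = {}"
      using edge by (rule curve_graph_edgeD)
    have ess: "essential surface \<gamma>" "essential surface \<delta>"
      using curve_classes_isotopic(1)[OF e(1,4)] curve_classes_isotopic(1)[OF e(2,5)] by auto
    have "\<not> isotopic surface \<gamma> \<delta>"
    proof
      assume "isotopic surface \<gamma> \<delta>"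
      then have "\<delta> \<in> u" using curve_classes_isotopic(2)[OF e(1,4)] ess by blast
      then show False
        using quotient_disj[OF equiv_isotopy_rel, of u surface v] e by (auto simp: curve_classes_def)
    qed
    then have "c (holes_inside \<gamma>) \<noteq> c (holes_inside \<delta>)"
      using disjoint_essential_curves[OF ess e(6)] essential_holes_inside_nonempty ess
      by (intro c2 hs) auto
    then show ?thesis using f e by simp
  qed
  ultimately show ?thesis
    by (intro exI[of _ f]) (auto simp: proper_coloring_def curve_graph_def)
qed

end

section \<open>Many crossing curves in the planar model\<close>

context beaded_disc begin

text \<open>
  The image of the open disc is open, and its union with the curve is compact. So it
  contains each side of the curve that it meets; being bounded, it meets the inside only. Hence the inside is part of
  the surface.
\<close>

lemma bounds_disk_holes_inside:
  assumes "bounds_disk surface \<gamma>"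
  shows "holes_inside \<gamma> = {}"
proof -
  obtain D h k where D: "D \<subseteq> surface" "homeomorphism (cball (0::complex) 1) D h k" "h ` unit_circle = \<gamma>"
    using assms by (auto simp: bounds_disk_def)
  have h: "continuous_on (cball 0 1) h" "h ` cball 0 1 = D" "inj_on h (cball 0 1)"
    using D(2) by (auto simp: homeomorphism_def intro: inj_on_inverseI)
  have emb: "circle_embedding h"
    unfolding circle_embedding_def
    by (intro conjI continuous_on_subset[OF h(1)] inj_on_subset[OF h(3)]) auto
  note J = Jordan_circle_embedding[OF emb D(3)[symmetric]]
  define W where "W = h ` ball 0 1"
  have "open W" unfolding W_def
    by (intro invariance_of_domain continuous_on_subset[OF h(1)] inj_on_subset[OF h(3)]) auto
  have "cball (0::complex) 1 = ball 0 1 \<union> unit_circle" by auto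
  then have D_eq: "D = W \<union> \<gamma>" using h(2) D(3) by (metis W_def image_Un)
  have "compact D" using compact_continuous_image[OF h(1)] h(2) by simp
  then have clo: "closed (W \<union> \<gamma>)" using D_eq compact_imp_closed by blast
  have conW: "connected W" unfolding W_def
    by (intro connected_continuous_image continuous_on_subset[OF h(1)]) auto
  have disj: "W \<inter> \<gamma> = {}"
  proof -
    have "h ` ball 0 1 \<inter> h ` unit_circle = h ` (ball 0 1 \<inter> unit_circle)"
      by (rule inj_on_image_Int[OF h(3), symmetric]) auto
    moreover have "ball 0 1 \<inter> unit_circle = {}" by auto
    ultimately show ?thesis by (simp add: W_def D(3))
  qed
  have "W \<noteq> {}" by (simp add: W_def)
  have nout: "W \<inter> outside \<gamma> = {}"
  proof (rule ccontr)
    assume "W \<inter> outside \<gamma> \<noteq> {}"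
    then have "outside \<gamma> \<subseteq> W"
      using clopen_contains_connected[OF \<open>open W\<close> clo J(7)] outside_no_overlap[of \<gamma>] by blast
    moreover have "bounded W" using \<open>compact D\<close> D_eq by (metis Un_upper1 bounded_subset compact_imp_bounded)
    ultimately show False using J(8) bounded_subset by blast
  qed
  then have "W \<inter> inside \<gamma> \<noteq> {}" using \<open>W \<noteq> {}\<close> disj inside_Un_outside[of \<gamma>] by blast
  then have "inside \<gamma> \<inter> W \<noteq> {}" by blast
  then have "inside \<gamma> \<subseteq> W"
    using clopen_contains_connected[OF \<open>open W\<close> clo J(3) inside_no_overlap] by blast
  then have "inside \<gamma> \<subseteq> surface" using D(1) D_eq by blast
  then show ?thesis using centre_notin_surface unfolding holes_inside_def by blast
qed

text \<open>
  A point off these circles has a round neighbourhood in the surface.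
\<close>

lemma surface_boundary_subset:
  "surface_boundary surface \<subseteq> diam_circle (r 0) (l n) \<union> (\<Union>k\<in>{1..<n}. diam_circle (l k) (r k))"
proof (rule ccontr)
  assume "\<not> ?thesis"
  then obtain x where x: "x \<in> surface_boundary surface" "x \<notin> diam_circle (r 0) (l n)" "\<And>k. k \<in> {1..<n} \<Longrightarrow> x \<notin> diam_circle (l k) (r k)"
    by blast
  then have xP: "x \<in> surface" by (simp add: surface_boundary_def)
  define Q where "Q = diam_disc (r 0) (l n) - (\<Union>k\<in>{1..<n}. diam_cdisc (l k) (r k))"
  have "closed (\<Union>k\<in>{1..<n}. diam_cdisc (l k) (r k))" by (intro closed_UN) (auto simp: diam_cdisc_def)
  then have "open Q" unfolding Q_def by (intro open_Diff) (auto simp: diam_disc_def)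
  moreover have "x \<in> Q" using x(2,3) xP unfolding Q_def surface_def diam_circle_eq hole_def by blast
  ultimately obtain e where e: "e > 0" "ball x e \<subseteq> Q" using openE by blast
  have "Q \<subseteq> surface" using diam_disc_subset_diam_cdisc unfolding Q_def surface_def hole_def by blast
  then have "openin (top_of_set surface) (ball x e)" using e by (intro open_subset) auto
  moreover have "ball x e homeomorphic ball (0::complex) 1" using e(1) by (intro homeomorphic_balls(1)) auto
  ultimately show False using x(1) e(1) by (auto simp: surface_boundary_def)
qed

text \<open>
  A boundary component is connected, so it is contained in one of the finitely many circles. Inside a subset of the
  circle around a hole there is at most this hole. The open disc bounded by the outer circle does not meet a subset of
  that circle and contains all holes, so either all of them are enclosed or none.
\<close>

lemma peripheral_holes_inside:
  assumes "peripheral surface \<gamma>"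
  shows "card (holes_inside \<gamma>) \<le> 1 \<or> holes_inside \<gamma> = {1..<n}"
proof -
  obtain \<beta> where \<beta>: "\<beta> \<in> components (surface_boundary surface)" "isotopic surface \<gamma> \<beta>"
    using assms by (auto simp: peripheral_def)
  have eq: "holes_inside \<gamma> = holes_inside \<beta>" using isotopic_holes_inside[OF \<beta>(2)] .
  have con: "connected \<beta>" "\<beta> \<noteq> {}" and sub: "\<beta> \<subseteq> surface_boundary surface"
    using \<beta>(1)[unfolded in_components_maximal] by simp_all
  have \<beta>P: "\<beta> \<subseteq> surface" using sub by (auto simp: surface_boundary_def)
  define R where "R = (\<lambda>A. \<Union>k\<in>A. diam_circle (l k) (r k))"
  have cR: "closed (R A)" if "finite A" for A
    unfolding R_def using that by (intro closed_UN) (auto simp: diam_circle_def)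
  have co: "closed (diam_circle a b)" for a b by (auto simp: diam_circle_def)
  have cover: "\<beta> \<subseteq> diam_circle (r 0) (l n) \<union> R {1..<n}" using sub surface_boundary_subset by (simp add: R_def)
  have dis0: "diam_circle (r 0) (l n) \<inter> R {1..<n} = {}"
    using hole_subset_outer unfolding R_def diam_circle_eq by blast
  have "diam_circle (r 0) (l n) \<inter> \<beta> = {} \<or> R {1..<n} \<inter> \<beta> = {}"
    by (rule connected_closedD[OF con(1)]) (use cover dis0 cR co in auto)
  then show ?thesis
  proof
    assume a: "R {1..<n} \<inter> \<beta> = {}"
    then have b: "\<beta> \<subseteq> diam_circle (r 0) (l n)" using cover by blast
    have cond: "connected (diam_disc (r 0) (l n))" by (simp add: diam_disc_def)
    have disd: "diam_disc (r 0) (l n) \<inter> \<beta> = {}" using b by (auto simp: diam_circle_eq)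
    have cin: "centre k \<in> diam_disc (r 0) (l n)" if "k \<in> {1..<n}" for k
      using hole_subset_outer[OF that] centre_in_hole[OF that] diam_disc_subset_diam_cdisc unfolding hole_def by blast
    show ?thesis
    proof (cases "holes_inside \<beta> = {}")
      case True then show ?thesis by (simp add: eq)
    next
      case False
      then obtain k where k: "k \<in> {1..<n}" "centre k \<in> inside \<beta>" by (auto simp: holes_inside_def)
      then have "diam_disc (r 0) (l n) \<subseteq> inside \<beta>" using connected_subset_inside[OF cond disd cin] by blast
      then have "holes_inside \<beta> = {1..<n}" using cin by (auto simp: holes_inside_def)
      then show ?thesis by (simp add: eq)
    qed
  next
    assume a: "diam_circle (r 0) (l n) \<inter> \<beta> = {}"
    obtain x where "x \<in> \<beta>" using con(2) by blast
    then obtain k where k: "k \<in> {1..<n}" "x \<in> diam_circle (l k) (r k)" using cover a by (auto simp: R_def)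
    have "diam_circle (l k) (r k) \<inter> \<beta> = {} \<or> R ({1..<n} - {k}) \<inter> \<beta> = {}"
    proof (rule connected_closedD[OF con(1)])
      have "diam_circle (l k) (r k) \<inter> diam_circle (l j) (r j) = {}" if "j \<in> {1..<n} - {k}" for j
        using cdisc_holes_disjoint[of k j] k(1) that unfolding diam_circle_eq by blast
      then show "diam_circle (l k) (r k) \<inter> R ({1..<n} - {k}) \<inter> \<beta> = {}" unfolding R_def by blast
      show "\<beta> \<subseteq> diam_circle (l k) (r k) \<union> R ({1..<n} - {k})" using cover a by (auto simp: R_def)
    qed (use cR co in auto)
    then have "R ({1..<n} - {k}) \<inter> \<beta> = {}" using \<open>x \<in> \<beta>\<close> k by blast
    then have "\<beta> \<subseteq> diam_cdisc (l k) (r k)" using cover a unfolding R_def diam_circle_eq by blast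
    then have ins: "inside \<beta> \<subseteq> diam_cdisc (l k) (r k)" by (rule inside_subset_convex) (simp add: diam_cdisc_def)
    have "holes_inside \<beta> \<subseteq> {k}"
    proof
      fix m assume m: "m \<in> holes_inside \<beta>"
      then have m1: "m \<in> {1..<n}" "centre m \<in> diam_cdisc (l k) (r k)" using ins by (auto simp: holes_inside_def)
      then have "centre m \<in> diam_cdisc (l m) (r m)" using centre_in_hole diam_disc_subset_diam_cdisc unfolding hole_def by blast
      then show "m \<in> {k}" using cdisc_holes_disjoint[OF m1(1) k(1)] m1(2) by blast
    qed
    then have "card (holes_inside \<beta>) \<le> card {k}" by (intro card_mono) auto
    then show ?thesis by (simp add: eq)
  qed
qed

text \<open>
  The circle around the holes of \<open>{i..<e}\<close> crosses the real axis in the gap before the hole \<open>i\<close> and in the gap before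
  the hole \<open>e\<close>. All circles with the same \<open>i\<close> share the first gap; there the left ends move
  outwards as \<open>e\<close> grows, and they stay in the right half of the gap. The right ends use the left half.
\<close>

definition left_end :: "nat \<Rightarrow> nat \<Rightarrow> real" where
  "left_end i e = l i - (l i - r (i - 1)) * (real e / (2 * real n))"

definition right_end :: "nat \<Rightarrow> nat \<Rightarrow> real" where
  "right_end i e = r (e - 1) + (l e - r (e - 1)) * (real (n - i) / (2 * real n))"

lemma left_end_bounds:
  assumes "1 \<le> i" "i < e" "e \<le> n"
  shows "(r (i - 1) + l i) / 2 \<le> left_end i e" "r (i - 1) < left_end i e" "left_end i e < l i"
proof -
  have g: "l i - r (i - 1) > 0" using gap_ord[of "i - 1"] assms by simp
  have c: "0 < real e / (2 * real n)" "real e / (2 * real n) \<le> 1 / 2" using assms by (auto simp: field_simps)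
  have "(l i - r (i - 1)) * (real e / (2 * real n)) \<le> (l i - r (i - 1)) * (1 / 2)"
    using g c by (intro mult_left_mono) auto
  then show 1: "(r (i - 1) + l i) / 2 \<le> left_end i e" by (simp add: left_end_def field_simps)
  then show "r (i - 1) < left_end i e" using g by simp
  show "left_end i e < l i" using mult_pos_pos[OF g c(1)] unfolding left_end_def by linarith
qed

lemma right_end_bounds:
  assumes "1 \<le> i" "i < e" "e \<le> n"
  shows "right_end i e < (r (e - 1) + l e) / 2" "right_end i e < l e" "r (e - 1) < right_end i e"
proof -
  have g: "l e - r (e - 1) > 0" using gap_ord[of "e - 1"] assms by simp
  have c: "0 < real (n - i) / (2 * real n)" "real (n - i) / (2 * real n) < 1 / 2" using assms by (auto simp: field_simps)
  have "(l e - r (e - 1)) * (real (n - i) / (2 * real n)) < (l e - r (e - 1)) * (1 / 2)"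
    using g c by (intro mult_strict_left_mono) auto
  then show 1: "right_end i e < (r (e - 1) + l e) / 2" by (simp add: right_end_def field_simps)
  then show "right_end i e < l e" using g by simp
  show "r (e - 1) < right_end i e" using mult_pos_pos[OF g c(1)] unfolding right_end_def by linarith
qed

lemma left_end_less_right_end:
  assumes "1 \<le> i" "i < e" "e \<le> n"
  shows "left_end i e < right_end i e"
proof -
  have "left_end i e < l i" using left_end_bounds assms by blast
  also have "l i \<le> l (e - 1)" using assms by (intro l_le_l) auto
  also have "l (e - 1) < r (e - 1)" using assms by (intro hole_ord) auto
  also have "\<dots> < right_end i e" using right_end_bounds assms by blast
  finally show ?thesis .
qed

definition curve :: "nat \<Rightarrow> nat \<Rightarrow> complex set" where
  "curve i e = diam_circle (left_end i e) (right_end i e)"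

text \<open>
  If the intervals share an end, the larger interval is given the end of the diameter that is farther out in
  the common gap.
\<close>

lemma curves_disjoint_of_nested:
  assumes v: "1 \<le> i" "i < e" "e \<le> n" and v': "1 \<le> i'" "i' < e'" "e' \<le> n"
    and "i \<le> i'" "e' \<le> e" "i < i' \<or> e' < e"
  shows "curve i e \<inter> curve i' e' = {}"
proof -
  have "left_end i e < left_end i' e'"
  proof (cases "i < i'")
    case True
    have "left_end i e < l i" using left_end_bounds[OF v] by blast
    also have "l i < r i" using v by (intro hole_ord) auto
    also have "r i \<le> r (i' - 1)" using True v' by (intro r_le_r) auto
    also have "\<dots> < left_end i' e'" using left_end_bounds[OF v'] by blast
    finally show ?thesis .
  next
    case False
    then have i: "i' = i" "e' < e" using assms by auto
    have g: "l i - r (i - 1) > 0" using gap_ord[of "i - 1"] v by simp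
    have "real e' / (2 * real n) < real e / (2 * real n)" using i v by (intro divide_strict_right_mono) auto
    from mult_strict_left_mono[OF this g] show ?thesis unfolding left_end_def i(1) by linarith
  qed
  moreover have "right_end i' e' < right_end i e"
  proof (cases "e' < e")
    case True
    have "right_end i' e' < l e'" using right_end_bounds[OF v'] by blast
    also have "l e' < r e'" using True v v' by (intro hole_ord) auto
    also have "r e' \<le> r (e - 1)" using True v by (intro r_le_r) auto
    also have "\<dots> < right_end i e" using right_end_bounds[OF v] by blast
    finally show ?thesis .
  next
    case False
    then have i: "e' = e" "i < i'" using assms by auto
    have g: "l e - r (e - 1) > 0" using gap_ord[of "e - 1"] v by simp
    have "real (n - i') / (2 * real n) < real (n - i) / (2 * real n)" using i v v' by (intro divide_strict_right_mono) auto
    from mult_strict_left_mono[OF this g] show ?thesis unfolding right_end_def i(1) by linarith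
  qed
  ultimately have "diam_cdisc (left_end i' e') (right_end i' e') \<subseteq> diam_disc (left_end i e) (right_end i e)"
    using left_end_less_right_end[OF v'] by (intro diam_cdisc_nested) auto
  then show ?thesis unfolding curve_def diam_circle_eq by blast
qed

text \<open>
  If one interval begins where the other ends, the two diameters have ends in different halves of the
  common gap.
\<close>

lemma curves_disjoint_of_consecutive:
  assumes v: "1 \<le> i" "i < e" "e \<le> n" and v': "1 \<le> i'" "i' < e'" "e' \<le> n" and "e \<le> i'"
  shows "curve i e \<inter> curve i' e' = {}"
proof -
  have "right_end i e < left_end i' e'"
  proof (cases "e = i'")
    case True
    have "right_end i e < (r (e - 1) + l e) / 2" using right_end_bounds[OF v] by blast
    also have "\<dots> \<le> left_end i' e'" using left_end_bounds[OF v'] True by simp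
    finally show ?thesis .
  next
    case False
    have "right_end i e < l e" using right_end_bounds[OF v] by blast
    also have "l e < r e" using False assms by (intro hole_ord) auto
    also have "r e \<le> r (i' - 1)" using False assms by (intro r_le_r) auto
    also have "\<dots> < left_end i' e'" using left_end_bounds[OF v'] by blast
    finally show ?thesis .
  qed
  then have "diam_cdisc (left_end i e) (right_end i e) \<inter> diam_cdisc (left_end i' e') (right_end i' e') = {}"
    using left_end_less_right_end[OF v] left_end_less_right_end[OF v'] by (intro diam_cdisc_disjoint) auto
  then show ?thesis unfolding curve_def diam_circle_eq by blast
qed

lemma holes_of_curve:
  assumes v: "1 \<le> i" "i < e" "e \<le> n"
  shows "k \<in> {i..<e} \<Longrightarrow> diam_cdisc (l k) (r k) \<subseteq> diam_disc (left_end i e) (right_end i e)"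
    "k \<in> {1..<n} \<Longrightarrow> k \<notin> {i..<e} \<Longrightarrow> diam_cdisc (l k) (r k) \<inter> diam_cdisc (left_end i e) (right_end i e) = {}"
proof -
  note b = left_end_bounds[OF v] right_end_bounds[OF v] left_end_less_right_end[OF v]
  show "diam_cdisc (l k) (r k) \<subseteq> diam_disc (left_end i e) (right_end i e)" if k: "k \<in> {i..<e}"
  proof (rule diam_cdisc_nested)
    have "l i \<le> l k" using k v by (intro l_le_l) auto
    then show "left_end i e < l k" using b(3) by linarith
    show "l k < r k" using k v by (intro hole_ord) auto
    have "r k \<le> r (e - 1)" using k v by (intro r_le_r) auto
    then show "r k < right_end i e" using b(6) by linarith
  qed
  show "diam_cdisc (l k) (r k) \<inter> diam_cdisc (left_end i e) (right_end i e) = {}" if k: "k \<in> {1..<n}" "k \<notin> {i..<e}"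
  proof (cases "k < i")
    case True
    then have "r k \<le> r (i - 1)" using v by (intro r_le_r) auto
    then have "r k < left_end i e" using b(2) by linarith
    then show ?thesis using hole_ord[OF k(1)] b(7) by (intro diam_cdisc_disjoint)
  next
    case False
    then have "l e \<le> l k" using k v by (intro l_le_l) auto
    then have "right_end i e < l k" using b(5) by linarith
    then show ?thesis using diam_cdisc_disjoint[OF b(7) _ hole_ord[OF k(1)]] by blast
  qed
qed

lemma curve_subset_surface:
  assumes v: "1 \<le> i" "i < e" "e \<le> n"
  shows "curve i e \<subseteq> surface"
proof -
  note b = left_end_bounds[OF v] right_end_bounds[OF v] left_end_less_right_end[OF v]
  have "r 0 \<le> r (i - 1)" "l e \<le> l n" using v by (auto intro: r_le_r l_le_l)
  then have "r 0 < left_end i e" "right_end i e < l n" using b(2,5) by linarith+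
  then have "diam_cdisc (left_end i e) (right_end i e) \<subseteq> diam_disc (r 0) (l n)"
    using b(7) by (intro diam_cdisc_nested)
  then have "curve i e \<subseteq> diam_cdisc (r 0) (l n)"
    using diam_disc_subset_diam_cdisc unfolding curve_def diam_circle_eq by blast
  moreover have "curve i e \<inter> hole k = {}" if "k \<in> {1..<n}" for k
    using holes_of_curve[OF v, of k] that diam_disc_subset_diam_cdisc unfolding curve_def diam_circle_eq hole_def by blast
  ultimately show ?thesis unfolding surface_def by blast
qed

lemma holes_inside_curve:
  assumes v: "1 \<le> i" "i < e" "e \<le> n"
  shows "holes_inside (curve i e) = {i..<e}"
proof -
  have ins: "inside (curve i e) = diam_disc (left_end i e) (right_end i e)"
    unfolding curve_def by (rule inside_diam_circle[OF left_end_less_right_end[OF v]])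
  have cc: "centre k \<in> diam_cdisc (l k) (r k)" if "k \<in> {1..<n}" for k
    using centre_in_hole[OF that] diam_disc_subset_diam_cdisc unfolding hole_def by blast
  show ?thesis
  proof
    show "holes_inside (curve i e) \<subseteq> {i..<e}"
    proof
      fix k assume "k \<in> holes_inside (curve i e)"
      then have k: "k \<in> {1..<n}" "centre k \<in> diam_disc (left_end i e) (right_end i e)" by (auto simp: holes_inside_def ins)
      then show "k \<in> {i..<e}" using holes_of_curve(2)[OF v k(1)] cc[OF k(1)] diam_disc_subset_diam_cdisc by blast
    qed
    show "{i..<e} \<subseteq> holes_inside (curve i e)"
    proof
      fix k assume k: "k \<in> {i..<e}"
      then have "k \<in> {1..<n}" using v by auto
      then show "k \<in> holes_inside (curve i e)"
        using holes_of_curve(1)[OF v k] cc unfolding holes_inside_def ins by blast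
    qed
  qed
qed

text \<open>
  The number of enclosed holes excludes both possibilities: a curve that bounds a disc encloses none, and a
  peripheral curve encloses at most one or all \<open>n - 1\<close> of them.
\<close>

lemma essential_curve:
  assumes v: "1 \<le> i" "i < e" "e \<le> n" and size: "2 \<le> e - i" "e - i \<le> n - 2"
  shows "essential surface (curve i e)"
proof -
  have "simple_closed_curve surface (curve i e)"
    unfolding simple_closed_curve_iff
    using diam_circle_embedding[OF left_end_less_right_end[OF v]] curve_subset_surface[OF v] by (auto simp: curve_def)
  moreover have "\<not> peripheral surface (curve i e)"
  proof
    assume "peripheral surface (curve i e)"
    then have "card {i..<e} \<le> 1 \<or> card {i..<e} = card {1..<n}"
      using peripheral_holes_inside holes_inside_curve[OF v] by metis
    then show False using size n5 by auto
  qed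
  moreover have "\<not> bounds_disk surface (curve i e)"
    using bounds_disk_holes_inside[of "curve i e"] holes_inside_curve[OF v] v by auto
  ultimately show ?thesis by (simp add: essential_def)
qed

text \<open>
  Two circles whose intervals do not cross are disjoint and enclose different sets of holes, so they receive disjoint sets of
  colours. Hence the intervals that carry a given colour cross pairwise and have total weight at most \<open>1\<close>. Summing over
  the \<open>A\<close> colours counts every weight \<open>B\<close> times.
\<close>

theorem fold_coloring_bound:
  assumes f: "fold_coloring (curve_graph surface) A B f" and "0 < B"
  shows "real n * ln (real n) / 16 \<le> real A / real B"
proof -
  define I where "I = (SIGMA s:{2..n div 2}. {1..n - s})"
  define V where "V = (\<lambda>(s, i). isotopy_rel surface `` {curve i (i + s)})"
  have finI: "finite I" by (simp add: I_def)
  have val: "1 \<le> i" "i < i + s" "i + s \<le> n" "2 \<le> s" "s \<le> n - 2" if "(s, i) \<in> I" for s i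
    using that n5 by (auto simp: I_def)
  have ess: "essential surface (curve i (i + s))" if "(s, i) \<in> I" for s i
    using val[OF that] by (intro essential_curve) auto
  have V: "V p \<in> curve_classes surface" if "p \<in> I" for p
    using curve_class_of_essential(1) ess that by (cases p) (auto simp: V_def)
  have fV: "f (V p) \<subseteq> {..<A}" "card (f (V p)) = B" if "p \<in> I" for p
    using f V[OF that] by (auto simp: fold_coloring_def curve_graph_def)
  have cross: "i < i' \<and> i' < i + s \<and> i + s < i' + s' \<or> i' < i \<and> i < i' + s' \<and> i' + s' < i + s"
    if I: "(s, i) \<in> I" "(s', i') \<in> I" "(s, i) \<noteq> (s', i')" and c: "c \<in> f (V (s, i))" "c \<in> f (V (s', i'))" for s i s' i' c
  proof (rule ccontr)
    assume n: "\<not> ?thesis"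
    note v = val(1-3)[OF I(1)] and v' = val(1-3)[OF I(2)]
    have disj: "curve i (i + s) \<inter> curve i' (i' + s') = {}"
    proof -
      consider "i + s \<le> i'" | "i' + s' \<le> i" | "i \<le> i'" "i' + s' \<le> i + s" | "i' \<le> i" "i + s \<le> i' + s'"
        using n by linarith
      then show ?thesis
      proof cases
        case 1 then show ?thesis using curves_disjoint_of_consecutive[OF v v'] by blast
      next
        case 2 then show ?thesis using curves_disjoint_of_consecutive[OF v' v] by blast
      next
        case 3
        then have "i < i' \<or> i' + s' < i + s" using I(3) by auto
        then show ?thesis using curves_disjoint_of_nested[OF v v' 3] by blast
      next
        case 4
        then have "i' < i \<or> i + s < i' + s'" using I(3) by auto
        then show ?thesis using curves_disjoint_of_nested[OF v' v 4] by blast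
      qed
    qed
    have "V (s, i) \<noteq> V (s', i')"
    proof
      assume "V (s, i) = V (s', i')"
      then have "(curve i (i + s), curve i' (i' + s')) \<in> isotopy_rel surface"
        using curve_class_of_essential(2)[OF ess[OF I(2)]] by (auto simp: V_def)
      then have "{i..<i + s} = {i'..<i' + s'}"
        using isotopic_holes_inside holes_inside_curve[OF v] holes_inside_curve[OF v'] by (auto simp: isotopy_rel_def)
      then show False using I(3) v v' by (simp add: atLeastLessThan_eq_iff)
    qed
    then have "{V (s, i), V (s', i')} \<in> snd (curve_graph surface)"
      using curve_graph_edgeI[OF V[OF I(1)] V[OF I(2)] _ _ _ disj]
        curve_class_of_essential(2)[OF ess[OF I(1)]] curve_class_of_essential(2)[OF ess[OF I(2)]]
      by (simp add: V_def)
    then show False using f c unfolding fold_coloring_def by blast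
  qed
  have "real B * (real n * ln (real n) / 16) \<le> real B * (\<Sum>(s, i)\<in>I. 1 / real s)"
    unfolding I_def using total_interval_weight[OF n5] by (intro mult_left_mono) auto
  also have "\<dots> = (\<Sum>p\<in>I. real B * (1 / real (fst p)))"
    by (simp add: sum_distrib_left case_prod_beta)
  also have "\<dots> = (\<Sum>p\<in>I. \<Sum>c<A. if c \<in> f (V p) then 1 / real (fst p) else 0)"
  proof (rule sum.cong[OF refl])
    fix p assume p: "p \<in> I"
    have "(\<Sum>c<A. if c \<in> f (V p) then 1 / real (fst p) else 0) = (\<Sum>c\<in>{..<A} \<inter> f (V p). 1 / real (fst p))"
      by (rule sum.inter_restrict[symmetric]) simp
    also have "{..<A} \<inter> f (V p) = f (V p)" using fV(1)[OF p] by blast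
    finally show "real B * (1 / real (fst p)) = (\<Sum>c<A. if c \<in> f (V p) then 1 / real (fst p) else 0)"
      using fV(2)[OF p] by simp
  qed
  also have "\<dots> = (\<Sum>c<A. \<Sum>p\<in>I. if c \<in> f (V p) then 1 / real (fst p) else 0)"
    by (rule sum.swap)
  also have "\<dots> \<le> (\<Sum>c<A. 1)"
  proof (rule sum_mono)
    fix c
    define F where "F = {p \<in> I. c \<in> f (V p)}"
    have "(\<Sum>p\<in>I. if c \<in> f (V p) then 1 / real (fst p) else 0) = (\<Sum>(s, i)\<in>F. 1 / real s)"
      unfolding F_def using finI by (simp add: sum.inter_filter case_prod_beta)
    also have "\<dots> \<le> 1"
    proof (rule sum_inverse_size_crossing_intervals)
      show "finite F" using finI by (simp add: F_def)
      show "0 < s" if "(s, i) \<in> F" for s i using that val(4)[of s i] by (simp add: F_def)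
      show "i < i' \<and> i' < i + s \<and> i + s < i' + s' \<or> i' < i \<and> i < i' + s' \<and> i' + s' < i + s"
        if "(s, i) \<in> F" "(s', i') \<in> F" "(s, i) \<noteq> (s', i')" for s i s' i'
        using cross[of s i s' i' c] that by (simp add: F_def)
    qed
    finally show "(\<Sum>p\<in>I. if c \<in> f (V p) then 1 / real (fst p) else 0) \<le> 1" .
  qed
  finally have "real B * (real n * ln (real n) / 16) \<le> real A" by simp
  then show ?thesis using \<open>0 < B\<close> by (simp add: field_simps)
qed

end

section \<open>Stereographic projection\<close>

lemma cot_diff:
  fixes A B :: real
  assumes "sin A \<noteq> 0" "sin B \<noteq> 0"
  shows "cot A - cot B = sin (B - A) / (sin A * sin B)"
  using assms by (simp add: cot_def sin_diff field_simps)

lemma minus_cot_strict_mono: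
  fixes A B :: real
  assumes "0 < A" "A < B" "B < pi"
  shows "- cot A < - cot B"
proof -
  have "sin A > 0" "sin B > 0" "sin (B - A) > 0" using assms by (auto intro: sin_gt_zero)
  then show ?thesis using cot_diff[of A B] by (smt (verit) divide_pos_pos mult_pos_pos)
qed

lemma arcsin_half_inverse_less:
  assumes "5 \<le> (n::nat)"
  shows "0 < arcsin (1 / (2 * real n))" "arcsin (1 / (2 * real n)) < pi / (2 * real n)"
    "sin (arcsin (1 / (2 * real n))) = 1 / (2 * real n)"
proof -
  have n: "real n \<ge> 5" using assms by simp
  show s: "sin (arcsin (1 / (2 * real n))) = 1 / (2 * real n)" using n by (intro sin_arcsin) (auto simp: field_simps)
  define x where "x = pi / (2 * real n)"
  have x: "0 < x" "x \<le> pi / 10" using n by (auto simp: x_def field_simps)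
  have "arcsin 0 < arcsin (1 / (2 * real n))" using n by (intro arcsin_less_arcsin) (auto simp: field_simps)
  then show "0 < arcsin (1 / (2 * real n))" by simp
  have "\<exists>z. z > 0 \<and> z < x \<and> sin x - sin 0 = (x - 0) * cos z"
    using x by (intro MVT2) (auto intro: DERIV_sin)
  then obtain z where z: "0 < z" "z < x" "sin x = x * cos z" by auto
  have "cos (pi / 3) < cos z" using z x by (intro cos_monotone_0_pi) auto
  then have "cos z > 1/2" by (simp add: cos_60)
  then have "x * (1/2) < x * cos z" using x by (intro mult_strict_left_mono) auto
  then have "sin x > x / 2" using z(3) by simp
  moreover have "x / 2 > 1 / (2 * real n)" using pi_gt3 n by (simp add: x_def field_simps)
  ultimately have "1 / (2 * real n) < sin x" by simp
  then have "arcsin (1 / (2 * real n)) < arcsin (sin x)" using n by (intro arcsin_less_arcsin) (auto simp: field_simps)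
  also have "arcsin (sin x) = x" using x by (intro arcsin_sin) auto
  finally show "arcsin (1 / (2 * real n)) < pi / (2 * real n)" by (simp add: x_def)
qed

context
  fixes n :: nat
  assumes n5: "5 \<le> n"
begin

text \<open>
  The removed caps meet the equator in the arcs of angles \<open>2 * (pi * k / n \<plusminus> cap_angle)\<close>, and the projection maps the
  point of the equator at the angle \<open>2 * \<theta>\<close> to \<open>- cot \<theta>\<close>. For the cap around the centre of projection, \<open>k = 0\<close> and
  \<open>k = n\<close> yield the two ends of the diameter of the outer circle.
\<close>

definition cap_angle :: real where "cap_angle = arcsin (1 / (2 * real n))"
definition hole_left :: "nat \<Rightarrow> real" where "hole_left k = - cot (pi * real k / real n - cap_angle)"
definition hole_right :: "nat \<Rightarrow> real" where "hole_right k = - cot (pi * real k / real n + cap_angle)"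

lemma hole_angles:
  assumes "k \<in> {1..<n}"
  shows "0 < pi * real k / real n - cap_angle" "pi * real k / real n + cap_angle < pi"
proof -
  have a: "cap_angle < pi / (2 * real n)" "0 < cap_angle" using arcsin_half_inverse_less[OF n5] by (auto simp: cap_angle_def)
  have np: "0 < real n" using n5 by simp
  have "pi / (2 * real n) < pi / real n" using np by (intro divide_strict_left_mono) auto
  also have "pi / real n \<le> pi * real k / real n" using assms np by (intro divide_right_mono) auto
  finally show "0 < pi * real k / real n - cap_angle" using a by simp
  have "real k \<le> real n - 1" using assms by auto
  then have "pi * real k / real n \<le> pi * (real n - 1) / real n" using np by (intro divide_right_mono mult_left_mono) auto
  also have "\<dots> = pi - pi / real n" using np by (simp add: field_simps)
  also have "\<dots> < pi - pi / (2 * real n)" using \<open>pi / (2 * real n) < pi / real n\<close> by simp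
  finally show "pi * real k / real n + cap_angle < pi" using a by simp
qed

lemma beaded_disc_hole_ends: "beaded_disc n hole_left hole_right"
proof
  have a: "cap_angle < pi / (2 * real n)" "0 < cap_angle" using arcsin_half_inverse_less[OF n5] by (auto simp: cap_angle_def)
  have np: "0 < real n" using n5 by simp
  show "5 \<le> n" by (rule n5)
  show "hole_left k < hole_right k" if "k \<in> {1..<n}" for k
    unfolding hole_left_def hole_right_def using hole_angles[OF that] a by (intro minus_cot_strict_mono) auto
  show "hole_right k < hole_left (Suc k)" if "k < n" for k
    unfolding hole_left_def hole_right_def
  proof (rule minus_cot_strict_mono)
    show "0 < pi * real k / real n + cap_angle" using a np by (simp add: add_nonneg_pos)
    have e: "pi * real (Suc k) / real n = pi * real k / real n + 2 * (pi / (2 * real n))"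
      using np by (simp add: field_simps)
    then show "pi * real k / real n + cap_angle < pi * real (Suc k) / real n - cap_angle" using a by linarith
    have "pi * real (Suc k) / real n \<le> pi * real n / real n" using that np by (intro divide_right_mono mult_left_mono) auto
    then have "pi * real (Suc k) / real n \<le> pi" using np by simp
    then show "pi * real (Suc k) / real n - cap_angle < pi" using a by linarith
  qed
qed

interpretation B: beaded_disc n hole_left hole_right by (rule beaded_disc_hole_ends)

text \<open>
  Stereographic projection from \<open>(1, 0)\<close>, the centre of the hole of index \<open>0\<close>. It maps the equator to the real
  axis.
\<close>

definition stereo :: "complex \<times> real \<Rightarrow> complex" where
  "stereo p = of_real (- Im (fst p) / (1 - Re (fst p))) + \<i> * of_real (snd p / (1 - Re (fst p)))"

definition stereo_inv :: "complex \<Rightarrow> complex \<times> real" where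
  "stereo_inv w = (of_real (((cmod w)\<^sup>2 - 1) / ((cmod w)\<^sup>2 + 1)) + \<i> * of_real (- 2 * Re w / ((cmod w)\<^sup>2 + 1)),
     2 * Im w / ((cmod w)\<^sup>2 + 1))"

lemma in_unit_sphere_iff: "(z, t :: real) \<in> sphere 0 1 \<longleftrightarrow> (Re z)\<^sup>2 + (Im z)\<^sup>2 + t\<^sup>2 = 1"
  by (simp add: norm_prod_def cmod_power2 dist_norm)

lemma stereo_inv_stereo:
  fixes p :: "complex \<times> real"
  assumes "p \<in> sphere 0 1" "Re (fst p) < 1"
  shows "stereo_inv (stereo p) = p"
proof -
  obtain z t where p: "p = (z, t)" by (cases p)
  define x y where "x = Re z" and "y = Im z"
  have s: "x\<^sup>2 + y\<^sup>2 + t\<^sup>2 = 1" "x < 1" using assms(1)[unfolded p in_unit_sphere_iff] assms(2) by (simp_all add: p x_def y_def)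
  have st: "Re (stereo p) = - y / (1 - x)" "Im (stereo p) = t / (1 - x)"
    by (simp_all add: stereo_def p x_def y_def)
  have "(cmod (stereo p))\<^sup>2 = (y\<^sup>2 + t\<^sup>2) / (1 - x)\<^sup>2"
    unfolding cmod_power2 st by (simp add: power_divide add_divide_distrib)
  also have "y\<^sup>2 + t\<^sup>2 = (1 - x) * (1 + x)" using s by (simp add: power2_eq_square algebra_simps)
  also have "(1 - x) * (1 + x) / (1 - x)\<^sup>2 = (1 + x) / (1 - x)" using s by (simp add: power2_eq_square)
  finally have m: "(cmod (stereo p))\<^sup>2 = (1 + x) / (1 - x)" .
  have m1: "(cmod (stereo p))\<^sup>2 + 1 = 2 / (1 - x)" "(cmod (stereo p))\<^sup>2 - 1 = 2 * x / (1 - x)"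
    unfolding m using s by (simp_all add: field_simps)
  show ?thesis
    unfolding stereo_inv_def m1 st using s
    by (simp add: p prod_eq_iff complex_eq_iff x_def[symmetric] y_def[symmetric])
qed

lemma stereo_stereo_inv:
  "stereo_inv w \<in> sphere 0 1" "Re (fst (stereo_inv w)) < 1" "stereo (stereo_inv w) = w"
proof -
  define d where "d = (cmod w)\<^sup>2 + 1"
  have d: "d > 0" by (simp add: d_def add_nonneg_pos)
  have wd: "(Re w)\<^sup>2 + (Im w)\<^sup>2 = d - 1" by (simp add: d_def cmod_power2)
  have si: "Re (fst (stereo_inv w)) = (d - 2) / d" "Im (fst (stereo_inv w)) = - 2 * Re w / d" "snd (stereo_inv w) = 2 * Im w / d"
    by (simp_all add: stereo_inv_def d_def)
  have "((d - 2) / d)\<^sup>2 + (- 2 * Re w / d)\<^sup>2 + (2 * Im w / d)\<^sup>2 = ((d - 2)\<^sup>2 + 4 * ((Re w)\<^sup>2 + (Im w)\<^sup>2)) / d\<^sup>2"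
    by (simp add: power_divide power_mult_distrib add_divide_distrib)
  also have "(d - 2)\<^sup>2 + 4 * ((Re w)\<^sup>2 + (Im w)\<^sup>2) = d\<^sup>2" unfolding wd by (simp add: power2_eq_square algebra_simps)
  finally have "((d - 2) / d)\<^sup>2 + (- 2 * Re w / d)\<^sup>2 + (2 * Im w / d)\<^sup>2 = 1" using d by simp
  then show "stereo_inv w \<in> sphere 0 1"
    using in_unit_sphere_iff[of "fst (stereo_inv w)" "snd (stereo_inv w)", unfolded prod.collapse, unfolded si] by (rule iffD2[rotated])
  show "Re (fst (stereo_inv w)) < 1" using d by (simp add: si)
  have "1 - (d - 2) / d = 2 / d" using d by (simp add: field_simps)
  then show "stereo (stereo_inv w) = w"
    unfolding stereo_def si using d by (simp add: complex_eq_iff)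
qed

text \<open>
  A ball of chordal radius \<open>1 / n\<close> about a point of the unit sphere cuts out the cap of angular radius
  \<open>2 * cap_angle\<close>.
\<close>

lemma in_cap_iff:
  fixes p :: "complex \<times> real"
  assumes "p \<in> sphere 0 1"
  shows "p \<in> ball (cis \<theta>, 0) (1 / real n) \<longleftrightarrow> Re (fst p) * cos \<theta> + Im (fst p) * sin \<theta> > cos (2 * cap_angle)"
proof -
  obtain z t where p: "p = (z, t)" by (cases p)
  have s: "(Re z)\<^sup>2 + (Im z)\<^sup>2 + t\<^sup>2 = 1" using assms(1)[unfolded p in_unit_sphere_iff] .
  have np: "real n > 0" using n5 by simp
  have "p \<in> ball (cis \<theta>, 0) (1 / real n) \<longleftrightarrow> (dist (cis \<theta>, 0) p)\<^sup>2 < (1 / real n)\<^sup>2"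
    unfolding mem_ball using np by (intro iffI power_strict_mono) (auto dest: power2_less_imp_less)
  also have "(dist (cis \<theta>, 0) p)\<^sup>2 = (cos \<theta> - Re z)\<^sup>2 + (sin \<theta> - Im z)\<^sup>2 + t\<^sup>2"
    by (simp add: p dist_prod_def dist_norm cmod_power2)
  also have "\<dots> = ((cos \<theta>)\<^sup>2 + (sin \<theta>)\<^sup>2) + ((Re z)\<^sup>2 + (Im z)\<^sup>2 + t\<^sup>2) - 2 * (Re z * cos \<theta> + Im z * sin \<theta>)"
    by (simp add: power2_eq_square algebra_simps)
  also have "\<dots> = 2 - 2 * (Re z * cos \<theta> + Im z * sin \<theta>)" unfolding s by simp
  also have "2 - 2 * (Re z * cos \<theta> + Im z * sin \<theta>) < (1 / real n)\<^sup>2 \<longleftrightarrow> Re z * cos \<theta> + Im z * sin \<theta> > 1 - (1 / real n)\<^sup>2 / 2"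
  proof -
    have "2 - 2 * X < Y \<longleftrightarrow> X > 1 - Y / 2" for X Y :: real by (auto simp: field_simps)
    then show ?thesis by blast
  qed
  also have "1 - (1 / real n)\<^sup>2 / 2 = cos (2 * cap_angle)"
    using arcsin_half_inverse_less(3)[OF n5] by (simp add: cos_double_sin cap_angle_def power_divide)
  finally show ?thesis by (simp add: p)
qed

text \<open>
  Up to a positive factor, the quadratic form that is negative on the disc with diameter from \<open>- cot A\<close> to
  \<open>- cot B\<close> is the linear form that is negative on the cap centred at the angle \<open>A + B\<close>.
\<close>

lemma stereo_diameter_form:
  fixes p :: "complex \<times> real"
  assumes "p \<in> sphere 0 1" "Re (fst p) < 1" "sin A > 0" "sin B > 0"
  shows "((Re (stereo p) + cot A) * (Re (stereo p) + cot B) + (Im (stereo p))\<^sup>2) * ((1 - Re (fst p)) * (sin A * sin B))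
      = cos (A - B) - Re (fst p) * cos (A + B) - Im (fst p) * sin (A + B)"
proof -
  obtain z t where p: "p = (z, t)" by (cases p)
  define x y where "x = Re z" and "y = Im z"
  have s: "x\<^sup>2 + y\<^sup>2 + t\<^sup>2 = 1" "x < 1" using assms(1)[unfolded p in_unit_sphere_iff] assms(2) by (simp_all add: p x_def y_def)
  define e where "e = 1 - x"
  have e: "e > 0" using s by (simp add: e_def)
  have st: "Re (stereo p) = - y / e" "Im (stereo p) = t / e"
    by (simp_all add: stereo_def p x_def y_def e_def)
  define sA cA sB cB where "sA = sin A" and "cA = cos A" and "sB = sin B" and "cB = cos B"
  have pos: "sA > 0" "sB > 0" using assms by (auto simp: sA_def sB_def)
  have "((- y / e + cA / sA) * (- y / e + cB / sB) + (t / e)\<^sup>2) * (e * (sA * sB))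
      = ((y\<^sup>2 + t\<^sup>2) / e) * (sA * sB) - y * (sA * cB + cA * sB) + e * (cA * cB)"
    using e pos by (simp add: field_simps power2_eq_square)
  also have "y\<^sup>2 + t\<^sup>2 = e * (1 + x)" using s by (simp add: e_def power2_eq_square algebra_simps)
  also have "e * (1 + x) / e = 1 + x" using e by simp
  also have "(1 + x) * (sA * sB) - y * (sA * cB + cA * sB) + e * (cA * cB)
      = (cA * cB + sA * sB) - x * (cA * cB - sA * sB) - y * (sA * cB + cA * sB)"
    by (simp add: e_def algebra_simps)
  finally show ?thesis
    unfolding st cot_def sA_def sB_def cA_def cB_def
    by (simp add: p x_def y_def e_def cos_diff cos_add sin_add)
qed

lemma stereo_in_surface_iff:
  fixes p :: "complex \<times> real"
  assumes p: "p \<in> sphere 0 1" "Re (fst p) < 1"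
  shows "stereo p \<in> B.surface \<longleftrightarrow> p \<in> std_holed_sphere n"
proof -
  have a: "cap_angle < pi / (2 * real n)" "0 < cap_angle" using arcsin_half_inverse_less[OF n5] by (auto simp: cap_angle_def)
  have np: "0 < real n" using n5 by simp
  have "pi / (2 * real n) < pi / 1" using np n5 by (intro divide_strict_left_mono) auto
  then have "cap_angle < pi" using a by simp
  then have sa: "sin cap_angle > 0" using a by (intro sin_gt_zero)
  have sgn_lt: "q < 0 \<longleftrightarrow> q * d < 0" and sgn_le: "q \<le> 0 \<longleftrightarrow> q * d \<le> 0" if "d > 0" for q d :: real
    using that by (auto simp: mult_less_0_iff mult_le_0_iff)
  define c where "c = cos (2 * cap_angle)"
  define g where "g = (\<lambda>k::nat. Re (fst p) * cos (2 * pi * real k / real n) + Im (fst p) * sin (2 * pi * real k / real n))"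
  have hole: "stereo p \<in> B.hole k \<longleftrightarrow> g k > c" if k: "k \<in> {1..<n}" for k
  proof -
    define A B where "A = pi * real k / real n - cap_angle" and "B = pi * real k / real n + cap_angle"
    have AB: "0 < A" "B < pi" "A < B" using hole_angles[OF k] a by (auto simp: A_def B_def)
    then have s: "sin A > 0" "sin B > 0" by (auto intro: sin_gt_zero)
    have sum: "A + B = 2 * pi * real k / real n" "A - B = - (2 * cap_angle)" by (simp_all add: A_def B_def)
    have pos: "(1 - Re (fst p)) * (sin A * sin B) > 0" using p s by simp
    let ?q = "(Re (stereo p) + cot A) * (Re (stereo p) + cot B) + (Im (stereo p))\<^sup>2"
    have "stereo p \<in> B.hole k \<longleftrightarrow> ?q < 0"
      unfolding B.hole_def using in_diam_disc_iff[OF B.hole_ord[OF k]] by (simp add: hole_left_def hole_right_def A_def B_def)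
    also have "\<dots> \<longleftrightarrow> ?q * ((1 - Re (fst p)) * (sin A * sin B)) < 0"
      using sgn_lt pos by blast
    also have "?q * ((1 - Re (fst p)) * (sin A * sin B)) = c - g k"
      unfolding stereo_diameter_form[OF p s] sum by (simp add: c_def g_def)
    finally show ?thesis by simp
  qed
  have outer: "stereo p \<in> diam_cdisc (hole_right 0) (hole_left n) \<longleftrightarrow> \<not> g 0 > c"
  proof -
    define A B where "A = cap_angle" and "B = pi - cap_angle"
    have s: "sin A > 0" "sin B > 0" using sa by (simp_all add: A_def B_def)
    have sum: "A + B = pi" by (simp add: A_def B_def)
    have dif: "cos (A - B) = - c"
    proof -
      have "A - B = - (pi - 2 * cap_angle)" by (simp add: A_def B_def)
      then have "cos (A - B) = cos (pi - 2 * cap_angle)" by (simp only: cos_minus)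
      also have "\<dots> = - c" by (simp add: c_def cos_diff)
      finally show ?thesis .
    qed
    have pos: "(1 - Re (fst p)) * (sin A * sin B) > 0" using p s by simp
    let ?q = "(Re (stereo p) + cot A) * (Re (stereo p) + cot B) + (Im (stereo p))\<^sup>2"
    have "stereo p \<in> diam_cdisc (hole_right 0) (hole_left n) \<longleftrightarrow> ?q \<le> 0"
      using in_diam_cdisc_iff[OF B.outer_ord] np by (simp add: hole_left_def hole_right_def A_def B_def)
    also have "\<dots> \<longleftrightarrow> ?q * ((1 - Re (fst p)) * (sin A * sin B)) \<le> 0"
      using sgn_le pos by blast
    also have "?q * ((1 - Re (fst p)) * (sin A * sin B)) = g 0 - c"
      unfolding stereo_diameter_form[OF p s] sum dif by (simp add: g_def)
    finally show ?thesis by auto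
  qed
  have "p \<in> std_holed_sphere n \<longleftrightarrow> (\<forall>k<n. \<not> g k > c)"
    using p(1) in_cap_iff[OF p(1)] by (auto simp: std_holed_sphere_def g_def c_def)
  also have "\<dots> \<longleftrightarrow> \<not> g 0 > c \<and> (\<forall>k\<in>{1..<n}. \<not> g k > c)"
  proof -
    have "{..<n} = insert 0 {1..<n}" using n5 by auto
    moreover have "(\<forall>k<n. \<not> g k > c) \<longleftrightarrow> (\<forall>k\<in>{..<n}. \<not> g k > c)" by auto
    ultimately show ?thesis by (simp only: ball_simps)
  qed
  also have "\<dots> \<longleftrightarrow> stereo p \<in> diam_cdisc (hole_right 0) (hole_left n) \<and> (\<forall>k\<in>{1..<n}. stereo p \<notin> B.hole k)"
    unfolding outer by (intro conj_cong ball_cong refl) (simp only: hole)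
  also have "\<dots> \<longleftrightarrow> stereo p \<in> B.surface" unfolding B.surface_def Diff_iff UN_iff bex_simps by (simp only: ball_simps bex_simps)
  finally show ?thesis by (rule sym)
qed

theorem std_holed_sphere_homeomorphic_beaded_disc: "std_holed_sphere n homeomorphic B.surface"
proof -
  have north: "Re (fst p) < 1" if "p \<in> std_holed_sphere n" for p
  proof -
    have s: "p \<in> sphere 0 1" using that by (simp add: std_holed_sphere_def)
    have "p \<notin> ball (cis (2 * pi * real 0 / real n), 0) (1 / real n)"
    proof
      assume b: "p \<in> ball (cis (2 * pi * real 0 / real n), 0) (1 / real n)"
      have z: "0 \<in> {..<n}" using n5 by simp
      have "p \<in> (\<Union>k<n. ball (cis (2 * pi * real k / real n), 0) (1 / real n))"
        by (rule UN_I[OF z]) (rule b)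
      then show False using that unfolding std_holed_sphere_def by (simp only: Diff_iff not_True_eq_False simp_thms)
    qed
    then have "Re (fst p) \<le> cos (2 * cap_angle)" using in_cap_iff[OF s, of 0] by simp
    moreover have "cos (2 * cap_angle) < 1"
      using arcsin_half_inverse_less[OF n5] n5 by (simp add: cos_double_sin cap_angle_def)
    ultimately show ?thesis by simp
  qed
  have sph: "p \<in> sphere 0 1" if "p \<in> std_holed_sphere n" for p using that by (simp add: std_holed_sphere_def)
  have "homeomorphism (std_holed_sphere n) B.surface stereo stereo_inv"
  proof (rule homeomorphismI)
    show "continuous_on (std_holed_sphere n) stereo"
      unfolding stereo_def using north by (intro continuous_intros) (auto dest: north)
    have "(cmod w)\<^sup>2 + 1 \<noteq> 0" for w by (smt (verit) zero_le_power2)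
    then show "continuous_on B.surface stereo_inv"
      unfolding stereo_inv_def by (intro continuous_intros) auto
    show "stereo ` std_holed_sphere n \<subseteq> B.surface" using stereo_in_surface_iff sph north by blast
    show "stereo_inv ` B.surface \<subseteq> std_holed_sphere n"
      using stereo_in_surface_iff[OF stereo_stereo_inv(1,2)] stereo_stereo_inv(3) by auto
    show "stereo_inv (stereo p) = p" if "p \<in> std_holed_sphere n" for p
      using stereo_inv_stereo sph north that by blast
    show "stereo (stereo_inv w) = w" for w by (rule stereo_stereo_inv(3))
  qed
  then show ?thesis by (auto simp: homeomorphic_def)
qed

end

section \<open>The order of growth\<close>

theorem theorem1p2:
  "bigTheta_on {(n, S). 5 \<le> n \<and> holed_sphere n S}
     (\<lambda>(n, S). fractional_chromatic_number (curve_graph S))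
     (\<lambda>(n, S). ereal (real n * ln (real n))) \<and>
   bigTheta_on {(n, S). 5 \<le> n \<and> holed_sphere n S}
     (\<lambda>(n, S). ereal_of_enat (chromatic_number (curve_graph S)))
     (\<lambda>(n, S). ereal (real n * ln (real n)))"
proof -
  have colouring: "\<exists>k f. proper_coloring (curve_graph S) k f \<and> real k \<le> 3 * (real n * ln (real n))"
    and bound: "0 < b \<Longrightarrow> fold_coloring (curve_graph S) a b g \<Longrightarrow> real n * ln (real n) / 16 \<le> real a / real b"
    if n5: "5 \<le> n" and S: "holed_sphere n S" for n S a b g
  proof -
    interpret B: beaded_disc n "hole_left n" "hole_right n" by (rule beaded_disc_hole_ends[OF n5])
    have hom: "S homeomorphic B.surface"
      using S std_holed_sphere_homeomorphic_beaded_disc[OF n5] homeomorphic_trans unfolding holed_sphere_def by blast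
    obtain h where h: "graph_hom (curve_graph S) (curve_graph B.surface) h"
      using homeomorphic_curve_graph_hom[OF hom] by blast
    obtain h' where h': "graph_hom (curve_graph B.surface) (curve_graph S) h'"
      using homeomorphic_curve_graph_hom homeomorphic_sym hom by blast
    let ?L = "nat \<lfloor>log 2 (real n)\<rfloor>"
    obtain f where "proper_coloring (curve_graph B.surface) (n * (?L + 1)) f"
      using B.proper_coloring_exists by blast
    then have f: "proper_coloring (curve_graph S) (n * (?L + 1)) (f \<circ> h)"
      using proper_coloring_comp[OF h] by blast
    have n: "real n \<ge> 5" using n5 by simp
    have "exp 1 \<le> real n" using exp_le n by linarith
    then have ln1: "1 \<le> ln (real n)" using n by (simp add: ln_ge_iff)
    have "real ?L \<le> log 2 (real n)" using n by simp
    also have "log 2 (real n) = ln (real n) / ln 2" by (simp add: log_def)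
    also have "\<dots> \<le> ln (real n) / (2/3)"
      using ln2_ge_two_thirds ln1 by (intro divide_left_mono) auto
    finally have "real ?L + 1 \<le> 3 * ln (real n)" using ln1 by simp
    then have "real n * (real ?L + 1) \<le> real n * (3 * ln (real n))" using n by (intro mult_left_mono) auto
    then have "real (n * (?L + 1)) \<le> 3 * (real n * ln (real n))" by (simp add: algebra_simps)
    then show "\<exists>k f. proper_coloring (curve_graph S) k f \<and> real k \<le> 3 * (real n * ln (real n))"
      using f by blast
    show "real n * ln (real n) / 16 \<le> real a / real b" if "0 < b" "fold_coloring (curve_graph S) a b g"
      using B.fold_coloring_bound[OF fold_coloring_comp[OF h' that(2)] that(1)] .
  qed
  have frac_le: "fractional_chromatic_number G \<le> ereal (real k)" if "proper_coloring G k f" for G :: "'v sgraph" and k f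
  proof -
    have "(k, 1) \<in> {(a, b). 0 < b \<and> (\<exists>f. fold_coloring G a b f)}"
      using fold_coloring_of_proper_coloring[OF that] by auto
    then show ?thesis unfolding fractional_chromatic_number_def by (rule INF_lower2) simp
  qed
  have chi_le: "ereal_of_enat (chromatic_number G) \<le> ereal (real k)" if "proper_coloring G k f" for G :: "'v sgraph" and k f
  proof -
    have "chromatic_number G \<le> enat k" unfolding chromatic_number_def using that by (intro INF_lower) auto
    then have "ereal_of_enat (chromatic_number G) \<le> ereal_of_enat (enat k)" by (simp only: ereal_of_enat_le_iff)
    then show ?thesis by simp
  qed
  have chi_ge: "fractional_chromatic_number G \<le> ereal_of_enat (chromatic_number G)" for G :: "'v sgraph"
  proof (cases "chromatic_number G")
    case (enat m)
    then have "chromatic_number G < enat (Suc m)" by simp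
    then obtain k f where k: "proper_coloring G k f" "enat k < enat (Suc m)"
      unfolding chromatic_number_def INF_less_iff by blast
    have "ereal (real k) \<le> ereal (real m)" using k(2) by simp
    with frac_le[OF k(1)] have "fractional_chromatic_number G \<le> ereal (real m)" by (rule order_trans)
    then show ?thesis by (simp add: enat)
  qed simp
  have frac_ge: "ereal (real n * ln (real n)) \<le> ereal 16 * fractional_chromatic_number (curve_graph S)"
    if n5: "5 \<le> n" and S: "holed_sphere n S" for n S
  proof -
    have "ereal (real n * ln (real n) / 16) \<le> fractional_chromatic_number (curve_graph S)"
      unfolding fractional_chromatic_number_def
    proof (rule INF_greatest, clarify)
      fix a b g assume "0 < b" "fold_coloring (curve_graph S) a b g"
      then show "ereal (real n * ln (real n) / 16) \<le> ereal (real a / real b)"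
        using bound[OF n5 S] by simp
    qed
    then have "ereal 16 * ereal (real n * ln (real n) / 16) \<le> ereal 16 * fractional_chromatic_number (curve_graph S)"
      by (rule ereal_mult_left_mono) simp
    then show ?thesis by simp
  qed
  have up: "bigO_on {(n, S). 5 \<le> n \<and> holed_sphere n S} F (\<lambda>(n, S). ereal (real n * ln (real n)))"
    if F: "\<And>n S k f. proper_coloring (curve_graph S) k f \<Longrightarrow> F (n, S) \<le> ereal (real k)" for F
    unfolding bigO_on_def
  proof (intro exI[of _ 3] conjI ballI)
    fix x assume "x \<in> {(n, S). 5 \<le> n \<and> holed_sphere n S}"
    then obtain n S where x: "x = (n, S)" "5 \<le> n" "holed_sphere n S" by auto
    obtain k f where k: "proper_coloring (curve_graph S) k f" "real k \<le> 3 * (real n * ln (real n))"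
      using colouring[OF x(2,3)] by blast
    have "F x \<le> ereal (real k)" using F[OF k(1)] x(1) by simp
    also have "\<dots> \<le> ereal 3 * ereal (real n * ln (real n))" using k(2) by simp
    finally show "F x \<le> ereal 3 * (case x of (n, S) \<Rightarrow> ereal (real n * ln (real n)))" by (simp add: x(1))
  qed simp
  have low: "bigO_on {(n, S). 5 \<le> n \<and> holed_sphere n S} (\<lambda>(n, S). ereal (real n * ln (real n))) F"
    if F: "\<And>n S. fractional_chromatic_number (curve_graph S) \<le> F (n, S)" for F
    unfolding bigO_on_def
  proof (intro exI[of _ 16] conjI ballI)
    fix x assume "x \<in> {(n, S). 5 \<le> n \<and> holed_sphere n S}"
    then obtain n S where x: "x = (n, S)" "5 \<le> n" "holed_sphere n S" by auto
    have "ereal (real n * ln (real n)) \<le> ereal 16 * fractional_chromatic_number (curve_graph S)"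
      by (rule frac_ge[OF x(2,3)])
    also have "\<dots> \<le> ereal 16 * F x" unfolding x(1) by (rule ereal_mult_left_mono[OF F]) simp
    finally show "(case x of (n, S) \<Rightarrow> ereal (real n * ln (real n))) \<le> ereal 16 * F x" by (simp add: x(1))
  qed simp
  show ?thesis
    unfolding bigTheta_on_def
    by (intro conjI up low) (simp_all add: frac_le chi_le chi_ge)
qed


end
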